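(* For any $(x_1,x_2)\in\mathbb{C}^2$ with $x_1\neq0$ there exists a unique, up to unitary equivalence, well-behaved irreducible representation of $A_{x_1,x_2}$; it acts on $l_2(\mathbb{Z}_+)^{\otimes3}$ and is defined on the generators by $$a_1=a\otimes\mathbf1\otimes\mathbf1,$$ $$a_2=\sqrt{1+\tfrac{|x_2|^2}{|x_1|^2}}\;\mathbf1\otimes\mathbf1\otimes a-\frac{x_2}{|x_1|}\mathbf1\otimes a^*\otimes\mathbf1+\frac{\overline{x}_1}{2}\mathbf1\otimes a^2\otimes\mathbf1+|x_1|\,a^*\otimes a\otimes\mathbf1+\frac{x_1}{2}(a^* )^2\otimes\mathbf1\otimes\mathbf1,$$ $$A=|x_1|\,\mathbf1\otimes a\otimes\mathbf1+x_1\,a^*\otimes\mathbf1\otimes\mathbf1.$$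
   Context: $A_{x_1,x_2}$ is the unital $*$-algebra generated by $a_1,a_2,A$ with relations $a_i^*a_i-a_ia_i^*=1$ ($i=1,2$), $a_1^*a_2=a_2a_1^*$, $A=a_2a_1-a_1a_2$, $Aa_i-a_iA=x_i1$, $a_i^*A=Aa_i^*$ ($i=1,2$). $A_3$ is the unital $*$-algebra of the CCR with three degrees of freedom, generated by $c_1,c_2,c_3$ with $c_i^*c_i-c_ic_i^*=1$ for all $i$ and $c_i^*c_j=c_jc_i^*$, $c_ic_j=c_jc_i$ for $i\ne j$. For $x_1\ne0$ there is a $*$-isomorphism $A_{x_1,x_2}\to A_3$ given by $a_1\mapsto c_1$, $A\mapsto|x_1|c_2+x_1c_1^*$, $a_2\mapsto\bigl(1+\frac{|x_2|^2}{|x_1|^2}\bigr)^{1/2}c_3-\frac{x_2}{|x_1|}c_2^*+\frac{\overline{x}_1}{2}c_2^2+|x_1|c_1^*c_2+\frac{x_1}{2}(c_1^* )^2$. A (generally unbounded) $*$-representation of $A_3$ is well-behaved if it is integrable, i.e. it is the differential, on the space of smooth vectors, of a strongly continuous unitary representation of the (7-dimensional) Heisenberg Lie group. A $*$-representation of $A_{x_1,x_2}$ is well-behaved if the representation of $A_3$ corresponding to it under the $*$-isomorphism $A_{x_1,x_2}\to A_3$ with $a_1\mapsto c_1$, $A\mapsto|x_1|c_2+x_1c_1^*$, $a_2\mapsto\bigl(1+\frac{|x_2|^2}{|x_1|^2}\bigr)^{1/2}c_3-\frac{x_2}{|x_1|}c_2^*+\frac{\overline{x}_1}{2}c_2^2+|x_1|c_1^*c_2+\frac{x_1}{2}(c_1^*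 )^2$ is well-behaved. $l_2(\mathbb{Z}_+)$ has standard orthonormal basis $\{e_n\}_{n\ge0}$, and $a e_n=\sqrt{n+1}\,e_{n+1}$, so $a^*e_n=\sqrt{n}\,e_{n-1}$ and $a^*e_0=0$; the formulas are understood on the corresponding domain of smooth vectors (rapidly decreasing sequences). *)

theory Defs
  imports
    "HOL-Analysis.Analysis"
    "HOL-Library.Poly_Mapping"
    "HOL-Algebra.QuotRing"
    "HOL-Algebra.Module"
begin

section \<open>Complex Hilbert spaces\<close>

class complex_hilbert = banach +
  fixes scaleC :: "complex \<Rightarrow> 'a \<Rightarrow> 'a" (infixr \<open>*\<^sub>C\<close> 75)
    and cinner :: "'a \<Rightarrow> 'a \<Rightarrow> complex"
  assumes scaleC_add_right: "c *\<^sub>C (x + y) = c *\<^sub>C x + c *\<^sub>C y"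
    and scaleC_add_left: "(c + d) *\<^sub>C x = c *\<^sub>C x + d *\<^sub>C x"
    and scaleC_scaleC: "c *\<^sub>C d *\<^sub>C x = (c * d) *\<^sub>C x"
    and scaleC_of_real: "complex_of_real r *\<^sub>C x = r *\<^sub>R x"
    and cinner_add_left: "cinner (x + y) z = cinner x z + cinner y z"
    and cinner_scaleC_left: "cinner (c *\<^sub>C x) y = c * cinner x y"
    and cinner_commute: "cinner x y = cnj (cinner y x)"
    and cinner_self: "cinner x x = complex_of_real ((norm x)\<^sup>2)"

definition csubspace :: "'h::complex_hilbert set \<Rightarrow> bool" where
  "csubspace D \<longleftrightarrow> 0 \<in> D \<and> (\<forall>x\<in>D. \<forall>y\<in>D. x + y \<in> D) \<and> (\<forall>c. \<forall>x\<in>D. c *\<^sub>C x \<in> D)"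

definition unitary :: "('h::complex_hilbert \<Rightarrow> 'k::complex_hilbert) \<Rightarrow> bool" where
  "unitary W \<longleftrightarrow> (\<forall>x y. W (x + y) = W x + W y) \<and> (\<forall>c x. W (c *\<^sub>C x) = c *\<^sub>C W x) \<and>
     (\<forall>x y. cinner (W x) (W y) = cinner x y) \<and> surj W"


section \<open>The Hilbert space of square-summable families\<close>

typedef 'i ell2 = "{f :: 'i \<Rightarrow> complex. (\<lambda>i. (cmod (f i))\<^sup>2) summable_on UNIV}"
  morphisms coord Abs_ell2
  by (rule exI[of _ "\<lambda>_. 0"]) simp

setup_lifting type_definition_ell2

lemma square_summable_add:
  fixes f g :: "'i \<Rightarrow> complex"
  assumes "(\<lambda>i. (cmod (f i))\<^sup>2) summable_on UNIV" "(\<lambda>i. (cmod (g i))\<^sup>2) summable_on UNIV"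
  shows "(\<lambda>i. (cmod (f i + g i))\<^sup>2) summable_on UNIV"
proof (rule summable_on_comparison_test)
  show "(\<lambda>i. 2 * (cmod (f i))\<^sup>2 + 2 * (cmod (g i))\<^sup>2) summable_on UNIV"
    by (intro summable_on_add summable_on_cmult_right assms)
next
  fix i
  have "(cmod (f i + g i))\<^sup>2 \<le> (cmod (f i) + cmod (g i))\<^sup>2"
    by (intro power_mono norm_triangle_ineq norm_ge_zero)
  also have "\<dots> \<le> 2 * (cmod (f i))\<^sup>2 + 2 * (cmod (g i))\<^sup>2"
    using sum_squares_bound[of "cmod (f i)" "cmod (g i)"] by (simp add: power2_sum)
  finally show "(cmod (f i + g i))\<^sup>2 \<le> 2 * (cmod (f i))\<^sup>2 + 2 * (cmod (g i))\<^sup>2" .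
qed simp

lemma square_summable_scale:
  fixes f :: "'i \<Rightarrow> complex"
  assumes "(\<lambda>i. (cmod (f i))\<^sup>2) summable_on UNIV"
  shows "(\<lambda>i. (cmod (c * f i))\<^sup>2) summable_on UNIV"
  by (simp add: norm_mult power_mult_distrib summable_on_cmult_right assms)

lemma square_summable_prod:
  fixes f g :: "'i \<Rightarrow> complex"
  assumes "(\<lambda>i. (cmod (f i))\<^sup>2) summable_on UNIV" "(\<lambda>i. (cmod (g i))\<^sup>2) summable_on UNIV"
  shows "(\<lambda>i. f i * cnj (g i)) summable_on UNIV"
proof (rule abs_summable_summable, rule summable_on_comparison_test)
  show "(\<lambda>i. (cmod (f i))\<^sup>2 + (cmod (g i))\<^sup>2) summable_on UNIV"
    by (intro summable_on_add assms)
next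
  fix i
  show "norm (f i * cnj (g i)) \<le> (cmod (f i))\<^sup>2 + (cmod (g i))\<^sup>2"
    using sum_squares_bound[of "cmod (f i)" "cmod (g i)"]
      mult_nonneg_nonneg[OF norm_ge_zero[of "f i"] norm_ge_zero[of "g i"]]
    unfolding norm_mult complex_mod_cnj by linarith
qed simp

instantiation ell2 :: (type) ab_group_add
begin

lift_definition zero_ell2 :: "'a ell2" is "\<lambda>_. 0" by simp
lift_definition plus_ell2 :: "'a ell2 \<Rightarrow> 'a ell2 \<Rightarrow> 'a ell2" is "\<lambda>f g i. f i + g i"
  by (rule square_summable_add)
lift_definition uminus_ell2 :: "'a ell2 \<Rightarrow> 'a ell2" is "\<lambda>f i. - f i" by simp
lift_definition minus_ell2 :: "'a ell2 \<Rightarrow> 'a ell2 \<Rightarrow> 'a ell2" is "\<lambda>f g i. f i - g i"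
  using square_summable_add[of _ "\<lambda>i. - _ i"] by simp

instance
  by standard (transfer; simp add: fun_eq_iff algebra_simps)+

end

lemma coord_ell2:
  "coord 0 i = 0" "coord (f + g) i = coord f i + coord g i"
  "coord (f - g) i = coord f i - coord g i" "coord (- f) i = - coord f i"
  by (transfer; simp)+

lemma coord_square_summable: "(\<lambda>i. (cmod (coord f i))\<^sup>2) summable_on UNIV"
  using coord[of f] by simp

lemma ell2_eqI: "(\<And>i. coord f i = coord g i) \<Longrightarrow> f = g"
  by (metis coord_inject ext)

instantiation ell2 :: (type) real_normed_vector
begin

lift_definition scaleR_ell2 :: "real \<Rightarrow> 'a ell2 \<Rightarrow> 'a ell2" is "\<lambda>r f i. complex_of_real r * f i"
  by (rule square_summable_scale)

definition norm_ell2 :: "'a ell2 \<Rightarrow> real" where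
  "norm_ell2 f = sqrt (\<Sum>\<^sub>\<infinity>i. (cmod (coord f i))\<^sup>2)"

definition dist_ell2 :: "'a ell2 \<Rightarrow> 'a ell2 \<Rightarrow> real" where
  "dist_ell2 f g = norm (f - g)"

definition sgn_ell2 :: "'a ell2 \<Rightarrow> 'a ell2" where
  "sgn_ell2 f = inverse (norm f) *\<^sub>R f"

definition uniformity_ell2 :: "('a ell2 \<times> 'a ell2) filter" where
  "uniformity_ell2 = (INF e\<in>{0<..}. principal {(f, g). dist f g < e})"

definition open_ell2 :: "'a ell2 set \<Rightarrow> bool" where
  "open_ell2 U \<longleftrightarrow> (\<forall>x\<in>U. eventually (\<lambda>(x', y). x' = x \<longrightarrow> y \<in> U) uniformity)"

lemma coord_scaleR: "coord (r *\<^sub>R f) i = complex_of_real r * coord f i"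
  by transfer simp

lemma norm_ell2_square: "(norm (f :: 'a ell2))\<^sup>2 = (\<Sum>\<^sub>\<infinity>i. (cmod (coord f i))\<^sup>2)"
  unfolding norm_ell2_def by (simp add: infsum_nonneg)

lemma L2_set_le_norm_ell2:
  "finite F \<Longrightarrow> L2_set (\<lambda>i. cmod (coord f i)) F \<le> norm (f :: 'a ell2)"
  unfolding L2_set_def norm_ell2_def
  by (intro real_sqrt_le_mono finite_sum_le_infsum coord_square_summable) auto

lemma norm_ell2_leI:
  fixes f :: "'a ell2"
  assumes "\<And>F. finite F \<Longrightarrow> L2_set (\<lambda>i. cmod (coord f i)) F \<le> B"
  shows "norm f \<le> B"
proof -
  have B: "B \<ge> 0" using assms[of "{}"] by simp
  have "(\<Sum>\<^sub>\<infinity>i. (cmod (coord f i))\<^sup>2) \<le> B\<^sup>2"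
  proof (rule infsum_le_finite_sums[OF coord_square_summable])
    fix F :: "'a set" assume "finite F"
    then have "sqrt (\<Sum>i\<in>F. (cmod (coord f i))\<^sup>2) \<le> B"
      using assms by (simp add: L2_set_def)
    then show "(\<Sum>i\<in>F. (cmod (coord f i))\<^sup>2) \<le> B\<^sup>2"
      by (metis real_sqrt_le_iff real_sqrt_unique B)
  qed
  then show ?thesis
    unfolding norm_ell2_def using B by (simp add: real_le_lsqrt)
qed

instance
proof
  fix f g :: "'a ell2" and r s :: real
  show "dist f g = norm (f - g)" by (rule dist_ell2_def)
  show "sgn f = inverse (norm f) *\<^sub>R f" by (rule sgn_ell2_def)
  show "(uniformity :: ('a ell2 \<times> 'a ell2) filter) =
      (INF e\<in>{0<..}. principal {(f, g). dist f g < e})" by (rule uniformity_ell2_def)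
  show "open U \<longleftrightarrow> (\<forall>x\<in>U. \<forall>\<^sub>F (x', y) in uniformity. x' = x \<longrightarrow> y \<in> U)" for U :: "'a ell2 set"
    by (rule open_ell2_def)
  show "r *\<^sub>R (f + g) = r *\<^sub>R f + r *\<^sub>R g" "(r + s) *\<^sub>R f = r *\<^sub>R f + s *\<^sub>R f"
    "r *\<^sub>R s *\<^sub>R f = (r * s) *\<^sub>R f" "1 *\<^sub>R f = f"
    by (rule ell2_eqI; simp add: coord_scaleR coord_ell2 algebra_simps)+
  show "norm f = 0 \<longleftrightarrow> f = 0"
  proof
    assume "norm f = 0"
    then have "cmod (coord f i) \<le> 0" for i
      using L2_set_le_norm_ell2[of "{i}" f] by simp
    then show "f = 0" by (intro ell2_eqI) (simp add: coord_ell2)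
  qed (simp add: norm_ell2_def coord_ell2)
  show "norm (f + g) \<le> norm f + norm g"
  proof (rule norm_ell2_leI)
    fix F :: "'a set" assume F: "finite F"
    have "L2_set (\<lambda>i. cmod (coord (f + g) i)) F
        \<le> L2_set (\<lambda>i. cmod (coord f i) + cmod (coord g i)) F"
      by (intro L2_set_mono) (auto simp: coord_ell2 norm_triangle_ineq)
    also have "\<dots> \<le> L2_set (\<lambda>i. cmod (coord f i)) F + L2_set (\<lambda>i. cmod (coord g i)) F"
      by (rule L2_set_triangle_ineq)
    also have "\<dots> \<le> norm f + norm g"
      using F by (intro add_mono L2_set_le_norm_ell2)
    finally show "L2_set (\<lambda>i. cmod (coord (f + g) i)) F \<le> norm f + norm g" .
  qed
  show "norm (r *\<^sub>R f) = \<bar>r\<bar> * norm f"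
    unfolding norm_ell2_def
    by (simp add: coord_scaleR norm_mult power_mult_distrib infsum_cmult_right'
        real_sqrt_mult)
qed

end

instance ell2 :: (type) banach
proof
  fix X :: "nat \<Rightarrow> 'a ell2"
  assume X: "Cauchy X"
  have coord_le: "cmod (coord f i) \<le> norm f" for f :: "'a ell2" and i
    using L2_set_le_norm_ell2[of "{i}" f] by simp
  have "Cauchy (\<lambda>n. coord (X n) i)" for i
  proof (rule CauchyI)
    fix e :: real assume "e > 0"
    then obtain M where "\<forall>m\<ge>M. \<forall>n\<ge>M. norm (X m - X n) < e"
      using CauchyD[OF X] by blast
    then show "\<exists>M. \<forall>m\<ge>M. \<forall>n\<ge>M. norm (coord (X m) i - coord (X n) i) < e"
      by (metis coord_le coord_ell2(3) le_less_trans)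
  qed
  then have "\<exists>l. (\<lambda>n. coord (X n) i) \<longlonglongrightarrow> l" for i
    using Cauchy_convergent_iff convergent_def by blast
  then obtain l where l: "\<And>i. (\<lambda>n. coord (X n) i) \<longlonglongrightarrow> l i" by metis
  have lim: "L2_set (\<lambda>i. cmod (coord (X m) i - l i)) F \<le> e"
    if "finite F" and e: "\<And>n. n \<ge> M \<Longrightarrow> norm (X m - X n) \<le> e" for m M e F
  proof (rule tendsto_upperbound)
    show "(\<lambda>n. L2_set (\<lambda>i. cmod (coord (X m - X n) i)) F) \<longlonglongrightarrow>
        L2_set (\<lambda>i. cmod (coord (X m) i - l i)) F"
      unfolding L2_set_def coord_ell2 by (intro tendsto_intros l)
    show "\<forall>\<^sub>F n in sequentially. L2_set (\<lambda>i. cmod (coord (X m - X n) i)) F \<le> e"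
      using L2_set_le_norm_ell2[OF \<open>finite F\<close>] e
      by (intro eventually_sequentiallyI[of M]) (meson order_trans)
  qed simp
  have sq: "(\<Sum>i\<in>F. (cmod (coord (X m) i - l i))\<^sup>2) \<le> e\<^sup>2"
    if "finite F" "\<And>n. n \<ge> M \<Longrightarrow> norm (X m - X n) \<le> e" for m M e F
  proof -
    have "e \<ge> 0" using that(2)[of M] norm_ge_zero[of "X m - X M"] by linarith
    then show ?thesis
      using lim[OF that] unfolding L2_set_def
      by (metis real_sqrt_le_iff real_sqrt_unique)
  qed
  obtain M where M: "\<forall>m\<ge>M. \<forall>n\<ge>M. norm (X m - X n) < 1"
    using CauchyD[OF X, of 1] by auto
  have "(\<lambda>i. (cmod (coord (X M) i - l i))\<^sup>2) summable_on UNIV"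
    using sq[of _ M M 1] M
    by (intro nonneg_bdd_above_summable_on bdd_aboveI[of _ 1]) (auto simp: less_imp_le)
  from square_summable_add[OF square_summable_scale[OF this, of "-1"] coord_square_summable[of "X M"]]
  have "(\<lambda>i. (cmod (l i))\<^sup>2) summable_on UNIV" by simp
  then have L: "coord (Abs_ell2 l) = l" by (simp add: Abs_ell2_inverse)
  have "X \<longlonglongrightarrow> Abs_ell2 l"
  proof (rule LIMSEQ_I)
    fix e :: real assume "e > 0"
    then obtain M where M: "\<forall>m\<ge>M. \<forall>n\<ge>M. norm (X m - X n) < e / 2"
      using CauchyD[OF X, of "e / 2"] by auto
    have "norm (X m - Abs_ell2 l) \<le> e / 2" if "m \<ge> M" for m
      by (rule norm_ell2_leI) (use lim[of _ M m "e / 2"] M that in \<open>auto simp: coord_ell2 L less_imp_le\<close>)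
    then show "\<exists>M. \<forall>m\<ge>M. norm (X m - Abs_ell2 l) < e"
      using \<open>e > 0\<close> by (metis field_sum_of_halves less_add_same_cancel1 half_gt_zero le_less_trans)
  qed
  then show "convergent X" by (auto simp: convergent_def)
qed

instantiation ell2 :: (type) complex_hilbert
begin

lift_definition scaleC_ell2 :: "complex \<Rightarrow> 'a ell2 \<Rightarrow> 'a ell2" is "\<lambda>c f i. c * f i"
  by (rule square_summable_scale)

definition cinner_ell2 :: "'a ell2 \<Rightarrow> 'a ell2 \<Rightarrow> complex" where
  "cinner_ell2 f g = (\<Sum>\<^sub>\<infinity>i. coord f i * cnj (coord g i))"

lemma coord_scaleC: "coord (c *\<^sub>C f) i = c * coord f i"
  by transfer simp

instance
proof
  fix f g h :: "'a ell2" and c d :: complex and r :: real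
  show "c *\<^sub>C (f + g) = c *\<^sub>C f + c *\<^sub>C g" "(c + d) *\<^sub>C f = c *\<^sub>C f + d *\<^sub>C f"
    "c *\<^sub>C d *\<^sub>C f = (c * d) *\<^sub>C f" "complex_of_real r *\<^sub>C f = r *\<^sub>R f"
    by (rule ell2_eqI; simp add: coord_scaleR coord_scaleC coord_ell2 algebra_simps)+
  note summ = square_summable_prod[OF coord_square_summable coord_square_summable]
  show "cinner (f + g) h = cinner f h + cinner g h"
    by (simp add: cinner_ell2_def coord_ell2 distrib_right infsum_add summ)
  show "cinner (c *\<^sub>C f) g = c * cinner f g"
    by (simp add: cinner_ell2_def coord_scaleC mult.assoc infsum_cmult_right')
  show "cinner f g = cnj (cinner g f)"
    by (simp add: cinner_ell2_def infsum_cnj[symmetric] mult.commute)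
  have "cinner f f = (\<Sum>\<^sub>\<infinity>i. complex_of_real ((cmod (coord f i))\<^sup>2))"
    by (simp add: cinner_ell2_def complex_norm_square[symmetric])
  also have "\<dots> = complex_of_real (\<Sum>\<^sub>\<infinity>i. (cmod (coord f i))\<^sup>2)"
    using has_sum_of_real[OF has_sum_infsum[OF coord_square_summable[of f]]]
    by (rule infsumI)
  finally show "cinner f f = complex_of_real ((norm f)\<^sup>2)"
    by (simp add: norm_ell2_square)
qed

end


section \<open>Presented unital *-algebras\<close>

text \<open>
  Words in the letters \<open>g\<close> and \<open>g\<^sup>*\<close> (flag \<^const>\<open>True\<close>), written additively because
  \<^typ>\<open>'a \<Rightarrow>\<^sub>0 'b\<close> carries the convolution product for an additive monoid of exponents.
\<close>

datatype 'g word = Word (letters: "('g \<times> bool) list")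

instantiation word :: (type) monoid_add
begin

definition zero_word :: "'a word" where
  "zero_word = Word []"

definition plus_word :: "'a word \<Rightarrow> 'a word \<Rightarrow> 'a word" where
  "plus_word u v = Word (letters u @ letters v)"

instance
  by standard (simp_all add: zero_word_def plus_word_def)

end

type_synonym 'g free_star = "'g word \<Rightarrow>\<^sub>0 complex"

definition scalar :: "complex \<Rightarrow> 'g free_star" where
  "scalar c = Poly_Mapping.single 0 c"

definition gen :: "'g \<Rightarrow> 'g free_star" where
  "gen g = Poly_Mapping.single (Word [(g, False)]) 1"

definition star_word :: "'g word \<Rightarrow> 'g word" where
  "star_word w = Word (rev (map (\<lambda>(g, b). (g, \<not> b)) (letters w)))"

lemma star_word_star_word [simp]: "star_word (star_word w) = w"
proof -
  have "map ((\<lambda>(g, b). (g, \<not> b)) \<circ> (\<lambda>(g, b). (g, \<not> b))) xs = xs" for xs :: "('g \<times> bool) list"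
    by (induction xs) auto
  from this[of "letters w"] show ?thesis by (simp add: star_word_def rev_map[symmetric])
qed

lift_definition adj :: "'g free_star \<Rightarrow> 'g free_star" is "\<lambda>p w. cnj (p (star_word w))"
proof -
  fix p :: "'g word \<Rightarrow> complex"
  assume "finite {w. p w \<noteq> 0}"
  moreover have "{w. cnj (p (star_word w)) \<noteq> 0} \<subseteq> star_word ` {w. p w \<noteq> 0}"
    by (auto intro!: image_eqI[of _ _ "star_word _"])
  ultimately show "finite {w. cnj (p (star_word w)) \<noteq> 0}"
    by (meson finite_imageI finite_subset)
qed

lemma poly_mapping_single_induct [case_names zero add]:
  assumes "P 0" and "\<And>k v p. P p \<Longrightarrow> P (Poly_Mapping.single k v + p)"
  shows "P p"
proof (induction p rule: update_induct)
  case const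
  then show ?case using assms(1) by simp
next
  case (update f a b)
  have "Poly_Mapping.update a b f = Poly_Mapping.single a b + f"
    using update(1)
    by (intro poly_mapping_eqI) (auto simp: lookup_update lookup_add lookup_single when_def in_keys_iff)
  then show ?case using assms(2) update by simp
qed

lemma adj_single: "adj (Poly_Mapping.single w c) = Poly_Mapping.single (star_word w) (cnj c)"
proof -
  have "w = star_word v \<longleftrightarrow> star_word w = v" for v :: "'a word"
    by (metis star_word_star_word)
  then show ?thesis
    by (intro poly_mapping_eqI) (simp add: adj.rep_eq lookup_single when_def)
qed

lemma adj_add: "adj (p + q) = adj p + adj q"
  by (rule poly_mapping_eqI) (simp add: adj.rep_eq lookup_add)

lemma adj_adj [simp]: "adj (adj p) = p"
  by (rule poly_mapping_eqI) (simp add: adj.rep_eq)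

lemma adj_zero [simp]: "adj 0 = 0"
  by (rule poly_mapping_eqI) (simp add: adj.rep_eq)

lemma adj_minus: "adj (- p) = - adj p"
  by (rule poly_mapping_eqI) (simp add: adj.rep_eq)

lemma star_word_add: "star_word (u + v) = star_word v + star_word u"
  by (simp add: star_word_def plus_word_def)

lemma adj_mult: "adj (p * q) = adj q * adj p"
proof (induction p rule: poly_mapping_single_induct)
  case zero
  then show ?case by simp
next
  case (add k v p)
  have "adj (Poly_Mapping.single k v * q) = adj q * adj (Poly_Mapping.single k v)"
    by (induction q rule: poly_mapping_single_induct)
      (simp_all add: distrib_left distrib_right adj_add adj_single mult_single star_word_add mult.commute)
  then show ?case
    by (simp add: distrib_left distrib_right adj_add add.IH)
qed

lemma adj_scalar [simp]: "adj (scalar c) = scalar (cnj c)"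
  by (simp add: scalar_def adj_single star_word_def zero_word_def)

lemma scalar_simps: "scalar 1 = 1" "scalar (c + d) = scalar c + scalar d"
  "scalar (c * d) = scalar c * scalar d"
  by (simp_all add: scalar_def single_add mult_single)

lemma scalar_commute: "p * scalar c = scalar c * p"
  by (induction p rule: poly_mapping_single_induct)
    (simp_all add: distrib_left distrib_right scalar_def mult_single mult.commute)

record 'b star_alg = "(complex, 'b) module" +
  star :: "'b \<Rightarrow> 'b"

locale star_algebra = ring A for A (structure) +
  assumes smult_closed: "x \<in> carrier A \<Longrightarrow> c \<odot> x \<in> carrier A"
    and smult_add_right: "x \<in> carrier A \<Longrightarrow> y \<in> carrier A \<Longrightarrow> c \<odot> (x \<oplus> y) = c \<odot> x \<oplus> c \<odot> y"
    and smult_add_left: "x \<in> carrier A \<Longrightarrow> (c + d) \<odot> x = c \<odot> x \<oplus> d \<odot> x"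
    and smult_smult: "x \<in> carrier A \<Longrightarrow> c \<odot> (d \<odot> x) = (c * d) \<odot> x"
    and smult_one: "x \<in> carrier A \<Longrightarrow> 1 \<odot> x = x"
    and smult_mult_left: "x \<in> carrier A \<Longrightarrow> y \<in> carrier A \<Longrightarrow> (c \<odot> x) \<otimes> y = c \<odot> (x \<otimes> y)"
    and smult_mult_right: "x \<in> carrier A \<Longrightarrow> y \<in> carrier A \<Longrightarrow> x \<otimes> (c \<odot> y) = c \<odot> (x \<otimes> y)"
    and star_closed: "x \<in> carrier A \<Longrightarrow> star A x \<in> carrier A"
    and star_add: "x \<in> carrier A \<Longrightarrow> y \<in> carrier A \<Longrightarrow> star A (x \<oplus> y) = star A x \<oplus> star A y"
    and star_smult: "x \<in> carrier A \<Longrightarrow> star A (c \<odot> x) = cnj c \<odot> star A x"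
    and star_mult: "x \<in> carrier A \<Longrightarrow> y \<in> carrier A \<Longrightarrow> star A (x \<otimes> y) = star A y \<otimes> star A x"
    and star_star: "x \<in> carrier A \<Longrightarrow> star A (star A x) = x"

definition star_iso :: "'a star_alg \<Rightarrow> 'b star_alg \<Rightarrow> ('a \<Rightarrow> 'b) \<Rightarrow> bool" where
  "star_iso A B \<phi> \<longleftrightarrow> \<phi> \<in> ring_iso A B \<and>
     (\<forall>c. \<forall>x\<in>carrier A. \<phi> (c \<odot>\<^bsub>A\<^esub> x) = c \<odot>\<^bsub>B\<^esub> \<phi> x) \<and>
     (\<forall>x\<in>carrier A. \<phi> (star A x) = star B (\<phi> x))"

definition free_ring :: "'g free_star ring" where
  "free_ring = \<lparr>carrier = UNIV, mult = (*), one = 1, zero = 0, add = (+)\<rparr>"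

definition star_ideal :: "'g free_star set \<Rightarrow> 'g free_star set" where
  "star_ideal S = Idl\<^bsub>free_ring\<^esub> (S \<union> adj ` S)"

definition cls :: "'g free_star set \<Rightarrow> 'g free_star \<Rightarrow> 'g free_star set" where
  "cls S p = star_ideal S +>\<^bsub>free_ring\<^esub> p"

definition presented :: "'g free_star set \<Rightarrow> 'g free_star set star_alg" where
  "presented S = (let Q = free_ring Quot star_ideal S in
     \<lparr>carrier = carrier Q, mult = mult Q, one = one Q, zero = zero Q, add = add Q,
      smult = (\<lambda>c X. cls S (scalar c) \<otimes>\<^bsub>Q\<^esub> X), star = (\<lambda>X. adj ` X)\<rparr>)"

lemma ring_free_ring: "ring free_ring"
proof -
  have "\<exists>y. y + x = 0" for x :: "'a free_star"
    by (rule exI[of _ "- x"]) simp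
  then show ?thesis
    by (intro ringI abelian_groupI monoidI)
      (auto simp: free_ring_def distrib_left distrib_right mult.assoc add.assoc add.commute)
qed

lemma ideal_star_ideal: "ideal (star_ideal S) free_ring"
  unfolding star_ideal_def
  by (rule ring.genideal_ideal[OF ring_free_ring]) (simp add: free_ring_def)

lemma star_idealI: "p \<in> S \<Longrightarrow> p \<in> star_ideal S"
  using ring.genideal_self[OF ring_free_ring, of "S \<union> adj ` S"]
  by (auto simp: star_ideal_def free_ring_def)

lemma star_ideal_closed:
  shows "0 \<in> star_ideal S"
    and "p \<in> star_ideal S \<Longrightarrow> q \<in> star_ideal S \<Longrightarrow> p + q \<in> star_ideal S"
    and "p \<in> star_ideal S \<Longrightarrow> - p \<in> star_ideal S"
    and "p \<in> star_ideal S \<Longrightarrow> q * p \<in> star_ideal S"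
    and "p \<in> star_ideal S \<Longrightarrow> p * q \<in> star_ideal S"
proof -
  interpret ideal "star_ideal S" free_ring by (rule ideal_star_ideal)
  have l: "p \<in> star_ideal S \<Longrightarrow> q * p \<in> star_ideal S" for p q
    using I_l_closed by (auto simp: free_ring_def)
  show "0 \<in> star_ideal S"
    and "p \<in> star_ideal S \<Longrightarrow> q \<in> star_ideal S \<Longrightarrow> p + q \<in> star_ideal S"
    and "p \<in> star_ideal S \<Longrightarrow> p * q \<in> star_ideal S"
    and "p \<in> star_ideal S \<Longrightarrow> q * p \<in> star_ideal S"
    and "p \<in> star_ideal S \<Longrightarrow> - p \<in> star_ideal S"
    using additive_subgroup.zero_closed[OF is_additive_subgroup]
      additive_subgroup.a_closed[OF is_additive_subgroup] I_r_closed l l[of p "- 1"]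
    by (auto simp: free_ring_def)
qed

lemma adj_star_ideal: "p \<in> star_ideal S \<Longrightarrow> adj p \<in> star_ideal S"
proof -
  let ?J = "{p. adj p \<in> star_ideal S}"
  have "ideal ?J free_ring"
  proof (rule idealI[OF ring_free_ring])
    show "subgroup ?J (add_monoid free_ring)"
    proof (rule group.subgroupI)
      show "Group.group (add_monoid free_ring)"
        using ring_free_ring abelian_group.a_group ring.is_abelian_group by blast
      fix p assume "p \<in> ?J"
      moreover have "inv\<^bsub>add_monoid free_ring\<^esub> p = - p"
        using abelian_group.minus_equality[of free_ring "- p" p] ring.is_abelian_group[OF ring_free_ring]
        by (simp add: a_inv_def free_ring_def)
      ultimately show "inv\<^bsub>add_monoid free_ring\<^esub> p \<in> ?J"
        by (simp add: adj_minus star_ideal_closed)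
    qed (auto simp: free_ring_def adj_add star_ideal_closed intro!: exI[of _ 0])
  qed (auto simp: free_ring_def adj_mult star_ideal_closed)
  moreover have "S \<union> adj ` S \<subseteq> ?J"
    using ring.genideal_self[OF ring_free_ring, of "S \<union> adj ` S"]
    by (auto simp: star_ideal_def free_ring_def)
  ultimately have "star_ideal S \<subseteq> ?J"
    by (auto simp: star_ideal_def genideal_def)
  then show "p \<in> star_ideal S \<Longrightarrow> adj p \<in> star_ideal S" by auto
qed

lemma cls_altdef: "cls S p = {q. q - p \<in> star_ideal S}"
proof -
  have "\<exists>h\<in>star_ideal S. q = h + p" if "q - p \<in> star_ideal S" for q
    using that by (intro bexI[of _ "q - p"]) auto
  then show ?thesis
    by (auto simp: cls_def a_r_coset_def' free_ring_def)
qed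

lemma cls_eq_iff: "cls S p = cls S q \<longleftrightarrow> p - q \<in> star_ideal S"
proof
  assume "cls S p = cls S q"
  moreover have "p \<in> cls S p" by (simp add: cls_altdef star_ideal_closed)
  ultimately show "p - q \<in> star_ideal S" by (simp add: cls_altdef)
next
  assume *: "p - q \<in> star_ideal S"
  have "r - p \<in> star_ideal S \<longleftrightarrow> r - q \<in> star_ideal S" for r
    using star_ideal_closed(2)[OF *, of "r - p"] star_ideal_closed(2)[OF star_ideal_closed(3)[OF *], of "r - q"]
    by (auto simp: algebra_simps)
  then show "cls S p = cls S q" by (simp add: cls_altdef)
qed

lemma presented_simps:
  shows "carrier (presented S) = range (cls S)"
    and "cls S p \<otimes>\<^bsub>presented S\<^esub> cls S q = cls S (p * q)"
    and "cls S p \<oplus>\<^bsub>presented S\<^esub> cls S q = cls S (p + q)"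
    and "\<one>\<^bsub>presented S\<^esub> = cls S 1"
    and "\<zero>\<^bsub>presented S\<^esub> = cls S 0"
    and "c \<odot>\<^bsub>presented S\<^esub> cls S p = cls S (scalar c * p)"
    and "star (presented S) (cls S p) = cls S (adj p)"
proof -
  interpret ideal "star_ideal S" free_ring by (rule ideal_star_ideal)
  show "carrier (presented S) = range (cls S)"
    by (auto simp: presented_def FactRing_def Let_def A_RCOSETS_def' cls_def free_ring_def)
  have m: "rcoset_mult free_ring (star_ideal S) (cls S p) (cls S q) = cls S (p * q)" for p q
    using rcoset_mult_add[of p q] by (simp add: cls_def free_ring_def)
  show "cls S p \<otimes>\<^bsub>presented S\<^esub> cls S q = cls S (p * q)"
    "c \<odot>\<^bsub>presented S\<^esub> cls S p = cls S (scalar c * p)"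
    by (simp_all add: presented_def FactRing_def Let_def m)
  show "cls S p \<oplus>\<^bsub>presented S\<^esub> cls S q = cls S (p + q)"
    using a_rcos_sum[of p q] by (simp add: presented_def FactRing_def Let_def cls_def free_ring_def)
  show "\<one>\<^bsub>presented S\<^esub> = cls S 1"
    by (simp add: presented_def FactRing_def Let_def cls_def free_ring_def)
  show "\<zero>\<^bsub>presented S\<^esub> = cls S 0"
    by (simp add: presented_def FactRing_def Let_def cls_altdef)
  have "adj ` cls S p = cls S (adj p)"
  proof (intro equalityI subsetI)
    fix q assume "q \<in> adj ` cls S p"
    then obtain r where "q = adj r" "r - p \<in> star_ideal S" by (auto simp: cls_altdef)
    then show "q \<in> cls S (adj p)"
      using adj_star_ideal[of "r - p" S] adj_add[of r "- p"] by (simp add: cls_altdef adj_minus)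
  next
    fix q assume "q \<in> cls S (adj p)"
    then have "adj q - p \<in> star_ideal S"
      using adj_star_ideal[of "q - adj p" S] adj_add[of q "- adj p"] by (simp add: cls_altdef adj_minus)
    then show "q \<in> adj ` cls S p"
      by (intro image_eqI[of _ _ "adj q"]) (auto simp: cls_altdef)
  qed
  then show "star (presented S) (cls S p) = cls S (adj p)"
    by (simp add: presented_def Let_def)
qed

lemma star_algebra_presented: "star_algebra (presented S)"
proof (rule star_algebra.intro)
  have "\<exists>q. cls S q \<oplus>\<^bsub>presented S\<^esub> cls S p = cls S 0" for p
    by (rule exI[of _ "- p"]) (simp add: presented_simps)
  then show "ring (presented S)"
    by (intro ringI abelian_groupI monoidI)
      (auto simp: presented_simps distrib_left distrib_right mult.assoc add_ac)
  have left_commute: "p * (scalar c * q) = scalar c * (p * q)" for p q :: "'a free_star" and c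
    by (metis mult.assoc scalar_commute)
  show "star_algebra_axioms (presented S)"
  proof (rule star_algebra_axioms.intro)
    fix X Y c assume "X \<in> carrier (presented S)" "Y \<in> carrier (presented S)"
    then obtain p q where "X = cls S p" "Y = cls S q" by (auto simp: presented_simps)
    then show "X \<otimes>\<^bsub>presented S\<^esub> (c \<odot>\<^bsub>presented S\<^esub> Y) = c \<odot>\<^bsub>presented S\<^esub> (X \<otimes>\<^bsub>presented S\<^esub> Y)"
      by (simp add: presented_simps left_commute)
  qed (auto simp: presented_simps scalar_simps distrib_left distrib_right mult.assoc
      adj_add adj_mult scalar_commute[of "adj _"])
qed


section \<open>*-representations\<close>

definition star_rep :: "'b star_alg \<Rightarrow> 'h::complex_hilbert set \<Rightarrow> ('b \<Rightarrow> 'h \<Rightarrow> 'h) \<Rightarrow> bool" where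
  "star_rep A D \<pi> \<longleftrightarrow> csubspace D \<and> closure D = UNIV \<and>
     (\<forall>X\<in>carrier A. \<forall>\<xi>\<in>D. \<pi> X \<xi> \<in> D) \<and>
     (\<forall>X\<in>carrier A. \<forall>\<xi>\<in>D. \<forall>\<eta>\<in>D. \<pi> X (\<xi> + \<eta>) = \<pi> X \<xi> + \<pi> X \<eta>) \<and>
     (\<forall>X\<in>carrier A. \<forall>c. \<forall>\<xi>\<in>D. \<pi> X (c *\<^sub>C \<xi>) = c *\<^sub>C \<pi> X \<xi>) \<and>
     (\<forall>X\<in>carrier A. \<forall>Y\<in>carrier A. \<forall>\<xi>\<in>D. \<pi> (X \<oplus>\<^bsub>A\<^esub> Y) \<xi> = \<pi> X \<xi> + \<pi> Y \<xi>) \<and>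
     (\<forall>c. \<forall>X\<in>carrier A. \<forall>\<xi>\<in>D. \<pi> (c \<odot>\<^bsub>A\<^esub> X) \<xi> = c *\<^sub>C \<pi> X \<xi>) \<and>
     (\<forall>X\<in>carrier A. \<forall>Y\<in>carrier A. \<forall>\<xi>\<in>D. \<pi> (X \<otimes>\<^bsub>A\<^esub> Y) \<xi> = \<pi> X (\<pi> Y \<xi>)) \<and>
     (\<forall>\<xi>\<in>D. \<pi> \<one>\<^bsub>A\<^esub> \<xi> = \<xi>) \<and>
     (\<forall>X\<in>carrier A. \<forall>\<xi>\<in>D. \<forall>\<eta>\<in>D. cinner (\<pi> X \<xi>) \<eta> = cinner \<xi> (\<pi> (star A X) \<eta>))"

text \<open>Irreducibility: the space is nonzero and the representation is not an orthogonal direct sum.\<close>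

definition irreducible_rep :: "'b star_alg \<Rightarrow> 'h::complex_hilbert set \<Rightarrow> ('b \<Rightarrow> 'h \<Rightarrow> 'h) \<Rightarrow> bool" where
  "irreducible_rep A D \<pi> \<longleftrightarrow> D \<noteq> {0} \<and>
     (\<forall>D1 D2. csubspace D1 \<and> csubspace D2 \<and>
        (\<forall>\<xi>\<in>D1. \<forall>\<eta>\<in>D2. cinner \<xi> \<eta> = 0) \<and> D = {\<xi> + \<eta> |\<xi> \<eta>. \<xi> \<in> D1 \<and> \<eta> \<in> D2} \<and>
        (\<forall>X\<in>carrier A. \<pi> X ` D1 \<subseteq> D1 \<and> \<pi> X ` D2 \<subseteq> D2) \<longrightarrow> D1 = {0} \<or> D2 = {0})"

definition unitarily_equivalent ::
  "'b star_alg \<Rightarrow> 'h::complex_hilbert set \<Rightarrow> ('b \<Rightarrow> 'h \<Rightarrow> 'h) \<Rightarrow>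
     'k::complex_hilbert set \<Rightarrow> ('b \<Rightarrow> 'k \<Rightarrow> 'k) \<Rightarrow> bool" where
  "unitarily_equivalent A D \<pi> E \<rho> \<longleftrightarrow>
     (\<exists>W. unitary W \<and> W ` D = E \<and> (\<forall>X\<in>carrier A. \<forall>\<xi>\<in>D. W (\<pi> X \<xi>) = \<rho> X (W \<xi>)))"


section \<open>Unitary representations of the Heisenberg group\<close>

text \<open>
  The group is written in exponential coordinates \<open>(p, q, t)\<close>, so the exponential map is the
  identity and \<open>s *\<^sub>R X\<close> is the one-parameter subgroup of \<open>X\<close>. The Lie bracket is
  \<open>[(p, q, t), (p', q', t')] = (0, 0, p \<bullet> q' - q \<bullet> p')\<close>.
\<close>

type_synonym heis = "(real^3) \<times> (real^3) \<times> real"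

definition heisenberg :: "heis monoid" where
  "heisenberg = \<lparr>carrier = UNIV,
     mult = (\<lambda>(p, q, t) (p', q', t'). (p + p', q + q', t + t' + (p \<bullet> q' - q \<bullet> p') / 2)),
     one = (0, 0, 0)\<rparr>"

lemma group_heisenberg: "Group.group heisenberg"
proof (rule groupI)
  fix X :: heis
  have "\<exists>Y. Y \<otimes>\<^bsub>heisenberg\<^esub> X = \<one>\<^bsub>heisenberg\<^esub>"
    by (rule exI[of _ "- X"], cases X) (simp add: heisenberg_def inner_commute)
  then show "\<exists>Y\<in>carrier heisenberg. Y \<otimes>\<^bsub>heisenberg\<^esub> X = \<one>\<^bsub>heisenberg\<^esub>"
    by (simp add: heisenberg_def)
qed (auto simp: heisenberg_def inner_add_left inner_add_right field_simps)

definition strongly_continuous_unitary_rep :: "(heis \<Rightarrow> 'h::complex_hilbert \<Rightarrow> 'h) \<Rightarrow> bool" where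
  "strongly_continuous_unitary_rep U \<longleftrightarrow> (\<forall>g. unitary (U g)) \<and>
     (\<forall>g h. U (g \<otimes>\<^bsub>heisenberg\<^esub> h) = U g \<circ> U h) \<and> (\<forall>\<xi>. continuous_on UNIV (\<lambda>g. U g \<xi>))"

fun C_k :: "nat \<Rightarrow> ('a::euclidean_space \<Rightarrow> 'b::real_normed_vector) \<Rightarrow> bool" where
  "C_k 0 f \<longleftrightarrow> continuous_on UNIV f"
| "C_k (Suc k) f \<longleftrightarrow> f differentiable_on UNIV \<and> (\<forall>v. C_k k (\<lambda>x. frechet_derivative f (at x) v))"

definition smooth_vectors :: "(heis \<Rightarrow> 'h::complex_hilbert \<Rightarrow> 'h) \<Rightarrow> 'h set" where
  "smooth_vectors U = {\<xi>. \<forall>k. C_k k (\<lambda>g. U g \<xi>)}"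

definition differential :: "(heis \<Rightarrow> 'h::complex_hilbert \<Rightarrow> 'h) \<Rightarrow> heis \<Rightarrow> 'h \<Rightarrow> 'h" where
  "differential U X \<xi> = vector_derivative (\<lambda>s. U (s *\<^sub>R X) \<xi>) (at 0)"


section \<open>The two *-algebras and well-behaved representations\<close>

definition ccr_relations :: "3 free_star set" where
  "ccr_relations =
     {adj (gen i) * gen i - gen i * adj (gen i) - 1 |i. True} \<union>
     {adj (gen i) * gen j - gen j * adj (gen i) |i j. i \<noteq> j} \<union>
     {gen i * gen j - gen j * gen i |i j. i \<noteq> j}"

definition ccr_algebra :: "3 free_star set star_alg" where
  "ccr_algebra = presented ccr_relations"

datatype generator = Ga1 | Ga2 | GA

definition A_relations :: "complex \<Rightarrow> complex \<Rightarrow> generator free_star set" where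
  "A_relations x1 x2 = (let a1 = gen Ga1; a2 = gen Ga2; A = gen GA in
     {adj a1 * a1 - a1 * adj a1 - 1,
      adj a2 * a2 - a2 * adj a2 - 1,
      adj a1 * a2 - a2 * adj a1,
      A - (a2 * a1 - a1 * a2),
      A * a1 - a1 * A - scalar x1,
      A * a2 - a2 * A - scalar x2,
      adj a1 * A - A * adj a1,
      adj a2 * A - A * adj a2})"

definition A_algebra :: "complex \<Rightarrow> complex \<Rightarrow> generator free_star set star_alg" where
  "A_algebra x1 x2 = presented (A_relations x1 x2)"

definition A_elem :: "complex \<Rightarrow> complex \<Rightarrow> generator \<Rightarrow> generator free_star set" where
  "A_elem x1 x2 g = cls (A_relations x1 x2) (gen g)"

definition canonical_iso ::
  "complex \<Rightarrow> complex \<Rightarrow> (generator free_star set \<Rightarrow> 3 free_star set) \<Rightarrow> bool" where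
  "canonical_iso x1 x2 \<phi> \<longleftrightarrow> star_iso (A_algebra x1 x2) ccr_algebra \<phi> \<and>
     (let c1 = gen 1; c2 = gen 2; c3 = gen 3; r = complex_of_real (cmod x1) in
       \<phi> (A_elem x1 x2 Ga1) = cls ccr_relations c1 \<and>
       \<phi> (A_elem x1 x2 GA) = cls ccr_relations (scalar r * c2 + scalar x1 * adj c1) \<and>
       \<phi> (A_elem x1 x2 Ga2) = cls ccr_relations
         (scalar (complex_of_real (sqrt (1 + (cmod x2)\<^sup>2 / (cmod x1)\<^sup>2))) * c3
          - scalar (x2 / r) * adj c2 + scalar (cnj x1 / 2) * c2 ^ 2
          + scalar r * adj c1 * c2 + scalar (x1 / 2) * adj c1 ^ 2))"

text \<open>
  The embedding of the Heisenberg Lie algebra into the skew-adjoint part of the CCR algebra. With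
  \<open>c\<^sub>j = (Q\<^sub>j - \<i> P\<^sub>j) / \<surd>2\<close> it sends \<open>(p, q, t)\<close> to \<open>\<i> (p \<bullet> P + q \<bullet> Q + t)\<close>, and
  \<open>[Q\<^sub>j, P\<^sub>j] = \<i>\<close> makes it a Lie algebra homomorphism for the bracket above.
\<close>

definition heis_embed :: "heis \<Rightarrow> 3 free_star" where
  "heis_embed = (\<lambda>(p, q, t).
     (\<Sum>j\<in>UNIV. scalar (complex_of_real (p $ j / sqrt 2)) * (adj (gen j) - gen j)
        + scalar (\<i> * complex_of_real (q $ j / sqrt 2)) * (adj (gen j) + gen j))
     + scalar (\<i> * complex_of_real t))"

definition integrable_rep :: "'h::complex_hilbert set \<Rightarrow> (3 free_star set \<Rightarrow> 'h \<Rightarrow> 'h) \<Rightarrow> bool" where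
  "integrable_rep D \<rho> \<longleftrightarrow> star_rep ccr_algebra D \<rho> \<and>
     (\<exists>U. strongly_continuous_unitary_rep U \<and> D = smooth_vectors U \<and>
       (\<forall>X. \<forall>\<xi>\<in>D. \<rho> (cls ccr_relations (heis_embed X)) \<xi> = differential U X \<xi>))"

definition well_behaved ::
  "complex \<Rightarrow> complex \<Rightarrow> 'h::complex_hilbert set \<Rightarrow> (generator free_star set \<Rightarrow> 'h \<Rightarrow> 'h) \<Rightarrow> bool" where
  "well_behaved x1 x2 D \<pi> \<longleftrightarrow> star_rep (A_algebra x1 x2) D \<pi> \<and>
     (\<exists>\<phi> \<rho>. canonical_iso x1 x2 \<phi> \<and> integrable_rep D \<rho> \<and>
       (\<forall>X\<in>carrier (A_algebra x1 x2). \<forall>\<xi>\<in>D. \<pi> X \<xi> = \<rho> (\<phi> X) \<xi>))"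


section \<open>Operators on the threefold tensor power\<close>

text \<open>
  The Hilbert space tensor cube of \<open>l\<^sub>2(\<nat>)\<close> is identified with \<^typ>\<open>(nat \<times> nat \<times> nat) ell2\<close> by
  sending \<open>e\<^sub>i \<otimes> e\<^sub>j \<otimes> e\<^sub>k\<close> to the basis vector at \<open>(i, j, k)\<close>.
\<close>

definition creation :: "(nat \<Rightarrow> complex) \<Rightarrow> nat \<Rightarrow> complex" where
  "creation f n = (if n = 0 then 0 else complex_of_real (sqrt (real n)) * f (n - 1))"

definition annihilation :: "(nat \<Rightarrow> complex) \<Rightarrow> nat \<Rightarrow> complex" where
  "annihilation f n = complex_of_real (sqrt (real n + 1)) * f (n + 1)"

definition basis_seq :: "nat \<Rightarrow> nat \<Rightarrow> complex" where
  "basis_seq n = (\<lambda>i. if i = n then 1 else 0)"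

lemma creation_basis: "creation (basis_seq n) = (\<lambda>i. complex_of_real (sqrt (real n + 1)) * basis_seq (n + 1) i)"
  by (auto simp: creation_def basis_seq_def fun_eq_iff)

lemma annihilation_basis:
  "annihilation (basis_seq n) = (\<lambda>i. complex_of_real (sqrt (real n)) * basis_seq (n - 1) i)"
  by (auto simp: annihilation_def basis_seq_def fun_eq_iff add.commute)

definition tensor3 ::
  "((nat \<Rightarrow> complex) \<Rightarrow> nat \<Rightarrow> complex) \<Rightarrow> ((nat \<Rightarrow> complex) \<Rightarrow> nat \<Rightarrow> complex) \<Rightarrow>
   ((nat \<Rightarrow> complex) \<Rightarrow> nat \<Rightarrow> complex) \<Rightarrow> (nat \<times> nat \<times> nat \<Rightarrow> complex) \<Rightarrow> nat \<times> nat \<times> nat \<Rightarrow> complex"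
  where
  "tensor3 R S T F = (\<lambda>(i, j, k). R (\<lambda>i'. S (\<lambda>j'. T (\<lambda>k'. F (i', j', k')) k) j) i)"

lemma tensor3_elementary:
  assumes "\<And>c f. R (\<lambda>n. c * f n) = (\<lambda>n. c * R f n)" "\<And>c f. S (\<lambda>n. c * f n) = (\<lambda>n. c * S f n)"
    "\<And>c f. T (\<lambda>n. c * f n) = (\<lambda>n. c * T f n)"
  shows "tensor3 R S T (\<lambda>(i, j, k). u i * (v j * w k)) = (\<lambda>(i, j, k). R u i * (S v j * T w k))"
proof -
  have "R (\<lambda>i'. S (\<lambda>j'. T (\<lambda>k'. u i' * (v j' * w k')) k) j) i = R u i * (S v j * T w k)" for i j k
  proof -
    have "T (\<lambda>k'. u i' * (v j' * w k')) k = (u i' * T w k) * v j'" for i' j'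
      using assms(3)[of "u i' * v j'" w] by (simp add: mult_ac)
    then have "S (\<lambda>j'. T (\<lambda>k'. u i' * (v j' * w k')) k) j = (T w k * S v j) * u i'" for i'
      using assms(2)[of "u i' * T w k" v] by (simp add: mult_ac)
    then show ?thesis
      using assms(1)[of "T w k * S v j" u] by (simp add: mult_ac)
  qed
  then show ?thesis by (simp add: tensor3_def fun_eq_iff)
qed

definition rapidly_decreasing :: "(nat \<times> nat \<times> nat) ell2 set" where
  "rapidly_decreasing =
     {f. \<forall>m. \<exists>B. \<forall>i j k. real (1 + i + j + k) ^ m * cmod (coord f (i, j, k)) \<le> B}"

end

theory Submission
  imports Defs "HOL-Probability.Characteristic_Functions"
begin

text \<open>
  With \<open>b\<^sub>2 = (A - x\<^sub>1 a\<^sub>1\<^sup>*) / \<bar>x\<^sub>1\<bar>\<close> and the analogous \<open>b\<^sub>3\<close>, the triangular substitution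
  \<open>(a\<^sub>1, A, a\<^sub>2) \<leftrightarrow> (c\<^sub>1, c\<^sub>2, c\<^sub>3)\<close> is invertible already on free *-algebras, and a commutator
  calculus modulo the relations makes it the *-isomorphism with the CCR algebra. This reduces the
  theorem to the Stone-von Neumann theorem for three degrees of freedom.

  Existence: on the coherent vectors of \<open>l\<^sub>2(\<nat>\<^sup>3)\<close> the group acts by displacements. These preserve the
  Gram matrix, so they extend to unitaries; their smooth vectors are the rapidly decreasing
  sequences, and the differential is the Fock representation. A reducing subspace contains the
  vacuum or is orthogonal to it, whence irreducibility.

  Uniqueness: for an integrable irreducible representation with group representation \<open>U\<close>, the
  Gaussian average of \<open>U\<close> is, up to a scalar, the projection onto the vacuum vectors; it is nonzero and
  yields a vector \<open>\<Omega>\<close> with \<open>\<langle>U(z) \<Omega>, \<Omega>\<rangle> = exp (-\<bar>z\<bar>\<^sup>2 / 4)\<close>. The Gram matrix of the orbit of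
  \<open>\<Omega>\<close> is then the one in Fock space, and by irreducibility the orbit is total.
\<close>

section \<open>Complex Hilbert spaces\<close>

text \<open>All analysis runs through the unitary group, because identities between unbounded
  operators on a dense domain say little about closed subspaces. A bounded operator commuting with
  the group preserves smooth vectors and commutes with the differential, and the generators lie in
  the complex span of the Lie algebra; so each intertwining statement about the algebra reduces to
  one about unitaries, which is checked on a total family. The obstacle is that irreducibility
  speaks of orthogonal decompositions of the domain and not of the Hilbert space: an invariant
  closed subspace has to be cut out by its projection, which the same principle restricts to the
  domain. The Gaussian average P enters only through its sesquilinear form, so all integrals are
  scalar; the identity P U(g) P = const exp(-|g|^2/4) P is a twisted convolution of Gaussians. The
  exponent 1/4 is forced: |g|^2/4 is half of <alpha, alpha> for the amplitude alpha = (i q - p) /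
  sqrt 2 of a displacement. The isomorphism in \<open>well_behaved\<close> is existentially
  quantified, but its prescribed values on the generators determine it.\<close>

lemma scaleC_zero [simp]: "c *\<^sub>C (0::'h::complex_hilbert) = 0" "0 *\<^sub>C (x::'h) = 0"
proof -
  show "c *\<^sub>C (0::'h) = 0" using scaleC_add_right[of c 0 0] by simp
  show "0 *\<^sub>C (x::'h) = 0" using scaleC_add_left[of 0 0 x] by simp
qed

lemma scaleC_minus: "c *\<^sub>C (- x) = - (c *\<^sub>C (x::'h::complex_hilbert))"
  using scaleC_add_right[of c x "- x"] by (simp add: eq_neg_iff_add_eq_0 add.commute)

lemma scaleC_minus_left: "(- c) *\<^sub>C x = - (c *\<^sub>C (x::'h::complex_hilbert))"
  using scaleC_add_left[of c "- c" x] by (simp add: eq_neg_iff_add_eq_0 add.commute)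

lemma scaleC_one [simp]: "1 *\<^sub>C x = (x::'h::complex_hilbert)"
  using scaleC_of_real[of 1 x] by simp

lemma cinner_add_right: "cinner x (y + z) = cinner x y + cinner (x::'h::complex_hilbert) z"
  by (subst (1 2 3) cinner_commute) (simp add: cinner_add_left)

lemma cinner_scaleC_right: "cinner x (c *\<^sub>C y) = cnj c * cinner (x::'h::complex_hilbert) y"
  by (subst (1 2) cinner_commute) (simp add: cinner_scaleC_left)

lemma cinner_zero [simp]: "cinner 0 (y::'h::complex_hilbert) = 0" "cinner (x::'h) 0 = 0"
  using cinner_scaleC_left[of 0 0 y] cinner_scaleC_right[of x 0 0] by simp_all

lemma cinner_minus_left: "cinner (- x) y = - cinner x (y::'h::complex_hilbert)"
  using cinner_add_left[of x "- x" y] by (simp add: eq_neg_iff_add_eq_0 add.commute)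

lemma cinner_minus_right: "cinner x (- y) = - cinner x (y::'h::complex_hilbert)"
  using cinner_add_right[of x y "- y"] by (simp add: eq_neg_iff_add_eq_0 add.commute)

lemma cinner_diff_left: "cinner (x - y) z = cinner x z - cinner y (z::'h::complex_hilbert)"
  using cinner_add_left[of x "- y" z] by (simp add: cinner_minus_left)

lemma cinner_diff_right: "cinner x (y - z) = cinner x y - cinner x (z::'h::complex_hilbert)"
  using cinner_add_right[of x y "- z"] by (simp add: cinner_minus_right)

lemma cinner_sum_left: "cinner (\<Sum>i\<in>I. f i) y = (\<Sum>i\<in>I. cinner (f i) (y::'h::complex_hilbert))"
  by (induction I rule: infinite_finite_induct) (simp_all add: cinner_add_left)

lemmas cinner_simps = cinner_add_left cinner_add_right cinner_diff_left cinner_diff_right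
  cinner_minus_left cinner_minus_right cinner_scaleC_left cinner_scaleC_right

lemma cinner_eq_zero [simp]: "cinner x x = 0 \<longleftrightarrow> (x::'h::complex_hilbert) = 0"
  by (simp add: cinner_self)

lemma norm_eq_Re_cinner: "(norm (x::'h::complex_hilbert))\<^sup>2 = Re (cinner x x)"
  by (simp add: cinner_self del: of_real_power)

lemma norm_diff_square:
  "(norm (x - y :: 'h::complex_hilbert))\<^sup>2 = (norm x)\<^sup>2 - 2 * Re (cinner x y) + (norm y)\<^sup>2"
  by (simp add: norm_eq_Re_cinner cinner_simps cinner_commute[of y x])

lemma norm_add_square:
  "(norm (x + y :: 'h::complex_hilbert))\<^sup>2 = (norm x)\<^sup>2 + 2 * Re (cinner x y) + (norm y)\<^sup>2"
  by (simp add: norm_eq_Re_cinner cinner_simps cinner_commute[of y x])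

lemma norm_scaleC: "norm (c *\<^sub>C x) = cmod c * norm (x::'h::complex_hilbert)"
proof -
  have "complex_of_real ((norm (c *\<^sub>C x))\<^sup>2) = c * cnj c * complex_of_real ((norm x)\<^sup>2)"
    by (simp only: cinner_self[symmetric] cinner_simps mult.assoc mult.left_commute)
  also have "\<dots> = complex_of_real ((cmod c * norm x)\<^sup>2)"
    by (simp only: complex_norm_square[symmetric] power_mult_distrib of_real_mult of_real_power)
  finally have "(norm (c *\<^sub>C x))\<^sup>2 = (cmod c * norm x)\<^sup>2"
    using of_real_eq_iff by blast
  then show ?thesis by (simp add: power2_eq_iff_nonneg)
qed

text \<open>Pythagoras for the projection onto the line through \<open>y\<close>. It yields the
  Cauchy-Schwarz inequality, and in \<open>orthogonal_projection\<close> it shows that a point of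
  least distance leaves an orthogonal remainder.\<close>

lemma projection_norm:
  assumes "(y::'h::complex_hilbert) \<noteq> 0"
  shows "(norm (x - (cinner x y / cinner y y) *\<^sub>C y))\<^sup>2 = (norm x)\<^sup>2 - (cmod (cinner x y))\<^sup>2 / (norm y)\<^sup>2"
proof -
  define c where "c = cinner x y / cinner y y"
  have c: "c = cinner x y / complex_of_real ((norm y)\<^sup>2)" by (simp add: c_def cinner_self)
  have "cinner x (c *\<^sub>C y) = complex_of_real ((cmod (cinner x y))\<^sup>2 / (norm y)\<^sup>2)"
    unfolding cinner_scaleC_right c of_real_divide complex_norm_square by (simp add: mult.commute)
  then have 1: "Re (cinner x (c *\<^sub>C y)) = (cmod (cinner x y))\<^sup>2 / (norm y)\<^sup>2"
    by (simp only: Re_complex_of_real)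
  have "cmod c = cmod (cinner x y) / (norm y)\<^sup>2"
    unfolding c norm_divide norm_of_real by simp
  then have 2: "(norm (c *\<^sub>C y))\<^sup>2 = (cmod (cinner x y))\<^sup>2 / (norm y)\<^sup>2"
    using assms by (simp add: norm_scaleC field_simps power2_eq_square)
  show ?thesis
    unfolding c_def[symmetric] norm_diff_square 1 2 by simp
qed

lemma cinner_Cauchy_Schwarz: "cmod (cinner x y) \<le> norm x * norm (y::'h::complex_hilbert)"
proof (cases "y = 0")
  case False
  have "0 \<le> (norm x)\<^sup>2 - (cmod (cinner x y))\<^sup>2 / (norm y)\<^sup>2"
    using projection_norm[OF False, of x] by (metis zero_le_power2)
  then have "(cmod (cinner x y))\<^sup>2 \<le> (norm x * norm y)\<^sup>2"
    using False by (simp add: field_simps power_mult_distrib)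
  then show ?thesis by (rule power2_le_imp_le) simp
qed simp

lemma bounded_bilinear_cinner: "bounded_bilinear (cinner :: 'h::complex_hilbert \<Rightarrow> 'h \<Rightarrow> complex)"
proof
  fix r and x y :: 'h
  show "cinner (r *\<^sub>R x) y = r *\<^sub>R cinner x y" "cinner x (r *\<^sub>R y) = r *\<^sub>R cinner x y"
    by (simp_all add: scaleC_of_real[symmetric] cinner_simps scaleR_conv_of_real)
  show "\<exists>K. \<forall>(a::'h) b. norm (cinner a b) \<le> norm a * norm b * K"
    by (rule exI[of _ 1]) (simp add: cinner_Cauchy_Schwarz)
qed (simp_all add: cinner_simps)

lemmas bounded_linear_cinner_left = bounded_bilinear.bounded_linear_left[OF bounded_bilinear_cinner]
lemmas tendsto_cinner [tendsto_intros] = bounded_bilinear.tendsto[OF bounded_bilinear_cinner]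
lemmas continuous_on_cinner [continuous_intros] = bounded_bilinear.continuous_on[OF bounded_bilinear_cinner]

lemma bounded_linear_scaleC: "bounded_linear (\<lambda>x::'h::complex_hilbert. c *\<^sub>C x)"
proof
  fix r and x y :: 'h
  show "c *\<^sub>C r *\<^sub>R x = r *\<^sub>R c *\<^sub>C x"
    by (simp add: scaleC_of_real[symmetric] scaleC_scaleC mult.commute)
  show "\<exists>K. \<forall>x::'h. norm (c *\<^sub>C x) \<le> norm x * K"
    by (rule exI[of _ "cmod c"]) (simp add: norm_scaleC mult.commute)
qed (simp add: scaleC_add_right)

lemma bounded_bilinear_scaleC: "bounded_bilinear (\<lambda>c (x::'h::complex_hilbert). c *\<^sub>C x)"
proof
  fix r c and x y :: 'h
  show "c *\<^sub>C r *\<^sub>R x = r *\<^sub>R c *\<^sub>C x"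
    by (simp add: scaleC_of_real[symmetric] scaleC_scaleC mult.commute)
  show "(r *\<^sub>R c) *\<^sub>C x = r *\<^sub>R c *\<^sub>C x"
    by (metis scaleC_of_real scaleC_scaleC scaleR_conv_of_real)
  show "\<exists>K. \<forall>c (x::'h). norm (c *\<^sub>C x) \<le> norm c * norm x * K"
    by (rule exI[of _ 1]) (simp add: norm_scaleC)
qed (simp_all add: scaleC_add_right scaleC_add_left)

lemmas continuous_on_scaleC [continuous_intros] = bounded_bilinear.continuous_on[OF bounded_bilinear_scaleC]

lemma csubspaceD:
  assumes "csubspace D"
  shows "0 \<in> D" "x \<in> D \<Longrightarrow> y \<in> D \<Longrightarrow> x + y \<in> D" "x \<in> D \<Longrightarrow> c *\<^sub>C x \<in> D"
    "x \<in> D \<Longrightarrow> - x \<in> D" "x \<in> D \<Longrightarrow> y \<in> D \<Longrightarrow> x - y \<in> D" "x \<in> D \<Longrightarrow> r *\<^sub>R x \<in> D"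
proof -
  show a: "0 \<in> D" "x \<in> D \<Longrightarrow> y \<in> D \<Longrightarrow> x + y \<in> D" and c: "x \<in> D \<Longrightarrow> c *\<^sub>C x \<in> D" for x y c
    using assms by (auto simp: csubspace_def)
  show m: "x \<in> D \<Longrightarrow> - x \<in> D" for x
    using c[of x "-1"] by (simp add: scaleC_minus_left)
  show "x \<in> D \<Longrightarrow> y \<in> D \<Longrightarrow> x - y \<in> D" using a(2)[of x "- y"] m[of y] by simp
  show "x \<in> D \<Longrightarrow> r *\<^sub>R x \<in> D" using c[of x "complex_of_real r"] by (simp add: scaleC_of_real)
qed

lemma closure_dense_orth:
  fixes x :: "'h::complex_hilbert"
  assumes "closure D = UNIV" "\<And>y. y \<in> D \<Longrightarrow> cinner x y = 0"
  shows "x = 0"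
proof -
  have "closed {y. cinner x y = 0}"
    by (intro closed_Collect_eq continuous_intros)
  then have "closure D \<subseteq> {y. cinner x y = 0}"
    by (intro closure_minimal) (use assms(2) in auto)
  then have "x \<in> {y. cinner x y = 0}" using assms(1) by blast
  then show ?thesis by simp
qed

section \<open>Orthogonal projections and the Riesz representation\<close>

lemma lim_inverse_add_one: "(\<lambda>n. 1 / (real n + 1)) \<longlonglongrightarrow> 0"
  using LIMSEQ_inverse_real_of_nat unfolding inverse_eq_divide of_nat_Suc by (simp only: add.commute)

text \<open>A minimising sequence for the distance to \<open>M\<close> is Cauchy by the
  parallelogram law; completeness gives a limit, and closedness of \<open>M\<close> keeps it in
  \<open>M\<close>.\<close>

theorem orthogonal_projection:
  fixes x :: "'h::complex_hilbert"
  assumes M: "csubspace M" "closed M"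
  shows "\<exists>m\<in>M. \<forall>y\<in>M. cinner (x - m) y = 0"
proof -
  define S where "S = (\<lambda>m. (norm (x - m))\<^sup>2) ` M"
  define d where "d = Inf S"
  have ne: "S \<noteq> {}" using csubspaceD(1)[OF M(1)] by (auto simp: S_def)
  have bdd: "bdd_below S" by (rule bdd_belowI[of _ 0]) (auto simp: S_def)
  have d_le: "d \<le> (norm (x - m))\<^sup>2" if "m \<in> M" for m
    unfolding d_def by (rule cInf_lower) (use that bdd in \<open>auto simp: S_def\<close>)
  have "\<exists>m\<in>M. (norm (x - m))\<^sup>2 < d + 1 / (real n + 1)" for n
    using cInf_less_iff[OF ne bdd, of "d + 1 / (real n + 1)"] by (auto simp: d_def S_def)
  then obtain m where m: "\<And>n. m n \<in> M" "\<And>n. (norm (x - m n))\<^sup>2 < d + 1 / (real n + 1)" by metis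
  have dist: "(norm (m j - m k))\<^sup>2 \<le> 2 / (real j + 1) + 2 / (real k + 1)" for j k
  proof -
    \<comment> \<open>The midpoint lies in \<open>M\<close>, so its squared distance from
      \<open>x\<close> is at least \<open>d\<close>; the parallelogram law turns this into a bound
      on \<open>m j - m k\<close>.\<close>
    let ?h = "(1/2) *\<^sub>R (m j + m k)"
    have "(x - m j) + (x - m k) = 2 *\<^sub>R (x - ?h)" by (simp add: scaleR_diff_right scaleR_2)
    then have "(norm ((x - m j) + (x - m k)))\<^sup>2 = 4 * (norm (x - ?h))\<^sup>2"
      by (simp add: power_mult_distrib)
    moreover have "(norm ((x - m k) - (x - m j)))\<^sup>2 + (norm ((x - m j) + (x - m k)))\<^sup>2
        = 2 * (norm (x - m j))\<^sup>2 + 2 * (norm (x - m k))\<^sup>2"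
      unfolding norm_diff_square[of "x - m k" "x - m j"] norm_add_square[of "x - m j" "x - m k"]
      by (subst cinner_commute[of "x - m k" "x - m j"]) simp
    moreover have "d \<le> (norm (x - ?h))\<^sup>2"
      by (intro d_le csubspaceD[OF M(1)] m)
    ultimately show ?thesis using m(2)[of j] m(2)[of k] by simp
  qed
  have "Cauchy m"
  proof (rule CauchyI)
    fix e :: real assume e: "e > 0"
    obtain N where N: "inverse (real (Suc N)) < e\<^sup>2 / 4"
      using reals_Archimedean[of "e\<^sup>2 / 4"] e by auto
    have "norm (m j - m k) < e" if "j \<ge> N" "k \<ge> N" for j k
    proof -
      have "1 / (real j + 1) \<le> inverse (real (Suc N))" "1 / (real k + 1) \<le> inverse (real (Suc N))"
        using that by (simp_all add: field_simps)
      then have "(norm (m j - m k))\<^sup>2 < e\<^sup>2" using dist[of j k] N by simp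
      then show ?thesis using e by (simp add: power2_less_imp_less)
    qed
    then show "\<exists>M. \<forall>j\<ge>M. \<forall>k\<ge>M. norm (m j - m k) < e" by blast
  qed
  then obtain l where l: "m \<longlonglongrightarrow> l" using Cauchy_convergent_iff convergent_def by blast
  have lM: "l \<in> M" using M(2) m(1) l by (metis closed_sequentially)
  have "(\<lambda>n. (norm (x - m n))\<^sup>2) \<longlonglongrightarrow> (norm (x - l))\<^sup>2" by (intro tendsto_intros l)
  moreover have "(\<lambda>n. d + 1 / (real n + 1)) \<longlonglongrightarrow> d + 0"
    by (intro tendsto_add tendsto_const lim_inverse_add_one)
  ultimately have ld: "(norm (x - l))\<^sup>2 \<le> d"
    using LIMSEQ_le[of "\<lambda>n. (norm (x - m n))\<^sup>2" _ "\<lambda>n. d + 1 / (real n + 1)" "d + 0"] m(2)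
    by (auto intro: less_imp_le)
  have "cinner (x - l) y = 0" if y: "y \<in> M" for y
  proof (cases "y = 0")
    case False
    \<comment> \<open>Moving the minimiser by this multiple of \<open>y\<close> lowers the squared
      distance by \<open>(cmod (cinner (x - l) y))\<^sup>2 / (norm y)\<^sup>2\<close>, which must
      therefore vanish.\<close>
    let ?c = "cinner (x - l) y / cinner y y"
    have "d \<le> (norm (x - (l + ?c *\<^sub>C y)))\<^sup>2"
      by (intro d_le csubspaceD[OF M(1)] lM y)
    then have "d \<le> (norm ((x - l) - ?c *\<^sub>C y))\<^sup>2" by (simp add: diff_diff_add)
    then have "(cmod (cinner (x - l) y))\<^sup>2 / (norm y)\<^sup>2 \<le> 0"
      using projection_norm[OF False, of "x - l"] ld by simp
    then show ?thesis using False by (simp add: divide_le_0_iff)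
  qed simp
  then show ?thesis using lM by blast
qed

text \<open>The component \<open>w\<close>, orthogonal to the kernel of \<open>f\<close>, of a
  vector \<open>u\<close> with \<open>f u \<noteq> 0\<close> spans the orthogonal complement of that
  kernel; a multiple of it represents \<open>f\<close>.\<close>

lemma riesz_representation:
  fixes f :: "'h::complex_hilbert \<Rightarrow> complex"
  assumes add: "\<And>x y. f (x + y) = f x + f y" and scale: "\<And>c x. f (c *\<^sub>C x) = c * f x"
    and bound: "\<And>x. cmod (f x) \<le> B * norm x"
  shows "\<exists>v. \<forall>x. f x = cinner x v"
proof (cases "\<forall>x. f x = 0")
  case True
  then show ?thesis by (intro exI[of _ 0]) simp
next
  case False
  then obtain u where u: "f u \<noteq> 0" by auto
  let ?M = "{x. f x = 0}"
  have lin: "bounded_linear f"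
  proof
    show "f (r *\<^sub>R x) = r *\<^sub>R f x" for r x
      using scale[of "complex_of_real r" x] by (simp add: scaleC_of_real scaleR_conv_of_real)
    show "\<exists>K. \<forall>x. norm (f x) \<le> norm x * K" using bound by (metis mult.commute)
  qed (rule add)
  have "closed ?M"
    by (intro closed_Collect_eq continuous_on_const linear_continuous_on lin)
  moreover have "csubspace ?M"
    using linear_simps(3)[OF lin] by (auto simp: csubspace_def add scale)
  ultimately obtain m where m: "f m = 0" "\<And>y. f y = 0 \<Longrightarrow> cinner (u - m) y = 0"
    using orthogonal_projection[of ?M u] by auto
  define w where "w = u - m"
  have fw: "f w = f u" using linear_simps(2)[OF lin, of u m] m(1) by (simp add: w_def)
  have w0: "w \<noteq> 0" using fw u linear_simps(3)[OF lin] by auto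
  have "f x = cinner x ((cnj (f w) / cinner w w) *\<^sub>C w)" for x
  proof -
    \<comment> \<open>This combination lies in the kernel, hence is orthogonal to \<open>w\<close>;
      solving the resulting equation for \<open>f x\<close> gives the representing vector.\<close>
    have "f (f w *\<^sub>C x - f x *\<^sub>C w) = 0" by (simp add: linear_simps(2)[OF lin] scale)
    then have "cinner (f w *\<^sub>C x - f x *\<^sub>C w) w = 0"
      using m(2) cinner_commute[of "f w *\<^sub>C x - f x *\<^sub>C w" w] by (simp add: w_def)
    moreover have "cnj (cinner w w) = cinner w w" using cinner_commute[of w w] by simp
    ultimately show ?thesis using w0 by (simp add: cinner_simps field_simps)
  qed
  then show ?thesis by blast
qed

section \<open>Unitaries, total families and extension from Gram matrices\<close>

lemma unitaryD:
  assumes "unitary W"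
  shows "W (x + y) = W x + W y" "W (c *\<^sub>C x) = c *\<^sub>C W x" "cinner (W x) (W y) = cinner x y" "surj W"
    "norm (W x) = norm x" "W 0 = 0" "W (x - y) = W x - W y" "bounded_linear W" "bij W"
proof -
  show a: "W (x + y) = W x + W y" and c: "W (c *\<^sub>C x) = c *\<^sub>C W x"
    and i: "cinner (W x) (W y) = cinner x y" and s: "surj W" for x y c
    using assms by (auto simp: unitary_def)
  show n: "norm (W x) = norm x" for x
  proof -
    have "(norm (W x))\<^sup>2 = (norm x)\<^sup>2" by (simp add: norm_eq_Re_cinner i)
    then show ?thesis by (simp add: power2_eq_iff_nonneg)
  qed
  show b: "bounded_linear W"
  proof
    show "W (r *\<^sub>R x) = r *\<^sub>R W x" for r x
      using c[of "complex_of_real r" x] by (simp add: scaleC_of_real)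
    show "\<exists>K. \<forall>x. norm (W x) \<le> norm x * K" by (rule exI[of _ 1]) (simp add: n)
  qed (rule a)
  show "W 0 = 0" and d: "W (x - y) = W x - W y" for x y by (simp_all add: linear_simps[OF b])
  have "inj W"
  proof (rule injI)
    fix x y assume "W x = W y"
    then have "norm (W (x - y)) = 0" by (simp add: d)
    then show "x = y" by (simp add: n)
  qed
  then show "bij W" using s by (simp add: bij_def)
qed

text \<open>Phrased through closed subspaces so that it serves as an induction principle: a closed
  linear property that holds on the family holds everywhere.\<close>

definition total :: "('i \<Rightarrow> 'h::complex_hilbert) \<Rightarrow> bool" where
  "total u \<longleftrightarrow> (\<forall>M. csubspace M \<and> closed M \<and> range u \<subseteq> M \<longrightarrow> M = UNIV)"

lemma totalD: "total u \<Longrightarrow> csubspace M \<Longrightarrow> closed M \<Longrightarrow> (\<And>i. u i \<in> M) \<Longrightarrow> x \<in> M"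
  by (auto simp: total_def)

text \<open>The remainder of \<open>x\<close> after projection onto a closed subspace containing the
  family is orthogonal to the family.\<close>

lemma total_orthI:
  assumes "\<And>x. (\<And>i. cinner x (u i) = 0) \<Longrightarrow> x = 0"
  shows "total u"
proof -
  have "x \<in> M" if M: "csubspace M" "closed M" "range u \<subseteq> M" for M x
  proof -
    obtain m where m: "m \<in> M" "\<And>y. y \<in> M \<Longrightarrow> cinner (x - m) y = 0"
      using orthogonal_projection[OF M(1,2), of x] by blast
    have "x - m = 0" by (rule assms) (use m(2) M(3) in blast)
    then show ?thesis using m(1) by simp
  qed
  then show ?thesis unfolding total_def by blast
qed

lemma total_orth:
  assumes "total u" "\<And>i. cinner x (u i) = 0"
  shows "x = 0"
proof -
  have "csubspace {y. cinner x y = 0}" by (simp add: csubspace_def cinner_simps)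
  moreover have "closed {y. cinner x y = 0}" by (intro closed_Collect_eq continuous_intros)
  ultimately have "x \<in> {y. cinner x y = 0}" using assms(2) by - (rule totalD[OF assms(1)], auto)
  then show ?thesis by simp
qed

lemma total_eqI:
  assumes "total u" "bounded_linear A" "bounded_linear B"
    "\<And>c x. A (c *\<^sub>C x) = c *\<^sub>C A x" "\<And>c x. B (c *\<^sub>C x) = c *\<^sub>C B x" "\<And>i. A (u i) = B (u i)"
  shows "A x = B x"
proof -
  have "csubspace {x. A x = B x}"
    using assms(4,5) by (simp add: csubspace_def linear_simps[OF assms(2)] linear_simps[OF assms(3)])
  moreover have "closed {x. A x = B x}"
    by (intro closed_Collect_eq linear_continuous_on assms)
  ultimately have "x \<in> {x. A x = B x}" using assms(6) by - (rule totalD[OF assms(1)], auto)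
  then show ?thesis by simp
qed

text \<open>A relation rather than a map, since for a linearly dependent family \<open>u\<close> one
  vector has several coefficient lists; equal Gram matrices make it isometric
  (\<open>gram_span_cinner\<close>), which restores uniqueness.\<close>

inductive gram_span :: "('i \<Rightarrow> 'h::complex_hilbert) \<Rightarrow> ('i \<Rightarrow> 'k::complex_hilbert) \<Rightarrow> 'h \<Rightarrow> 'k \<Rightarrow> bool"
  for u v where
  zero: "gram_span u v 0 0"
| step: "gram_span u v x y \<Longrightarrow> gram_span u v (x + c *\<^sub>C u i) (y + c *\<^sub>C v i)"

lemma gram_span_lin:
  assumes "gram_span u v x y"
  shows "gram_span u v x' y' \<Longrightarrow> gram_span u v (x + x') (y + y')" "gram_span u v (c *\<^sub>C x) (c *\<^sub>C y)"
proof -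
  assume "gram_span u v x' y'"
  then show "gram_span u v (x + x') (y + y')"
  proof induction
    case zero
    then show ?case using assms by simp
  next
    case (step x1 y1 c i)
    then show ?case using gram_span.step[OF step.IH, of c i] by (simp add: add.assoc)
  qed
next
  show "gram_span u v (c *\<^sub>C x) (c *\<^sub>C y)"
    using assms
  proof induction
    case zero
    then show ?case by (simp add: gram_span.zero)
  next
    case (step x1 y1 d i)
    then show ?case using gram_span.step[OF step.IH, of "c * d" i] by (simp add: scaleC_add_right scaleC_scaleC)
  qed
qed

lemma gram_span_cinner:
  assumes "\<And>i j. cinner (u i) (u j) = cinner (v i) (v j)" "gram_span u v x y" "gram_span u v x' y'"
  shows "cinner x x' = cinner y y'"
proof -
  have "cinner (u i) x' = cinner (v i) y'" for i
    using assms(3) by induction (simp_all add: cinner_simps assms(1))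
  with assms(2) show ?thesis by induction (simp_all add: cinner_simps)
qed

text \<open>The graph of the extension is the closure of the linear relation spanned by the pairs
  \<open>(u i, v i)\<close>; equality of the Gram matrices makes it the graph of an isometry.\<close>

theorem unitary_extension:
  fixes u :: "'i \<Rightarrow> 'h::complex_hilbert" and v :: "'i \<Rightarrow> 'k::complex_hilbert"
  assumes gram: "\<And>i j. cinner (u i) (u j) = cinner (v i) (v j)" and u: "total u" and v: "total v"
  shows "\<exists>W. unitary W \<and> (\<forall>i. W (u i) = v i)"
proof -
  define R where "R x y \<longleftrightarrow> (\<exists>X Y. (\<forall>n. gram_span u v (X n) (Y n)) \<and> X \<longlonglongrightarrow> x \<and> Y \<longlonglongrightarrow> y)" for x y
  have Rspan: "R x y" if "gram_span u v x y" for x y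
    unfolding R_def by (rule exI[of _ "\<lambda>_. x"], rule exI[of _ "\<lambda>_. y"]) (simp add: that)
  have Radd: "R (x + x') (y + y')" if xy: "R x y" "R x' y'" for x x' y y'
  proof -
    obtain X Y X' Y' where "\<forall>n. gram_span u v (X n) (Y n)" "X \<longlonglongrightarrow> x" "Y \<longlonglongrightarrow> y"
      "\<forall>n. gram_span u v (X' n) (Y' n)" "X' \<longlonglongrightarrow> x'" "Y' \<longlonglongrightarrow> y'" using xy by (auto simp: R_def)
    then show ?thesis unfolding R_def
      by (intro exI[of _ "\<lambda>n. X n + X' n"] exI[of _ "\<lambda>n. Y n + Y' n"]) (auto intro: gram_span_lin tendsto_add)
  qed
  have Rscale: "R (c *\<^sub>C x) (c *\<^sub>C y)" if xy: "R x y" for c x y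
  proof -
    obtain X Y where "\<forall>n. gram_span u v (X n) (Y n)" "X \<longlonglongrightarrow> x" "Y \<longlonglongrightarrow> y" using xy by (auto simp: R_def)
    then show ?thesis unfolding R_def
      by (intro exI[of _ "\<lambda>n. c *\<^sub>C X n"] exI[of _ "\<lambda>n. c *\<^sub>C Y n"])
        (auto intro: gram_span_lin bounded_linear.tendsto[OF bounded_linear_scaleC])
  qed
  have Rinner: "cinner x x' = cinner y y'" if xy: "R x y" "R x' y'" for x x' y y'
  proof -
    obtain X Y X' Y' where *: "\<forall>n. gram_span u v (X n) (Y n)" "X \<longlonglongrightarrow> x" "Y \<longlonglongrightarrow> y"
      "\<forall>n. gram_span u v (X' n) (Y' n)" "X' \<longlonglongrightarrow> x'" "Y' \<longlonglongrightarrow> y'" using xy by (auto simp: R_def)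
    have "cinner (X n) (X' n) = cinner (Y n) (Y' n)" for n
      using *(1,4) by (intro gram_span_cinner[OF gram]) auto
    then have "(\<lambda>n. cinner (X n) (X' n)) \<longlonglongrightarrow> cinner y y'"
      using tendsto_cinner[OF *(3,6)] by simp
    then show ?thesis using tendsto_cinner[OF *(2,5)] LIMSEQ_unique by blast
  qed
  have Rdiff: "R (x - x') (y - y')" if "R x y" "R x' y'" for x x' y y'
    using Radd[OF that(1) Rscale[OF that(2), of "-1"]] by (simp add: scaleC_minus_left)
  have Rnorm: "norm x = norm y" if "R x y" for x y
  proof -
    have "(norm x)\<^sup>2 = (norm y)\<^sup>2" unfolding norm_eq_Re_cinner Rinner[OF that that] ..
    then show ?thesis by (simp add: power2_eq_iff_nonneg)
  qed
  have Rgen: "R (u i) (v i)" for i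
    using Rspan[OF gram_span.step[OF gram_span.zero, of u v 1 i]] by simp
  have approx: "\<exists>x' y'. gram_span u v x' y' \<and> norm (x - x') < e \<and> norm (y - y') < e" if xy: "R x y" "e > 0" for x y e
  proof -
    obtain X Y where *: "\<forall>n. gram_span u v (X n) (Y n)" "X \<longlonglongrightarrow> x" "Y \<longlonglongrightarrow> y" using xy(1) by (auto simp: R_def)
    have "eventually (\<lambda>n. dist (X n) x < e \<and> dist (Y n) y < e) sequentially"
      using *(2,3) xy(2) by (intro eventually_conj tendstoD)
    then obtain n where "dist (X n) x < e" "dist (Y n) y < e" by (auto simp: eventually_sequentially)
    then have "norm (x - X n) < e" "norm (y - Y n) < e" by (simp_all add: dist_norm norm_minus_commute)
    then show ?thesis using *(1) by blast
  qed
  \<comment> \<open>A limit of limits: a diagonal sequence of spanned pairs within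
    \<open>1 / (n + 1)\<close> shows that the sequential closure \<open>R\<close> is itself
    closed.\<close>
  have Rclosed: "R x y" if xy: "\<And>n. R (X n) (Y n)" "X \<longlonglongrightarrow> x" "Y \<longlonglongrightarrow> y" for X Y x y
  proof -
    have "\<exists>p. gram_span u v (fst p) (snd p) \<and> norm (X n - fst p) < 1 / (real n + 1) \<and>
        norm (Y n - snd p) < 1 / (real n + 1)" for n
      using approx[OF xy(1), of "1 / (real n + 1)" n] by auto
    then obtain p where p: "\<forall>n. gram_span u v (fst (p n)) (snd (p n)) \<and> norm (X n - fst (p n)) < 1 / (real n + 1) \<and>
        norm (Y n - snd (p n)) < 1 / (real n + 1)"
      using choice[of "\<lambda>n p. gram_span u v (fst p) (snd p) \<and> norm (X n - fst p) < 1 / (real n + 1) \<and>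
        norm (Y n - snd p) < 1 / (real n + 1)"] by blast
    define X' Y' where "X' n = fst (p n)" and "Y' n = snd (p n)" for n
    have *: "gram_span u v (X' n) (Y' n)" "norm (X n - X' n) < 1 / (real n + 1)"
      "norm (Y n - Y' n) < 1 / (real n + 1)" for n using p by (auto simp: X'_def Y'_def)
    have "(\<lambda>n. X n - X' n) \<longlonglongrightarrow> 0" "(\<lambda>n. Y n - Y' n) \<longlonglongrightarrow> 0"
      using *(2,3) by (auto intro!: Lim_null_comparison[OF _ lim_inverse_add_one] always_eventually intro: less_imp_le)
    from tendsto_diff[OF xy(2) this(1)] tendsto_diff[OF xy(3) this(2)]
    show ?thesis using *(1) unfolding R_def by (intro exI[of _ X'] exI[of _ Y']) auto
  qed
  \<comment> \<open>The set of first components is closed because \<open>R\<close> preserves norms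
    of differences, so that the partners of a convergent sequence converge too; totality of
    \<open>u\<close> makes it the whole space. The second components are treated in the same
    way.\<close>
  have dom: "\<exists>y. R x y" for x
  proof -
    have "closed {x. \<exists>y. R x y}"
    proof (subst closed_sequential_limits, safe)
      fix X x assume X: "\<forall>n. X n \<in> {x. \<exists>y. R x y}" "X \<longlonglongrightarrow> x"
      then have "\<forall>n. \<exists>y. R (X n) y" by blast
      then obtain Y where Y: "\<And>n. R (X n) (Y n)" using choice[of "\<lambda>n y. R (X n) y"] by blast
      have "norm (Y j - Y k) = norm (X j - X k)" for j k
        using Rnorm[OF Rdiff[OF Y Y]] by simp
      then have "Cauchy Y" using LIMSEQ_imp_Cauchy[OF X(2)] by (simp add: Cauchy_def dist_norm)
      then obtain y where "Y \<longlonglongrightarrow> y" using Cauchy_convergent_iff convergent_def by blast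
      then show "\<exists>y. R x y" using Rclosed[OF Y X(2)] by blast
    qed
    moreover have "csubspace {x. \<exists>y. R x y}"
      using Rspan[OF gram_span.zero] Radd Rscale unfolding csubspace_def by blast
    ultimately have "x \<in> {x. \<exists>y. R x y}" using Rgen by - (rule totalD[OF u], auto)
    then show ?thesis by simp
  qed
  have ran: "\<exists>x. R x y" for y
  proof -
    have "closed {y. \<exists>x. R x y}"
    proof (subst closed_sequential_limits, safe)
      fix Y y assume Y: "\<forall>n. Y n \<in> {y. \<exists>x. R x y}" "Y \<longlonglongrightarrow> y"
      then have "\<forall>n. \<exists>x. R x (Y n)" by blast
      then obtain X where X: "\<And>n. R (X n) (Y n)" using choice[of "\<lambda>n x. R x (Y n)"] by blast
      have "norm (X j - X k) = norm (Y j - Y k)" for j k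
        using Rnorm[OF Rdiff[OF X X]] by simp
      then have "Cauchy X" using LIMSEQ_imp_Cauchy[OF Y(2)] by (simp add: Cauchy_def dist_norm)
      then obtain x where "X \<longlonglongrightarrow> x" using Cauchy_convergent_iff convergent_def by blast
      then show "\<exists>x. R x y" using Rclosed[OF X _ Y(2)] by blast
    qed
    moreover have "csubspace {y. \<exists>x. R x y}"
      using Rspan[OF gram_span.zero] Radd Rscale unfolding csubspace_def by blast
    ultimately have "y \<in> {y. \<exists>x. R x y}" using Rgen by - (rule totalD[OF v], auto)
    then show ?thesis by simp
  qed
  have uniq: "y = y'" if "R x y" "R x y'" for x y y'
    using Rnorm[OF Rdiff[OF that]] by simp
  define W where "W x = (SOME y. R x y)" for x
  have RW: "R x (W x)" for x unfolding W_def using dom by (rule someI_ex)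
  have W: "W x = y" if "R x y" for x y using uniq[OF RW that] .
  have "unitary W"
    unfolding unitary_def
  proof (intro conjI allI)
    show "surj W" unfolding surj_def using ran W[symmetric] by blast
  qed (rule W[OF Radd[OF RW RW]] W[OF Rscale[OF RW]] Rinner[OF RW RW, symmetric])+
  moreover have "W (u i) = v i" for i by (rule W[OF Rgen])
  ultimately show ?thesis by blast
qed

section \<open>Presented *-algebras\<close>

lemma scalar_zero [simp]: "scalar 0 = 0"
  by (simp add: scalar_def)

lemma scalar_minus: "scalar (- c) = - scalar c"
  using scalar_simps(2)[of c "- c"] by (simp add: eq_neg_iff_add_eq_0 add.commute)

lemma adj_diff: "adj (p - q) = adj p - adj q"
  using adj_add[of p "- q"] by (simp add: adj_minus)

section \<open>Induction over the free *-algebra and its universal property\<close>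

lemma single_Cons:
  "Poly_Mapping.single (Word ((g, b) # xs)) c = (if b then adj (gen g) else gen g) * Poly_Mapping.single (Word xs) c"
  by (simp add: gen_def adj_single star_word_def mult_single plus_word_def)

text \<open>Words are products of generators and adjoint generators, so a property compatible with
  sums and products is checked on scalars and letters.\<close>

lemma free_star_induct [case_names scalar gen adj_gen add mult]:
  assumes "\<And>c. P (scalar c)" "\<And>g. P (gen g)" "\<And>g. P (adj (gen g))"
    "\<And>p q. P p \<Longrightarrow> P q \<Longrightarrow> P (p + q)" "\<And>p q. P p \<Longrightarrow> P q \<Longrightarrow> P (p * q)"
  shows "P p"
proof (induction p rule: poly_mapping_single_induct)
  case zero
  then show ?case using assms(1)[of 0] by simp
next
  case (add k v p)
  have "P (Poly_Mapping.single (Word xs) v)" for xs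
  proof (induction xs)
    case Nil
    then show ?case using assms(1)[of v] by (simp add: scalar_def zero_word_def)
  next
    case (Cons x xs)
    then show ?case using assms(2,3,5) by (cases x) (simp add: single_Cons)
  qed
  from this[of "letters k"] show ?case using assms(4) add by simp
qed

text \<open>\<open>F\<close> takes coefficient and word together because scalars act differently in
  the targets: through \<open>scalar\<close> in a free *-algebra and through \<open>scaleC\<close>
  in a Hilbert space. Additivity of \<open>F\<close> in the coefficient makes the extension
  additive.\<close>

definition linear_extension :: "(complex \<Rightarrow> 'g word \<Rightarrow> 'v::ab_group_add) \<Rightarrow> 'g free_star \<Rightarrow> 'v" where
  "linear_extension F p = (\<Sum>w\<in>Poly_Mapping.keys p. F (Poly_Mapping.lookup p w) w)"

lemma linear_extension_single:
  "(\<And>w. F 0 w = 0) \<Longrightarrow> linear_extension F (Poly_Mapping.single w c) = F c w"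
  by (simp add: linear_extension_def)

lemma linear_extension_add:
  assumes zero: "\<And>w. F 0 w = 0" and add: "\<And>a b w. F (a + b) w = F a w + F b w"
  shows "linear_extension F (p + q) = linear_extension F p + linear_extension F q"
proof -
  let ?K = "Poly_Mapping.keys p \<union> Poly_Mapping.keys q"
  have *: "linear_extension F r = (\<Sum>w\<in>?K. F (Poly_Mapping.lookup r w) w)"
    if "Poly_Mapping.keys r \<subseteq> ?K" for r
    unfolding linear_extension_def
    by (rule sum.mono_neutral_left) (use that zero in \<open>auto simp: in_keys_iff\<close>)
  show ?thesis
    using *[of "p + q", OF Poly_Mapping.keys_add] *[of p] *[of q]
    by (simp add: lookup_add add sum.distrib)
qed

definition free_hom :: "('g \<Rightarrow> 'k free_star) \<Rightarrow> 'g free_star \<Rightarrow> 'k free_star" where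
  "free_hom h = linear_extension
     (\<lambda>c w. scalar c * prod_list (map (\<lambda>(g, b). if b then adj (h g) else h g) (letters w)))"

lemma free_hom_add: "free_hom h (p + q) = free_hom h p + free_hom h q"
  unfolding free_hom_def by (rule linear_extension_add) (simp_all add: scalar_simps distrib_right)

lemma free_hom_single: "free_hom h (Poly_Mapping.single w c) =
    scalar c * prod_list (map (\<lambda>(g, b). if b then adj (h g) else h g) (letters w))"
  unfolding free_hom_def by (rule linear_extension_single) simp

lemma free_hom_scalar [simp]: "free_hom h (scalar c) = scalar c"
  by (simp add: scalar_def free_hom_single zero_word_def)

lemma free_hom_zero [simp]: "free_hom h 0 = 0"
  using free_hom_scalar[of h 0] by simp

lemma free_hom_one [simp]: "free_hom h 1 = 1"
  using free_hom_scalar[of h 1] by (simp only: scalar_simps(1))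

lemma free_hom_minus: "free_hom h (- p) = - free_hom h p"
  using free_hom_add[of h p "- p"] by (simp add: eq_neg_iff_add_eq_0 add.commute)

lemma free_hom_diff: "free_hom h (p - q) = free_hom h p - free_hom h q"
  using free_hom_add[of h p "- q"] by (simp add: free_hom_minus)

lemma free_hom_gen [simp]: "free_hom h (gen g) = h g" "free_hom h (adj (gen g)) = adj (h g)"
  by (simp_all add: gen_def free_hom_single adj_single star_word_def scalar_simps)

lemma scalar_left_commute: "p * (scalar c * q) = scalar c * (p * q)"
  by (simp only: mult.assoc[symmetric] scalar_commute)

lemma scalar_mult_mult: "scalar a * p * (scalar b * q) = scalar (a * b) * (p * q)"
  by (simp only: mult.assoc scalar_left_commute[of p b q] scalar_simps(3))

lemma free_hom_mult: "free_hom h (p * q) = free_hom h p * free_hom h q"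
proof (induction p rule: poly_mapping_single_induct)
  case zero
  then show ?case by simp
next
  case (add k v p)
  have "free_hom h (Poly_Mapping.single k v * q) = free_hom h (Poly_Mapping.single k v) * free_hom h q"
    by (induction q rule: poly_mapping_single_induct)
      (simp_all add: distrib_left free_hom_add mult_single free_hom_single plus_word_def scalar_mult_mult)
  then show ?case by (simp add: distrib_right free_hom_add add.IH)
qed

lemma free_hom_power: "free_hom h (p ^ n) = free_hom h p ^ n"
  by (induction n) (simp_all add: free_hom_mult)

lemma free_hom_adj: "free_hom h (adj p) = adj (free_hom h p)"
  by (induction p rule: free_star_induct) (simp_all add: adj_add adj_mult free_hom_add free_hom_mult)

text \<open>Minimality of the *-ideal as an induction rule in terms of ring operations. Negatives
  come from multiplication by \<open>- 1\<close>.\<close>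

lemma star_ideal_least:
  assumes gens: "\<And>r. r \<in> R \<Longrightarrow> P r \<and> P (adj r)" and zero: "P 0"
    and add: "\<And>p q. P p \<Longrightarrow> P q \<Longrightarrow> P (p + q)"
    and mult: "\<And>p q. P p \<Longrightarrow> P (q * p)" "\<And>p q. P p \<Longrightarrow> P (p * q)"
    and p: "p \<in> star_ideal R"
  shows "P p"
proof -
  have minus: "P (- p)" if "P p" for p using mult(1)[OF that, of "- 1"] by simp
  let ?J = "{p. P p}"
  have "ideal ?J free_ring"
  proof (rule idealI[OF ring_free_ring])
    show "subgroup ?J (add_monoid free_ring)"
    proof (rule group.subgroupI)
      show "Group.group (add_monoid free_ring)"
        using ring_free_ring abelian_group.a_group ring.is_abelian_group by blast
      fix p assume "p \<in> ?J"
      moreover have "inv\<^bsub>add_monoid free_ring\<^esub> p = - p"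
        using abelian_group.minus_equality[of free_ring "- p" p] ring.is_abelian_group[OF ring_free_ring]
        by (simp add: a_inv_def free_ring_def)
      ultimately show "inv\<^bsub>add_monoid free_ring\<^esub> p \<in> ?J" using minus by simp
    qed (use zero add in \<open>auto simp: free_ring_def\<close>)
  qed (use mult in \<open>auto simp: free_ring_def\<close>)
  moreover have "R \<union> adj ` R \<subseteq> ?J" using gens by auto
  ultimately have "star_ideal R \<subseteq> ?J" by (auto simp: star_ideal_def genideal_def)
  then show ?thesis using p by auto
qed

section \<open>Maps between presented algebras\<close>

lemma free_hom_star_ideal:
  assumes "\<And>r. r \<in> R \<Longrightarrow> free_hom h r \<in> star_ideal S" and "p \<in> star_ideal R"
  shows "free_hom h p \<in> star_ideal S"
  using assms(2)
  by (rule star_ideal_least[where P = "\<lambda>p. free_hom h p \<in> star_ideal S", rotated -1])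
    (auto simp: assms(1) free_hom_adj adj_star_ideal free_hom_add free_hom_mult star_ideal_closed)

text \<open>The representative is arbitrary: when \<open>h\<close> sends the relations into the
  target ideal, the images of two representatives of one class differ by an element of that
  ideal.\<close>

definition presented_map :: "'g free_star set \<Rightarrow> 'k free_star set \<Rightarrow> ('g \<Rightarrow> 'k free_star) \<Rightarrow>
    'g free_star set \<Rightarrow> 'k free_star set" where
  "presented_map R S h X = cls S (free_hom h (SOME p. X = cls R p))"

lemma presented_map_cls:
  assumes "\<And>r. r \<in> R \<Longrightarrow> free_hom h r \<in> star_ideal S"
  shows "presented_map R S h (cls R p) = cls S (free_hom h p)"
proof -
  have "cls R p = cls R (SOME q. cls R p = cls R q)" by (rule someI[of _ p]) simp
  then have "free_hom h (p - (SOME q. cls R p = cls R q)) \<in> star_ideal S"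
    by (intro free_hom_star_ideal[OF assms]) (simp_all only: cls_eq_iff)
  then show ?thesis
    unfolding presented_map_def by (subst eq_commute) (simp only: cls_eq_iff free_hom_diff)
qed

lemma cls_add_cong: "cls S p = cls S p' \<Longrightarrow> cls S q = cls S q' \<Longrightarrow> cls S (p + q) = cls S (p' + q')"
  by (simp only: presented_simps(3)[symmetric])

lemma cls_mult_cong: "cls S p = cls S p' \<Longrightarrow> cls S q = cls S q' \<Longrightarrow> cls S (p * q) = cls S (p' * q')"
  by (simp only: presented_simps(2)[symmetric])

lemma cls_adj_cong: "cls S p = cls S p' \<Longrightarrow> cls S (adj p) = cls S (adj p')"
  by (simp only: presented_simps(7)[symmetric])

text \<open>Both composites are compatible with sums, products and adjoints modulo the ideals, so it
  suffices that they fix the classes of the generators.\<close>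

lemma star_iso_presented:
  fixes h :: "'g \<Rightarrow> 'k free_star"
  assumes h: "\<And>r. r \<in> R \<Longrightarrow> free_hom h r \<in> star_ideal S"
    and k: "\<And>s. s \<in> S \<Longrightarrow> free_hom k s \<in> star_ideal R"
    and kh: "\<And>g. cls R (free_hom k (h g)) = cls R (gen g)"
    and hk: "\<And>j. cls S (free_hom h (k j)) = cls S (gen j)"
  shows "star_iso (presented R) (presented S) (presented_map R S h)"
proof -
  have inv1: "cls R (free_hom k (free_hom h p)) = cls R p" for p
    by (induction p rule: free_star_induct)
      (simp_all add: kh free_hom_adj free_hom_add free_hom_mult,
        (rule cls_add_cong cls_mult_cong cls_adj_cong kh | assumption)+)
  have inv2: "cls S (free_hom h (free_hom k p)) = cls S p" for p
    by (induction p rule: free_star_induct)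
      (simp_all add: hk free_hom_adj free_hom_add free_hom_mult,
        (rule cls_add_cong cls_mult_cong cls_adj_cong hk | assumption)+)
  note [simp] = presented_map_cls[OF h] presented_simps
  have "presented_map R S h \<in> ring_hom (presented R) (presented S)"
    by (rule ring_hom_memI) (auto simp: free_hom_add free_hom_mult)
  moreover have "bij_betw (presented_map R S h) (carrier (presented R)) (carrier (presented S))"
    by (rule bij_betwI[where g = "presented_map S R k"]) (auto simp: presented_map_cls[OF k] inv1 inv2)
  ultimately show ?thesis
    by (auto simp: star_iso_def ring_iso_def free_hom_mult free_hom_adj)
qed

section \<open>Representations from operators on a common domain\<close>

lemma star_rep_iso:
  assumes \<rho>: "star_rep B D \<rho>" and \<phi>: "star_iso A B \<phi>"
  shows "star_rep A D (\<lambda>X. \<rho> (\<phi> X))"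
proof -
  have hom: "\<phi> \<in> ring_hom A B" and c: "\<And>X. X \<in> carrier A \<Longrightarrow> \<phi> X \<in> carrier B"
    using \<phi> by (auto simp: star_iso_def ring_iso_def ring_hom_def)
  show ?thesis
    using \<rho> \<phi> ring_hom_add[OF hom] ring_hom_mult[OF hom] ring_hom_one[OF hom] c
    unfolding star_rep_def star_iso_def by simp
qed

text \<open>The flag \<open>True\<close> marks the starred letter, as in words, so the last
  assumption makes the operators of \<open>g\<close> and of its adjoint formally adjoint on the
  common invariant domain. Density lets a vanishing operator be recognised by inner
  products.\<close>

locale operator_family =
  fixes D :: "'h::complex_hilbert set" and T :: "'g \<times> bool \<Rightarrow> 'h \<Rightarrow> 'h"
  assumes subspace: "csubspace D" and dense: "closure D = UNIV"
    and T_closed: "\<xi> \<in> D \<Longrightarrow> T x \<xi> \<in> D"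
    and T_add: "\<xi> \<in> D \<Longrightarrow> \<eta> \<in> D \<Longrightarrow> T x (\<xi> + \<eta>) = T x \<xi> + T x \<eta>"
    and T_scale: "\<xi> \<in> D \<Longrightarrow> T x (c *\<^sub>C \<xi>) = c *\<^sub>C T x \<xi>"
    and T_adjoint: "\<xi> \<in> D \<Longrightarrow> \<eta> \<in> D \<Longrightarrow> cinner (T (g, b) \<xi>) \<eta> = cinner \<xi> (T (g, \<not> b) \<eta>)"
begin

definition evaluate :: "'g free_star \<Rightarrow> 'h \<Rightarrow> 'h" where
  "evaluate p \<xi> = linear_extension (\<lambda>c w. c *\<^sub>C foldr T (letters w) \<xi>) p"

lemma evaluate_add: "evaluate (p + q) \<xi> = evaluate p \<xi> + evaluate q \<xi>"
  unfolding evaluate_def by (rule linear_extension_add) (simp_all add: scaleC_add_left)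

lemma evaluate_single: "evaluate (Poly_Mapping.single w c) \<xi> = c *\<^sub>C foldr T (letters w) \<xi>"
  unfolding evaluate_def by (rule linear_extension_single) simp

lemma evaluate_scalar: "evaluate (scalar c) \<xi> = c *\<^sub>C \<xi>"
  by (simp add: scalar_def evaluate_single zero_word_def)

lemma evaluate_zero [simp]: "evaluate 0 \<xi> = 0"
  using evaluate_scalar[of 0 \<xi>] by simp

lemma evaluate_one [simp]: "evaluate 1 \<xi> = \<xi>"
  using evaluate_scalar[of 1 \<xi>] by (simp add: scalar_simps(1))

lemma evaluate_minus: "evaluate (- p) \<xi> = - evaluate p \<xi>"
  using evaluate_add[of p "- p" \<xi>] by (simp add: eq_neg_iff_add_eq_0 add.commute)

lemma evaluate_diff: "evaluate (p - q) \<xi> = evaluate p \<xi> - evaluate q \<xi>"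
  using evaluate_add[of p "- q" \<xi>] by (simp add: evaluate_minus)

lemma evaluate_gen: "evaluate (gen g) \<xi> = T (g, False) \<xi>" "evaluate (adj (gen g)) \<xi> = T (g, True) \<xi>"
  by (simp_all add: gen_def evaluate_single adj_single star_word_def)

lemma word_action:
  assumes "\<xi> \<in> D" "\<eta> \<in> D"
  shows "foldr T xs \<xi> \<in> D" "foldr T xs (\<xi> + \<eta>) = foldr T xs \<xi> + foldr T xs \<eta>"
    "foldr T xs (c *\<^sub>C \<xi>) = c *\<^sub>C foldr T xs \<xi>"
proof -
  have c: "foldr T xs \<xi> \<in> D" if "\<xi> \<in> D" for xs \<xi>
    by (induction xs) (simp_all add: that T_closed)
  show "foldr T xs \<xi> \<in> D" by (rule c[OF assms(1)])
  show "foldr T xs (\<xi> + \<eta>) = foldr T xs \<xi> + foldr T xs \<eta>"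
    by (induction xs) (simp_all add: T_add c assms)
  show "foldr T xs (c *\<^sub>C \<xi>) = c *\<^sub>C foldr T xs \<xi>"
    by (induction xs) (simp_all add: T_scale c assms)
qed

lemma evaluate_linear:
  assumes "\<xi> \<in> D" "\<eta> \<in> D"
  shows "evaluate p \<xi> \<in> D" "evaluate p (\<xi> + \<eta>) = evaluate p \<xi> + evaluate p \<eta>"
    "evaluate p (c *\<^sub>C \<xi>) = c *\<^sub>C evaluate p \<xi>"
  using assms
  by (induction p rule: poly_mapping_single_induct)
    (simp_all add: evaluate_add evaluate_single word_action csubspaceD[OF subspace] scaleC_add_right
      scaleC_scaleC mult.commute add_ac)

lemma evaluate_mult: "\<xi> \<in> D \<Longrightarrow> evaluate (p * q) \<xi> = evaluate p (evaluate q \<xi>)"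
proof (induction p rule: poly_mapping_single_induct)
  case zero
  then show ?case by simp
next
  case (add k v p)
  have "evaluate (Poly_Mapping.single k v * q) \<xi> = evaluate (Poly_Mapping.single k v) (evaluate q \<xi>)"
  proof (induction q rule: poly_mapping_single_induct)
    case zero
    then show ?case using word_action(3)[OF add.prems add.prems, of _ 0] by (simp add: evaluate_single)
  next
    case (add l u q)
    then show ?case using \<open>\<xi> \<in> D\<close>
      by (simp add: distrib_left evaluate_add evaluate_single mult_single plus_word_def evaluate_linear
          word_action csubspaceD[OF subspace] scaleC_add_right scaleC_scaleC)
  qed
  then show ?case using add by (simp add: distrib_right evaluate_add)
qed

lemma evaluate_adjoint:
  "\<xi> \<in> D \<Longrightarrow> \<eta> \<in> D \<Longrightarrow> cinner (evaluate p \<xi>) \<eta> = cinner \<xi> (evaluate (adj p) \<eta>)"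
proof (induction p arbitrary: \<xi> \<eta> rule: free_star_induct)
  case (gen g)
  then show ?case using T_adjoint[of \<xi> \<eta> g False] by (simp add: evaluate_gen)
next
  case (adj_gen g)
  then show ?case using T_adjoint[of \<xi> \<eta> g True] by (simp add: evaluate_gen)
qed (simp_all add: evaluate_scalar evaluate_add adj_add adj_mult evaluate_mult evaluate_linear cinner_simps)

definition represent :: "'g free_star set \<Rightarrow> 'g free_star set \<Rightarrow> 'h \<Rightarrow> 'h" where
  "represent R X = evaluate (SOME p. X = cls R p)"

context
  fixes R :: "'g free_star set"
  assumes relations: "\<And>r \<xi>. r \<in> R \<Longrightarrow> \<xi> \<in> D \<Longrightarrow> evaluate r \<xi> = 0"
begin

text \<open>The *-ideal also contains the adjoints of the relations. An adjoint relation is tested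
  against the dense domain, where it moves to the other side of the inner product and becomes the
  original relation.\<close>

lemma evaluate_star_ideal:
  assumes "p \<in> star_ideal R" "\<xi> \<in> D"
  shows "evaluate p \<xi> = 0"
proof -
  have "evaluate (adj r) \<xi> = 0" if "r \<in> R" "\<xi> \<in> D" for r \<xi>
  proof (rule closure_dense_orth[OF dense])
    fix \<eta> assume "\<eta> \<in> D"
    then show "cinner (evaluate (adj r) \<xi>) \<eta> = 0"
      using that by (simp add: evaluate_adjoint relations)
  qed
  moreover have "evaluate p 0 = 0" for p
    using evaluate_linear(3)[of 0 0 p 0] csubspaceD(1)[OF subspace] by simp
  ultimately have "\<forall>\<xi>\<in>D. evaluate p \<xi> = 0"
    using relations
    by - (rule star_ideal_least[where P = "\<lambda>p. \<forall>\<xi>\<in>D. evaluate p \<xi> = 0", OF _ _ _ _ _ assms(1)],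
      simp_all add: evaluate_add evaluate_mult evaluate_linear)
  then show ?thesis using assms(2) by blast
qed

lemma represent_cls:
  assumes "\<xi> \<in> D"
  shows "represent R (cls R p) \<xi> = evaluate p \<xi>"
proof -
  have "cls R p = cls R (SOME q. cls R p = cls R q)" by (rule someI[of _ p]) simp
  then have "evaluate (p - (SOME q. cls R p = cls R q)) \<xi> = 0"
    using evaluate_star_ideal assms by (simp add: cls_eq_iff)
  then show ?thesis by (simp add: represent_def evaluate_diff)
qed

lemma star_rep_represent: "star_rep (presented R) D (represent R)"
  unfolding star_rep_def presented_simps(1)
  by (auto simp: presented_simps represent_cls subspace dense evaluate_linear csubspaceD[OF subspace]
      evaluate_add evaluate_mult evaluate_scalar evaluate_adjoint)

end

end

section \<open>The canonical isomorphism\<close>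

text \<open>The value of the commutator is an argument of its own, so that the rules below compute
  it while the derivation of a bracket is assembled; \<open>bracket_eq\<close> then leaves a single
  closing identity.\<close>

definition bracket_mod :: "'g free_star set \<Rightarrow> 'g free_star \<Rightarrow> 'g free_star \<Rightarrow> 'g free_star \<Rightarrow> bool" where
  "bracket_mod S p q r \<longleftrightarrow> p * q - q * p - r \<in> star_ideal S"

lemma star_ideal_diff: "p \<in> star_ideal S \<Longrightarrow> q \<in> star_ideal S \<Longrightarrow> p - q \<in> star_ideal S"
  using star_ideal_closed(2)[OF _ star_ideal_closed(3), of p S q] by simp

lemma bracket_add:
  assumes "bracket_mod S p q r" "bracket_mod S p' q r'"
  shows "bracket_mod S (p + p') q (r + r')"
  using star_ideal_closed(2)[OF assms[unfolded bracket_mod_def]]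
  by (simp add: bracket_mod_def algebra_simps)

lemma bracket_diff:
  assumes "bracket_mod S p q r" "bracket_mod S p' q r'"
  shows "bracket_mod S (p - p') q (r - r')"
  using star_ideal_diff[OF assms[unfolded bracket_mod_def]]
  by (simp add: bracket_mod_def algebra_simps)

lemma bracket_scale:
  assumes "bracket_mod S p q r"
  shows "bracket_mod S (scalar c * p) q (scalar c * r)"
proof -
  have "scalar c * (p * q - q * p - r) = scalar c * p * q - q * (scalar c * p) - scalar c * r"
    by (simp only: right_diff_distrib mult.assoc scalar_left_commute[of q])
  then show ?thesis
    using star_ideal_closed(4)[OF assms[unfolded bracket_mod_def], of "scalar c"]
    by (simp only: bracket_mod_def)
qed

lemma bracket_sym:
  assumes "bracket_mod S p q r"
  shows "bracket_mod S q p (- r)"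
  using star_ideal_closed(3)[OF assms[unfolded bracket_mod_def]]
  by (simp add: bracket_mod_def algebra_simps)

text \<open>Leibniz rule: taking the commutator with \<open>q\<close> is a derivation. The two
  defects are multiplied into the ideal from the right and from the left.\<close>

lemma bracket_mult:
  assumes "bracket_mod S p q r" "bracket_mod S p' q r'"
  shows "bracket_mod S (p * p') q (r * p' + p * r')"
proof -
  have "(p * q - q * p - r) * p' + p * (p' * q - q * p' - r') = p * p' * q - q * (p * p') - (r * p' + p * r')"
    by (simp add: algebra_simps)
  then show ?thesis
    using star_ideal_closed(2)[OF star_ideal_closed(5)[OF assms(1)[unfolded bracket_mod_def], of p']
        star_ideal_closed(4)[OF assms(2)[unfolded bracket_mod_def], of p]]
    by (simp only: bracket_mod_def)
qed

lemma bracket_adj: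
  assumes "bracket_mod S p q r"
  shows "bracket_mod S (adj q) (adj p) (adj r)"
  using adj_star_ideal[OF assms[unfolded bracket_mod_def]]
  by (simp add: bracket_mod_def adj_diff adj_mult)

lemma bracket_self: "bracket_mod S p p 0"
  by (simp add: bracket_mod_def star_ideal_closed)

lemma bracket_eq: "bracket_mod S p q r \<Longrightarrow> r = r' \<Longrightarrow> bracket_mod S p q r'"
  by simp

text \<open>Allows an element to be replaced by a congruent one; it is applied to the completed
  squares, whose brackets are much shorter than those of the original formulas.\<close>

lemma bracket_cong:
  assumes "bracket_mod S p q r" "p - p' \<in> star_ideal S"
  shows "bracket_mod S p' q r"
proof -
  have "(p * q - q * p - r) - ((p - p') * q - q * (p - p')) = p' * q - q * p' - r"
    by (simp add: algebra_simps)
  then show ?thesis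
    using star_ideal_diff[OF assms(1)[unfolded bracket_mod_def]
        star_ideal_diff[OF star_ideal_closed(5)[OF assms(2), of q] star_ideal_closed(4)[OF assms(2), of q]]]
    by (simp only: bracket_mod_def)
qed

lemma bracket_zero_iff: "bracket_mod S p q 0 \<longleftrightarrow> p * q - q * p \<in> star_ideal S"
  by (simp add: bracket_mod_def)

lemma adj_scalar_mult: "adj (scalar c * p) = scalar (cnj c) * adj p"
  by (simp add: adj_mult scalar_commute)

lemma scalar_scalar: "scalar a * scalar b = scalar (a * b)" "scalar a * (scalar b * p) = scalar (a * b) * p"
  by (simp_all only: scalar_simps(3) mult.assoc)

text \<open>Completing the square in the formula for \<open>a\<^sub>2\<close>: modulo commutation of \<open>b\<close> and \<open>a\<^sup>*\<close>, its
  quadratic part is \<open>A\<^sup>2 / (2 x\<^sub>1)\<close>.\<close>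

lemma complete_square:
  fixes x :: complex
  assumes x: "x \<noteq> 0" and comm: "bracket_mod S y b 0"
  defines "r \<equiv> complex_of_real (cmod x)"
  shows "(scalar (cnj x / 2) * b ^ 2 + scalar r * y * b + scalar (x / 2) * y ^ 2)
    - scalar (1 / (2 * x)) * ((scalar r * b + scalar x * y) * (scalar r * b + scalar x * y)) \<in> star_ideal S"
proof -
  have rr: "r * r = x * cnj x"
    using complex_norm_square[of x] unfolding r_def power2_eq_square of_real_mult .
  \<comment> \<open>By \<open>r * r = x * cnj x\<close> the coefficients of the expanded square
    become those of the quadratic part; the two mixed terms agree once \<open>b\<close> and
    \<open>y\<close> commute.\<close>
  have k: "1 / (2 * x) * (r * r) = cnj x / 2" "1 / (2 * x) * (r * x) = r / 2"
    "1 / (2 * x) * (x * r) = r / 2" "1 / (2 * x) * (x * x) = x / 2"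
    unfolding rr using x by (simp_all add: field_simps)
  have "scalar (1 / (2 * x)) * ((scalar r * b + scalar x * y) * (scalar r * b + scalar x * y))
      = scalar (cnj x / 2) * (b * b) + scalar (r / 2) * (b * y) + (scalar (r / 2) * (y * b) + scalar (x / 2) * (y * y))"
    by (simp only: distrib_left distrib_right scalar_mult_mult scalar_scalar k add_ac)
  moreover have "scalar r * y * b = scalar (r / 2) * (y * b) + scalar (r / 2) * (y * b)"
    by (simp only: distrib_right[symmetric] scalar_simps(2)[symmetric] mult.assoc) simp
  ultimately have "(scalar (cnj x / 2) * b ^ 2 + scalar r * y * b + scalar (x / 2) * y ^ 2)
    - scalar (1 / (2 * x)) * ((scalar r * b + scalar x * y) * (scalar r * b + scalar x * y))
    = scalar (r / 2) * (y * b - b * y)"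
    by (simp add: power2_eq_square right_diff_distrib)
  then show ?thesis
    using star_ideal_closed(4)[of "y * b - b * y" S "scalar (r / 2)"] comm by (simp add: bracket_zero_iff)
qed

section \<open>The triangular substitution and its inverse\<close>

locale iso_parameters =
  fixes x1 x2 :: complex
  assumes x1: "x1 \<noteq> 0"
begin

definition r :: complex where "r = complex_of_real (cmod x1)"
definition s :: complex where "s = complex_of_real (sqrt (1 + (cmod x2)\<^sup>2 / (cmod x1)\<^sup>2))"

lemma r_nonzero [simp]: "r \<noteq> 0" and x1_nonzero [simp]: "x1 \<noteq> 0" and cnj_r [simp]: "cnj r = r"
  and cnj_s [simp]: "cnj s = s"
  using x1 by (simp_all add: r_def s_def)

lemma rr: "r * r = x1 * cnj x1"
  using complex_norm_square[of x1] unfolding r_def power2_eq_square of_real_mult .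

text \<open>This normalises the canonical commutator of \<open>a2\<close>: \<open>c3\<close>
  contributes \<open>s * s\<close>, and the term in \<open>adj c2\<close> subtracts the second
  summand.\<close>

lemma ss: "s * s = 1 + x2 / r * (cnj x2 / r)"
proof -
  have "s * s = complex_of_real (1 + (cmod x2)\<^sup>2 / (cmod x1)\<^sup>2)"
    unfolding s_def of_real_mult[symmetric] by (simp del: of_real_add of_real_divide)
  also have "\<dots> = 1 + complex_of_real ((cmod x2)\<^sup>2) / (r * r)"
    by (simp add: r_def power2_eq_square)
  finally show ?thesis by (simp add: complex_norm_square del: of_real_power)
qed

lemma s_nonzero [simp]: "s \<noteq> 0"
proof -
  have "0 < 1 + (cmod x2)\<^sup>2 / (cmod x1)\<^sup>2" by (simp add: add_pos_nonneg)
  then show ?thesis unfolding s_def of_real_eq_0_iff by (simp only: real_sqrt_eq_zero_cancel_iff)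
qed

text \<open>The formulas for \<open>A\<close> and \<open>a2\<close> take arbitrary arguments, since
  they are evaluated both at the CCR generators and at the candidates \<open>a1\<close>,
  \<open>b2\<close>, \<open>b3\<close> for their preimages.\<close>

definition image_A :: "'g free_star \<Rightarrow> 'g free_star \<Rightarrow> 'g free_star" where
  "image_A c1 c2 = scalar r * c2 + scalar x1 * adj c1"

definition image_a2 :: "'g free_star \<Rightarrow> 'g free_star \<Rightarrow> 'g free_star \<Rightarrow> 'g free_star" where
  "image_a2 c1 c2 c3 = scalar s * c3 - scalar (x2 / r) * adj c2 + scalar (cnj x1 / 2) * c2 ^ 2
     + scalar r * adj c1 * c2 + scalar (x1 / 2) * adj c1 ^ 2"

definition forward :: "generator \<Rightarrow> 3 free_star" where
  "forward g = (case g of Ga1 \<Rightarrow> gen 1 | GA \<Rightarrow> image_A (gen 1) (gen 2)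
     | Ga2 \<Rightarrow> image_a2 (gen 1) (gen 2) (gen 3))"

abbreviation "a1 \<equiv> gen Ga1"
abbreviation "a2 \<equiv> gen Ga2"
abbreviation "AA \<equiv> gen GA"

definition b2 :: "generator free_star" where
  "b2 = scalar (1 / r) * (AA - scalar x1 * adj a1)"

text \<open>\<open>image_a2 a1 b2 0\<close> collects the terms of \<open>a2\<close> without
  \<open>c3\<close>; what remains is \<open>s\<close> times the preimage of
  \<open>c3\<close>.\<close>

definition b3 :: "generator free_star" where
  "b3 = scalar (1 / s) * (a2 - image_a2 a1 b2 0)"

definition backward :: "3 \<Rightarrow> generator free_star" where
  "backward i = (if i = 1 then a1 else if i = 2 then b2 else b3)"

lemma image_a2_0: "image_a2 c1 c2 c3 = scalar s * c3 + image_a2 c1 c2 0"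
  by (simp add: image_a2_def)

lemma scalar_inverse: "c \<noteq> 0 \<Longrightarrow> scalar c * (scalar (1 / c) * p) = p" "c \<noteq> 0 \<Longrightarrow> scalar (1 / c) * (scalar c * p) = p"
  by (simp_all add: scalar_scalar scalar_simps(1))

lemma image_A_b2: "image_A a1 b2 = AA"
  by (simp add: image_A_def b2_def scalar_inverse)

lemma image_a2_b3: "image_a2 a1 b2 b3 = a2"
  by (subst image_a2_0) (simp add: b3_def scalar_inverse)

lemma free_hom_image: "free_hom h (image_A c1 c2) = image_A (free_hom h c1) (free_hom h c2)"
  "free_hom h (image_a2 c1 c2 c3) = image_a2 (free_hom h c1) (free_hom h c2) (free_hom h c3)"
  by (simp_all add: image_A_def image_a2_def free_hom_add free_hom_diff free_hom_mult free_hom_adj free_hom_power)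

lemma backward_forward: "free_hom backward (forward g) = gen g"
  by (cases g) (simp_all add: forward_def free_hom_image backward_def image_A_b2 image_a2_b3)

lemma forward_b2: "free_hom forward b2 = gen 2"
  by (simp add: b2_def free_hom_mult free_hom_diff forward_def image_A_def scalar_inverse)

lemma forward_backward: "free_hom forward (backward i) = gen i"
proof -
  have "free_hom forward b3 = gen 3"
    by (simp add: b3_def free_hom_mult free_hom_diff free_hom_image forward_b2)
      (simp add: forward_def image_a2_0[of "gen 1" "gen 2" "gen 3"] scalar_inverse)
  moreover have "i = 1 \<or> i = 2 \<or> i = 3" by (rule exhaust_3)
  ultimately show ?thesis by (auto simp: backward_def forward_b2) (simp add: forward_def)
qed

text \<open>Once the quadratic terms form \<open>A * A / (2 * x1)\<close>, brackets with
  \<open>a2\<close> follow from the Leibniz rule, because \<open>A\<close> has scalar brackets with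
  the CCR generators and their adjoints.\<close>

lemma image_a2_square:
  assumes "bracket_mod S (adj c1) c2 0"
  defines "A \<equiv> image_A c1 c2"
  shows "image_a2 c1 c2 c3 - (scalar s * c3 - scalar (x2 / r) * adj c2 + scalar (1 / (2 * x1)) * (A * A)) \<in> star_ideal S"
  using complete_square[OF x1 assms(1)] unfolding A_def image_A_def image_a2_def r_def[symmetric]
  by (simp add: algebra_simps)

lemmas bracket_linear = bracket_add bracket_diff bracket_scale bracket_mult

section \<open>Relations are respected in both directions\<close>

lemma ccr_brackets:
  "bracket_mod ccr_relations (adj (gen i)) (gen i) 1"
  "i \<noteq> j \<Longrightarrow> bracket_mod ccr_relations (adj (gen i)) (gen j) 0"
  "bracket_mod ccr_relations (gen i) (gen j) 0"
  "bracket_mod ccr_relations (adj (gen i)) (adj (gen j)) 0"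
proof -
  show "bracket_mod ccr_relations (adj (gen i)) (gen i) 1"
    unfolding bracket_mod_def by (rule star_idealI) (auto simp: ccr_relations_def)
  show "i \<noteq> j \<Longrightarrow> bracket_mod ccr_relations (adj (gen i)) (gen j) 0"
    unfolding bracket_zero_iff by (rule star_idealI) (auto simp: ccr_relations_def)
  show c: "bracket_mod ccr_relations (gen i) (gen j) 0" for i j
  proof (cases "i = j")
    case False
    then show ?thesis unfolding bracket_zero_iff by (intro star_idealI) (auto simp: ccr_relations_def)
  qed (simp add: bracket_self)
  show "bracket_mod ccr_relations (adj (gen i)) (adj (gen j)) 0"
    using bracket_adj[OF c[of j i]] by simp
qed

lemma forward_relations:
  assumes "q \<in> A_relations x1 x2"
  shows "free_hom forward q \<in> star_ideal ccr_relations"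
proof -
  let ?B = "bracket_mod ccr_relations"
  define c1 c2 c3 where "c1 = (gen 1 :: 3 free_star)" and "c2 = (gen 2 :: 3 free_star)" and "c3 = (gen 3 :: 3 free_star)"
  have d: "(1::3) \<noteq> 2" "(1::3) \<noteq> 3" "(2::3) \<noteq> 3" by simp_all
  note cc = ccr_brackets(1)[of 1, folded c1_def] ccr_brackets(1)[of 2, folded c2_def]
    ccr_brackets(1)[of 3, folded c3_def]
    ccr_brackets(2)[OF d(1), folded c1_def c2_def] ccr_brackets(2)[OF d(2), folded c1_def c3_def]
    ccr_brackets(2)[OF d(3), folded c2_def c3_def]
    ccr_brackets(2)[OF d(1)[symmetric], folded c1_def c2_def] ccr_brackets(2)[OF d(2)[symmetric], folded c1_def c3_def]
    ccr_brackets(2)[OF d(3)[symmetric], folded c2_def c3_def]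
  note ca = ccr_brackets(3)[of 1 2, folded c1_def c2_def] ccr_brackets(3)[of 1 3, folded c1_def c3_def]
    ccr_brackets(3)[of 2 3, folded c2_def c3_def]
  note cb = ccr_brackets(4)[of 1 2, folded c1_def c2_def] ccr_brackets(4)[of 1 3, folded c1_def c3_def]
    ccr_brackets(4)[of 2 3, folded c2_def c3_def]
  define A where "A = image_A c1 c2"
  have A: "A = scalar r * c2 + scalar x1 * adj c1" by (simp add: A_def image_A_def)
  have adjA: "adj A = scalar r * adj c2 + scalar (cnj x1) * c1" by (simp add: A adj_add adj_scalar_mult)
  have Ac1: "?B A c1 (scalar x1)" unfolding A
    by (rule bracket_eq[OF bracket_add[OF bracket_scale[OF bracket_sym[OF ca(1)]] bracket_scale[OF cc(1)]]]) simp
  have Ac1': "?B A (adj c1) 0" unfolding A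
    by (rule bracket_eq[OF bracket_add[OF bracket_scale[OF bracket_sym[OF cc(4)]] bracket_scale[OF bracket_self]]]) simp
  have Ac2: "?B A c2 0" unfolding A
    by (rule bracket_eq[OF bracket_add[OF bracket_scale[OF bracket_self] bracket_scale[OF cc(4)]]]) simp
  have Ac2': "?B A (adj c2) (- scalar r)" unfolding A
    by (rule bracket_eq[OF bracket_add[OF bracket_scale[OF bracket_sym[OF cc(2)]] bracket_scale[OF cb(1)]]]) simp
  have Ac3: "?B A c3 0" unfolding A
    by (rule bracket_eq[OF bracket_add[OF bracket_scale[OF ca(3)] bracket_scale[OF cc(5)]]]) simp
  have Ac3': "?B A (adj c3) 0" unfolding A
    by (rule bracket_eq[OF bracket_add[OF bracket_scale[OF bracket_sym[OF cc(9)]] bracket_scale[OF cb(2)]]]) simp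
  \<comment> \<open>\<open>A\<close> is normal: the modes 2 and 1 contribute \<open>r * r\<close>
    and \<open>- x1 * cnj x1\<close>, which cancel.\<close>
  have AA': "?B (adj A) A 0"
    unfolding adjA
    by (rule bracket_eq[OF bracket_add[OF bracket_scale[OF bracket_sym[OF Ac2']] bracket_scale[OF bracket_sym[OF Ac1]]]])
      (simp add: scalar_scalar rr mult.commute)
  define a where "a = image_a2 c1 c2 c3"
  define a' where "a' = scalar s * c3 - scalar (x2 / r) * adj c2 + scalar (1 / (2 * x1)) * (A * A)"
  have aa': "a' - a \<in> star_ideal ccr_relations"
    using star_ideal_closed(3)[OF image_a2_square[OF cc(4), of c3]] by (simp add: a_def a'_def A_def)
  have into_a: "?B a q t" if "?B a' q t" for q t using bracket_cong[OF that aa'] .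
  have halves: "scalar (1 / (2 * x1)) * (scalar x1 * A + A * scalar x1) = A"
    by (simp add: scalar_commute distrib_left scalar_scalar distrib_right[symmetric] scalar_simps(2)[symmetric])
      (simp add: scalar_simps(1))
  \<comment> \<open>This becomes the relation defining \<open>A\<close> as a commutator: the linear
    part of \<open>a2\<close> commutes with \<open>c1\<close>, and the square contributes
    \<open>(x1 * A + A * x1) / (2 * x1) = A\<close>.\<close>
  have ac1: "?B a c1 A"
    by (rule into_a, unfold a'_def, rule bracket_eq[OF bracket_add[OF bracket_diff[OF bracket_scale[OF bracket_sym[OF ca(2)]]
          bracket_scale[OF cc(7)]] bracket_scale[OF bracket_mult[OF Ac1 Ac1]]]])
      (simp add: halves)
  have aA: "?B a A (- scalar x2)"
    by (rule into_a, unfold a'_def, rule bracket_eq[OF bracket_add[OF bracket_diff[OF bracket_scale[OF bracket_sym[OF Ac3]]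
          bracket_scale[OF bracket_sym[OF Ac2']]] bracket_scale[OF bracket_mult[OF bracket_self bracket_self]]]])
      (simp add: scalar_scalar)
  have ac1': "?B a (adj c1) 0"
    by (rule into_a, unfold a'_def, rule bracket_eq[OF bracket_add[OF bracket_diff[OF bracket_scale[OF bracket_sym[OF cc(5)]]
          bracket_scale[OF bracket_sym[OF cb(1)]]] bracket_scale[OF bracket_mult[OF Ac1' Ac1']]]])
      simp
  have aA': "?B a (adj A) 0"
    unfolding adjA
  proof (rule into_a, unfold a'_def adjA[symmetric], rule bracket_eq[OF bracket_add[OF bracket_diff[OF bracket_scale bracket_scale]
        bracket_scale[OF bracket_mult[OF bracket_sym[OF AA'] bracket_sym[OF AA']]]]])
    show "?B c3 (adj A) 0" using bracket_adj[OF Ac3'] by simp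
    show "?B (adj c2) (adj A) 0" using bracket_adj[OF Ac2] by simp
  qed simp
  have ac3': "?B a (adj c3) (- scalar s)"
    by (rule into_a, unfold a'_def, rule bracket_eq[OF bracket_add[OF bracket_diff[OF bracket_scale[OF bracket_sym[OF cc(3)]]
          bracket_scale[OF cb(3)]] bracket_scale[OF bracket_mult[OF Ac3' Ac3']]]])
      simp
  have ac2: "?B a c2 (- scalar (x2 / r))"
    by (rule into_a, unfold a'_def, rule bracket_eq[OF bracket_add[OF bracket_diff[OF bracket_scale[OF bracket_sym[OF ca(3)]]
          bracket_scale[OF cc(2)]] bracket_scale[OF bracket_mult[OF Ac2 Ac2]]]])
      simp
  have adja': "adj a' = scalar s * adj c3 - scalar (cnj x2 / r) * c2 + scalar (1 / (2 * cnj x1)) * (adj A * adj A)"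
    by (simp add: a'_def adj_add adj_diff adj_scalar_mult adj_mult[of A A])
  \<comment> \<open>The square of \<open>adj A\<close> drops out because \<open>a\<close> commutes
    with \<open>adj A\<close>; the brackets with \<open>adj c3\<close> and \<open>c2\<close> leave
    \<open>s * s - cnj x2 * x2 / (r * r)\<close>.\<close>
  have "?B (adj a') a 1"
    unfolding adja'
  proof (rule bracket_eq[OF bracket_add[OF bracket_diff[OF bracket_scale[OF bracket_sym[OF ac3']]
          bracket_scale[OF bracket_sym[OF ac2]]] bracket_scale[OF bracket_mult[OF bracket_sym[OF aA'] bracket_sym[OF aA']]]]])
    have "scalar s * scalar s - scalar (cnj x2 / r) * scalar (x2 / r) = (1 :: 3 free_star)"
      by (simp add: scalar_scalar ss scalar_simps(1,2) mult.commute)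
    then show "scalar s * - (- scalar s) - scalar (cnj x2 / r) * - (- scalar (x2 / r)) +
        scalar (1 / (2 * cnj x1)) * (- 0 * adj A + adj A * - 0) = (1 :: 3 free_star)" by simp
  qed
  then have aa: "?B (adj a) a 1"
    using bracket_cong adj_star_ideal[OF aa'] by (metis adj_diff)
  have f: "free_hom forward (gen Ga1) = c1" "free_hom forward (gen Ga2) = a" "free_hom forward (gen GA) = A"
    by (simp_all add: forward_def c1_def c2_def c3_def a_def A_def)
  have fa: "free_hom forward (adj p) = adj (free_hom forward p)" for p by (rule free_hom_adj)
  have Aa: "?B A a (scalar x2)" using bracket_sym[OF aA] by simp
  have c1a: "?B (adj c1) a 0" using bracket_sym[OF ac1'] by simp
  have c1A: "?B (adj c1) A 0" using bracket_sym[OF Ac1'] by simp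
  have aA2: "?B (adj a) A 0" using bracket_adj[OF bracket_sym[OF aA']] by simp
  have comm: "A - (a * c1 - c1 * a) \<in> star_ideal ccr_relations"
    using star_ideal_closed(3)[OF ac1[unfolded bracket_mod_def]] by (simp add: algebra_simps)
  show ?thesis
    using assms cc(1) aa c1a Aa Ac1 c1A aA2 comm
    by (auto simp: A_relations_def Let_def free_hom_diff free_hom_mult fa f bracket_mod_def simp del: free_hom_gen)
qed

lemma backward_relations:
  assumes "q \<in> ccr_relations"
  shows "free_hom backward q \<in> star_ideal (A_relations x1 x2)"
proof -
  let ?B = "bracket_mod (A_relations x1 x2)"
  have rel: "p \<in> A_relations x1 x2 \<Longrightarrow> p \<in> star_ideal (A_relations x1 x2)" for p by (rule star_idealI)
  have a1a1: "?B (adj a1) a1 1" and a2a2: "?B (adj a2) a2 1" and Aa1: "?B AA a1 (scalar x1)"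
    and Aa2: "?B AA a2 (scalar x2)"
    unfolding bracket_mod_def by (rule rel, simp add: A_relations_def Let_def)+
  have a1a2: "?B (adj a1) a2 0" and a1A: "?B (adj a1) AA 0" and a2A: "?B (adj a2) AA 0"
    unfolding bracket_zero_iff by (rule rel, simp add: A_relations_def Let_def)+
  have A: "AA - (a2 * a1 - a1 * a2) \<in> star_ideal (A_relations x1 x2)"
    by (rule rel) (simp add: A_relations_def Let_def)
  have Aa2': "?B (adj AA) a2 0" using bracket_adj[OF a2A] by simp
  have Aa1': "?B (adj AA) a1 0" using bracket_adj[OF a1A] by simp
  \<comment> \<open>Normality of \<open>A\<close> is not among the relations. It follows because
    \<open>adj AA\<close> commutes with \<open>a1\<close> and \<open>a2\<close>, hence with their
    commutator, which is congruent to \<open>AA\<close>.\<close>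
  have AA': "?B AA (adj AA) 0"
  proof (rule bracket_cong)
    show "?B (a2 * a1 - a1 * a2) (adj AA) 0"
      using bracket_diff[OF bracket_mult[OF bracket_sym[OF Aa2'] bracket_sym[OF Aa1']]
          bracket_mult[OF bracket_sym[OF Aa1'] bracket_sym[OF Aa2']]] by simp
    show "a2 * a1 - a1 * a2 - AA \<in> star_ideal (A_relations x1 x2)"
      using star_ideal_closed(3)[OF A] by simp
  qed
  have a2a1: "?B a2 a1 AA" using star_ideal_closed(3)[OF A] by (simp add: bracket_mod_def)
  have A'a1': "?B (adj AA) (adj a1) (- scalar (cnj x1))"
    using bracket_adj[OF bracket_sym[OF Aa1]] by (simp add: adj_minus)
  have adjb2: "adj b2 = scalar (1 / r) * (adj AA - scalar (cnj x1) * a1)"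
    by (simp add: b2_def adj_scalar_mult adj_diff)
  have b2a1: "?B b2 a1 0" unfolding b2_def
    by (rule bracket_eq[OF bracket_scale[OF bracket_diff[OF Aa1 bracket_scale[OF a1a1]]]]) simp
  have b2a1': "?B b2 (adj a1) 0" unfolding b2_def
    by (rule bracket_eq[OF bracket_scale[OF bracket_diff[OF bracket_sym[OF a1A] bracket_scale[OF bracket_self]]]]) simp
  have b2A: "?B b2 AA 0" unfolding b2_def
    by (rule bracket_eq[OF bracket_scale[OF bracket_diff[OF bracket_self bracket_scale[OF a1A]]]]) simp
  have b2A': "?B b2 (adj AA) (- scalar r)" unfolding b2_def
    by (rule bracket_eq[OF bracket_scale[OF bracket_diff[OF AA' bracket_scale[OF bracket_sym[OF A'a1']]]]])
      (simp add: scalar_scalar rr[symmetric] scalar_minus)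
  have b2'A: "?B (adj b2) AA (scalar r)"
    using bracket_adj[OF bracket_sym[OF b2A']] by simp
  have b2b2: "?B (adj b2) b2 1" unfolding adjb2
    by (rule bracket_eq[OF bracket_scale[OF bracket_diff[OF bracket_sym[OF b2A'] bracket_scale[OF bracket_sym[OF b2a1]]]]])
      (simp add: scalar_scalar scalar_simps(1))
  have a2b2: "?B b2 a2 (scalar (x2 / r))" unfolding b2_def
    by (rule bracket_eq[OF bracket_scale[OF bracket_diff[OF Aa2 bracket_scale[OF a1a2]]]]) (simp add: scalar_scalar)
  have b2'a2: "?B (adj b2) a2 (scalar (cnj x1 / r) * AA)" unfolding adjb2
    by (rule bracket_eq[OF bracket_scale[OF bracket_diff[OF Aa2' bracket_scale[OF bracket_sym[OF a2a1]]]]])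
      (simp add: scalar_scalar)
  have a1b2': "?B (adj a1) (adj b2) 0" using bracket_adj[OF b2a1] by simp
  have b2'a1: "?B (adj b2) a1 0" using bracket_adj[OF bracket_sym[OF b2a1']] by simp
  \<comment> \<open>The congruent form of \<open>b3\<close> in which the completed square replaces
    the quadratic terms in \<open>b2\<close> and \<open>adj a1\<close>.\<close>
  define b3' where "b3' = scalar (1 / s) * (a2 + scalar (x2 / r) * adj b2 - scalar (1 / (2 * x1)) * (AA * AA))"
  have b3: "b3' - b3 \<in> star_ideal (A_relations x1 x2)"
  proof -
    have "?B (adj a1) b2 0" using bracket_sym[OF b2a1'] by simp
    from image_a2_square[OF this, of 0]
    have "image_a2 a1 b2 0 - (- scalar (x2 / r) * adj b2 + scalar (1 / (2 * x1)) * (AA * AA))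
        \<in> star_ideal (A_relations x1 x2)" by (simp add: image_A_b2)
    from star_ideal_closed(4)[OF this, of "scalar (1 / s)"] show ?thesis
      by (simp add: b3'_def b3_def right_diff_distrib distrib_left algebra_simps)
  qed
  have into: "?B b3 q t" if "?B b3' q t" for q t using bracket_cong[OF that b3] .
  have halves: "scalar (1 / (2 * x1)) * (scalar x1 * AA + AA * scalar x1) = AA"
    by (simp add: scalar_commute distrib_left scalar_scalar distrib_right[symmetric] scalar_simps(2)[symmetric])
      (simp add: scalar_simps(1))
  \<comment> \<open>Here \<open>r / x1 = cnj x1 / r\<close>; this is why the square of
    \<open>AA\<close> cancels the bracket of \<open>adj b2\<close> with \<open>a2\<close>.\<close>
  have halves2: "scalar (1 / (2 * x1)) * (scalar r * AA + AA * scalar r) = scalar (cnj x1 / r) * AA"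
  proof -
    have "1 / (2 * x1) * r + 1 / (2 * x1) * r = cnj x1 / r" using rr by (simp add: field_simps)
    then show ?thesis
      by (simp only: scalar_commute distrib_left scalar_scalar distrib_right[symmetric] scalar_simps(2)[symmetric])
  qed
  have b3a1: "?B b3 a1 0"
    by (rule into, unfold b3'_def, rule bracket_eq[OF bracket_scale[OF bracket_diff[OF bracket_add[OF a2a1
          bracket_scale[OF b2'a1]] bracket_scale[OF bracket_mult[OF Aa1 Aa1]]]]]) (simp add: halves)
  have b3a1': "?B b3 (adj a1) 0"
    by (rule into, unfold b3'_def, rule bracket_eq[OF bracket_scale[OF bracket_diff[OF bracket_add[OF bracket_sym[OF a1a2]
          bracket_scale[OF bracket_sym[OF a1b2']]] bracket_scale[OF bracket_mult[OF bracket_sym[OF a1A] bracket_sym[OF a1A]]]]]])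
      simp
  have b3b2: "?B b3 b2 0"
    by (rule into, unfold b3'_def, rule bracket_eq[OF bracket_scale[OF bracket_diff[OF bracket_add[OF bracket_sym[OF a2b2]
          bracket_scale[OF b2b2]] bracket_scale[OF bracket_mult[OF bracket_sym[OF b2A] bracket_sym[OF b2A]]]]]])
      simp
  have b3b2': "?B b3 (adj b2) 0"
  proof (rule into, unfold b3'_def, rule bracket_eq[OF bracket_scale[OF bracket_diff[OF bracket_add[OF bracket_sym[OF b2'a2]
          bracket_scale[OF bracket_self]] bracket_scale[OF bracket_mult[OF bracket_sym[OF b2'A] bracket_sym[OF b2'A]]]]]])
    have "scalar (1 / (2 * x1)) * (- scalar r * AA + AA * - scalar r) = - (scalar (cnj x1 / r) * AA)"
      unfolding halves2[symmetric] by (simp add: algebra_simps)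
    then show "scalar (1 / s) * (- (scalar (cnj x1 / r) * AA) + scalar (x2 / r) * 0 -
        scalar (1 / (2 * x1)) * (- scalar r * AA + AA * - scalar r)) = 0" by simp
  qed
  have A_b2: "AA = scalar r * b2 + scalar x1 * adj a1"
    using image_A_b2 by (simp add: image_A_def)
  \<comment> \<open>\<open>adj AA\<close> is a combination of \<open>adj b2\<close> and
    \<open>a1\<close>, both already known to commute with \<open>b3\<close>.\<close>
  have b3A': "?B b3 (adj AA) 0"
  proof -
    have "?B (adj AA) b3 0"
      unfolding A_b2 adj_add adj_scalar_mult adj_adj
      by (rule bracket_eq[OF bracket_add[OF bracket_scale[OF bracket_sym[OF b3b2']] bracket_scale[OF bracket_sym[OF b3a1]]]]) simp
    from bracket_sym[OF this] show ?thesis by simp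
  qed
  \<comment> \<open>Only \<open>adj a2\<close> and \<open>b2\<close> contribute, and
    \<open>1 + cnj x2 * x2 / (r * r) = s * s\<close> turns the prefactor \<open>1 / s\<close> into
    the value \<open>s\<close>. Passing from \<open>a2\<close> to \<open>b3\<close> later divides by
    \<open>s\<close> once more and gives the canonical relation.\<close>
  have b3'a2: "?B (adj b3') a2 (scalar s)"
  proof -
    have adjb3': "adj b3' = scalar (1 / s) * (adj a2 + scalar (cnj x2 / r) * b2 - scalar (1 / (2 * cnj x1)) * (adj AA * adj AA))"
      by (simp add: b3'_def adj_add adj_diff adj_scalar_mult adj_mult[of AA AA])
    have "scalar (1 / s) * (1 + scalar (cnj x2 / r) * scalar (x2 / r)) = (scalar s :: generator free_star)"
    proof -
      have "1 + cnj x2 / r * (x2 / r) = s * s" by (simp add: ss mult.commute)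
      then show ?thesis by (simp only: scalar_scalar scalar_simps(1,2)[symmetric]) (simp add: scalar_scalar)
    qed
    then show ?thesis unfolding adjb3'
      by - (rule bracket_eq[OF bracket_scale[OF bracket_diff[OF bracket_add[OF a2a2
          bracket_scale[OF a2b2]] bracket_scale[OF bracket_mult[OF Aa2' Aa2']]]]], simp)
  qed
  have "adj b3' - adj b3 \<in> star_ideal (A_relations x1 x2)"
    using adj_star_ideal[OF b3] by (simp add: adj_diff)
  from bracket_cong[OF b3'a2 this] have b3a2: "?B a2 (adj b3) (- scalar s)" by (rule bracket_sym)
  have b3b3: "?B b3 (adj b3) (- 1)"
  proof (rule into, unfold b3'_def, rule bracket_eq[OF bracket_scale[OF bracket_diff[OF bracket_add[OF b3a2
          bracket_scale] bracket_scale[OF bracket_mult]]]])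
    show "?B (adj b2) (adj b3) 0" using bracket_adj[OF b3b2] by simp
    show "?B AA (adj b3) 0" using bracket_adj[OF b3A'] by simp
    then show "?B AA (adj b3) 0" .
  qed (simp add: scalar_scalar scalar_simps(1))
  have bw: "backward 1 = a1" "backward 2 = b2" "backward 3 = b3" by (simp_all add: backward_def)
  have com: "?B (backward i) (backward j) 0" for i j
    using bracket_self[of _ "backward i"] bracket_sym[OF b2a1] b2a1 b3a1 bracket_sym[OF b3a1] b3b2 bracket_sym[OF b3b2]
      exhaust_3[of i] exhaust_3[of j] by (auto simp: bw)
  have can: "?B (adj (backward i)) (backward i) 1" for i
    using a1a1 b2b2 bracket_sym[OF b3b3] exhaust_3[of i] by (auto simp: bw)
  have adj0: "?B (adj q) p 0" if "?B p (adj q) 0" for p q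
    using bracket_sym[OF that] by simp
  have adj0': "?B (adj p) q 0" if "?B p (adj q) 0" for p q
    using bracket_sym[OF bracket_adj[OF that]] bracket_adj[OF bracket_sym[OF that]] by simp
  have com': "?B (adj (backward i)) (backward j) 0" if "i \<noteq> j" for i j
    using that adj0[OF b2a1'] adj0[OF b3a1'] adj0[OF b3b2'] adj0'[OF b2a1'] adj0'[OF b3a1'] adj0'[OF b3b2']
      exhaust_3[of i] exhaust_3[of j] by (auto simp: bw)
  show ?thesis
    using assms com com' can
    by (auto simp: ccr_relations_def free_hom_diff free_hom_mult bracket_mod_def)
qed

definition phi :: "generator free_star set \<Rightarrow> 3 free_star set" where
  "phi = presented_map (A_relations x1 x2) ccr_relations forward"

lemma phi_cls: "phi (cls (A_relations x1 x2) p) = cls ccr_relations (free_hom forward p)"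
  unfolding phi_def by (rule presented_map_cls) (rule forward_relations)

lemma canonical_iso_phi: "canonical_iso x1 x2 phi"
proof -
  have "star_iso (A_algebra x1 x2) ccr_algebra phi"
    unfolding phi_def A_algebra_def ccr_algebra_def
    by (rule star_iso_presented[where k = backward])
      (simp_all add: forward_relations backward_relations backward_forward forward_backward)
  then show ?thesis
    unfolding canonical_iso_def Let_def A_elem_def phi_cls
    by (simp add: forward_def image_A_def image_a2_def r_def s_def)
qed

end

text \<open>A *-isomorphism is determined by its values on the generators, so every admissible
  isomorphism agrees with \<open>phi\<close> on classes. This removes the existential choice in
  \<open>well_behaved\<close>.\<close>

lemma canonical_iso_cls:
  assumes x1: "x1 \<noteq> 0" and \<phi>: "canonical_iso x1 x2 \<phi>"
  shows "\<phi> (cls (A_relations x1 x2) p) = cls ccr_relations (free_hom (iso_parameters.forward x1 x2) p)"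
proof -
  interpret iso_parameters x1 x2 by standard (rule x1)
  have iso: "star_iso (presented (A_relations x1 x2)) (presented ccr_relations) \<phi>"
    using \<phi> by (simp add: canonical_iso_def A_algebra_def ccr_algebra_def)
  then have hom: "\<phi> \<in> ring_hom (presented (A_relations x1 x2)) (presented ccr_relations)"
    by (simp add: star_iso_def ring_iso_def)
  have on_gen: "\<phi> (cls (A_relations x1 x2) (gen g)) = cls ccr_relations (forward g)" for g
  proof -
    note * = \<phi>[unfolded canonical_iso_def Let_def A_elem_def, THEN conjunct2]
    show ?thesis
      using *[THEN conjunct1] *[THEN conjunct2, THEN conjunct1] *[THEN conjunct2, THEN conjunct2]
      unfolding forward_def image_A_def image_a2_def r_def s_def by (cases g) simp_all
  qed
  have c: "cls (A_relations x1 x2) p \<in> carrier (presented (A_relations x1 x2))" for p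
    by (simp add: presented_simps)
  show ?thesis
  proof (induction p rule: free_star_induct)
    case (scalar c)
    have one: "\<phi> (cls (A_relations x1 x2) 1) = cls ccr_relations 1"
      using ring_hom_one[OF hom] by (simp add: presented_simps)
    have "\<phi> (c \<odot>\<^bsub>presented (A_relations x1 x2)\<^esub> cls (A_relations x1 x2) 1)
        = c \<odot>\<^bsub>presented ccr_relations\<^esub> \<phi> (cls (A_relations x1 x2) 1)"
      using iso c by (simp add: star_iso_def)
    then show ?case by (simp add: presented_simps one)
  next
    case (gen g)
    then show ?case by (simp add: on_gen)
  next
    case (adj_gen g)
    have "\<phi> (star (presented (A_relations x1 x2)) (cls (A_relations x1 x2) (gen g)))
        = star (presented ccr_relations) (\<phi> (cls (A_relations x1 x2) (gen g)))"
      using iso c by (simp add: star_iso_def)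
    then show ?case by (simp add: presented_simps on_gen)
  next
    case (add p q)
    then show ?case using ring_hom_add[OF hom c[of p] c[of q]] by (simp add: presented_simps free_hom_add)
  next
    case (mult p q)
    then show ?case using ring_hom_mult[OF hom c[of p] c[of q]] by (simp add: presented_simps free_hom_mult)
  qed
qed

section \<open>Ladder operators on rapidly decreasing families\<close>

type_synonym idx = "nat \<times> nat \<times> nat"

text \<open>The tensor factors are numbered by the type \<open>3\<close>, so that one statement
  about mode \<open>l\<close> replaces three statements about components of a triple.\<close>

definition occ :: "3 \<Rightarrow> idx \<Rightarrow> nat" where
  "occ l = (\<lambda>(i, j, k). if l = 1 then i else if l = 2 then j else k)"

definition up :: "3 \<Rightarrow> idx \<Rightarrow> idx" where
  "up l = (\<lambda>(i, j, k). if l = 1 then (Suc i, j, k) else if l = 2 then (i, Suc j, k) else (i, j, Suc k))"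

definition down :: "3 \<Rightarrow> idx \<Rightarrow> idx" where
  "down l = (\<lambda>(i, j, k). if l = 1 then (i - 1, j, k) else if l = 2 then (i, j - 1, k) else (i, j, k - 1))"

definition degree :: "idx \<Rightarrow> nat" where
  "degree n = occ 1 n + occ 2 n + occ 3 n"

lemma idx_eqI:
  assumes "\<And>l. occ l m = occ l n"
  shows "m = n"
  using assms[of 1] assms[of 2] assms[of 3] by (cases m; cases n) (simp add: occ_def)

lemma occ_up: "occ m (up l n) = occ m n + (if m = l then 1 else 0)"
  using exhaust_3[of l] exhaust_3[of m] by (cases n) (auto simp: occ_def up_def)

lemma occ_down: "occ m (down l n) = occ m n - (if m = l then 1 else 0)"
  using exhaust_3[of l] exhaust_3[of m] by (cases n) (auto simp: occ_def down_def)

lemma down_up [simp]: "down l (up l n) = n"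
  by (rule idx_eqI) (simp add: occ_up occ_down)

lemma up_down: "occ l n \<noteq> 0 \<Longrightarrow> up l (down l n) = n"
  by (rule idx_eqI) (auto simp: occ_up occ_down)

lemma up_down_commute: "l \<noteq> m \<Longrightarrow> up l (down m n) = down m (up l n)"
  by (rule idx_eqI) (auto simp: occ_up occ_down)

lemma down_commute: "down l (down m n) = down m (down l n)"
  by (rule idx_eqI) (auto simp: occ_down)

lemma occ_le_degree: "occ l n \<le> degree n"
  using exhaust_3[of l] by (auto simp: degree_def)

lemma degree_up: "degree (up l n) = Suc (degree n)"
  using exhaust_3[of l] by (auto simp: degree_def occ_up)

text \<open>On coefficient functions creation reads the value at the lowered index. At
  \<open>occ l n = 0\<close> the truncated subtraction in \<open>down\<close> returns
  \<open>n\<close> itself, but the square root is then 0.\<close>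

definition cre :: "3 \<Rightarrow> (idx \<Rightarrow> complex) \<Rightarrow> idx \<Rightarrow> complex" where
  "cre l F n = complex_of_real (sqrt (real (occ l n))) * F (down l n)"

definition ann :: "3 \<Rightarrow> (idx \<Rightarrow> complex) \<Rightarrow> idx \<Rightarrow> complex" where
  "ann l F n = complex_of_real (sqrt (real (occ l n) + 1)) * F (up l n)"

text \<open>Stated for arbitrary coefficient functions, so that decay can be shown before membership
  in the Hilbert space, which \<open>rapid_square_summable\<close> supplies.\<close>

definition rapid :: "(idx \<Rightarrow> complex) \<Rightarrow> bool" where
  "rapid F \<longleftrightarrow> (\<forall>m. \<exists>B. \<forall>n. (1 + real (degree n)) ^ m * cmod (F n) \<le> B)"

lemma rapidly_decreasing_iff: "f \<in> rapidly_decreasing \<longleftrightarrow> rapid (coord f)"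
  by (simp add: rapidly_decreasing_def rapid_def degree_def occ_def split_paired_All add_ac)

lemma rapid_zero: "rapid (\<lambda>_. 0)"
  by (auto simp: rapid_def)

lemma rapid_add:
  assumes "rapid F" "rapid G"
  shows "rapid (\<lambda>n. F n + G n)"
  unfolding rapid_def
proof
  fix m
  obtain A B where A: "\<And>n. (1 + real (degree n)) ^ m * cmod (F n) \<le> A"
    and B: "\<And>n. (1 + real (degree n)) ^ m * cmod (G n) \<le> B"
    using assms unfolding rapid_def by blast
  have "(1 + real (degree n)) ^ m * cmod (F n + G n) \<le> A + B" for n
  proof -
    have "(1 + real (degree n)) ^ m * cmod (F n + G n) \<le> (1 + real (degree n)) ^ m * (cmod (F n) + cmod (G n))"
      by (intro mult_left_mono norm_triangle_ineq) simp
    then show ?thesis using A[of n] B[of n] by (simp add: distrib_left)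
  qed
  then show "\<exists>B. \<forall>n. (1 + real (degree n)) ^ m * cmod (F n + G n) \<le> B" by blast
qed

lemma rapid_scale:
  assumes "rapid F"
  shows "rapid (\<lambda>n. c * F n)"
  unfolding rapid_def
proof
  fix m
  obtain A where A: "\<And>n. (1 + real (degree n)) ^ m * cmod (F n) \<le> A"
    using assms unfolding rapid_def by blast
  have "(1 + real (degree n)) ^ m * cmod (c * F n) \<le> cmod c * A" for n
    using mult_left_mono[OF A[of n], of "cmod c"] by (simp add: norm_mult mult_ac)
  then show "\<exists>B. \<forall>n. (1 + real (degree n)) ^ m * cmod (c * F n) \<le> B" by blast
qed

lemma sqrt_le_self: "1 \<le> x \<Longrightarrow> sqrt x \<le> x"
  using mult_left_mono[of 1 x x] by (intro real_le_lsqrt) (simp_all add: power2_eq_square)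

text \<open>The square root factor costs at most one power of the weight, hence the use of the bound
  with exponent \<open>Suc m\<close>.\<close>

lemma rapid_ann:
  assumes "rapid F"
  shows "rapid (ann l F)"
  unfolding rapid_def
proof
  fix m
  obtain A where A: "\<And>n. (1 + real (degree n)) ^ Suc m * cmod (F n) \<le> A"
    using assms unfolding rapid_def by blast
  have "(1 + real (degree n)) ^ m * cmod (ann l F n) \<le> A" for n
  proof -
    let ?d = "1 + real (degree (up l n))"
    have "sqrt (real (occ l n) + 1) \<le> ?d"
      using sqrt_le_self[of "real (occ l n) + 1"] occ_le_degree[of l n] by (simp add: degree_up)
    moreover have "(1 + real (degree n)) ^ m \<le> ?d ^ m" by (intro power_mono) (simp_all add: degree_up)
    ultimately have "(1 + real (degree n)) ^ m * sqrt (real (occ l n) + 1) \<le> ?d ^ m * ?d"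
      by (intro mult_mono) simp_all
    then have "(1 + real (degree n)) ^ m * sqrt (real (occ l n) + 1) * cmod (F (up l n)) \<le> ?d ^ Suc m * cmod (F (up l n))"
      by (intro mult_right_mono) (simp_all add: mult.commute)
    then show ?thesis using A[of "up l n"] by (simp add: ann_def norm_mult mult.assoc)
  qed
  then show "\<exists>B. \<forall>n. (1 + real (degree n)) ^ m * cmod (ann l F n) \<le> B" by blast
qed

lemma rapid_cre:
  assumes "rapid F"
  shows "rapid (cre l F)"
  unfolding rapid_def
proof
  fix m
  obtain A where A: "\<And>n. (1 + real (degree n)) ^ Suc m * cmod (F n) \<le> A"
    using assms unfolding rapid_def by blast
  \<comment> \<open>The factor 2 arises because \<open>1 + degree n\<close> and the square root are
    both at most \<open>2 * (1 + degree k)\<close> for the lowered index \<open>k\<close>.\<close>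
  have "(1 + real (degree n)) ^ m * cmod (cre l F n) \<le> 2 ^ Suc m * A" for n
  proof (cases "occ l n = 0")
    case True
    have "0 \<le> A" using A[of n] by (rule order_trans[rotated]) simp
    then show ?thesis using True by (simp add: cre_def)
  next
    case False
    define k where "k = down l n"
    have n: "n = up l k" by (simp add: k_def up_down[OF False])
    have "sqrt (real (occ l n)) \<le> 2 * (1 + real (degree k))"
      using sqrt_le_self[of "real (occ l n)"] occ_le_degree[of l n] False by (simp add: n degree_up)
    moreover have "(1 + real (degree n)) ^ m \<le> (2 * (1 + real (degree k))) ^ m"
      by (intro power_mono) (simp_all add: n degree_up)
    ultimately have "(1 + real (degree n)) ^ m * sqrt (real (occ l n)) \<le> (2 * (1 + real (degree k))) ^ m * (2 * (1 + real (degree k)))"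
      by (intro mult_mono) simp_all
    then have "(1 + real (degree n)) ^ m * sqrt (real (occ l n)) * cmod (F k)
        \<le> (2 * (1 + real (degree k))) ^ Suc m * cmod (F k)"
      by (intro mult_right_mono) (simp_all only: power_Suc2 norm_ge_zero)
    also have "\<dots> \<le> 2 ^ Suc m * A"
      unfolding power_mult_distrib mult.assoc by (rule mult_left_mono[OF A]) simp
    finally show ?thesis by (simp add: cre_def norm_mult k_def[symmetric] mult.assoc)
  qed
  then show "\<exists>B. \<forall>n. (1 + real (degree n)) ^ m * cmod (cre l F n) \<le> B" by blast
qed

section \<open>Summation over products; rapid decay implies square summability\<close>

lemma summable_on_times:
  fixes f :: "'i \<Rightarrow> real" and g :: "'j \<Rightarrow> real"
  assumes "f summable_on UNIV" "g summable_on UNIV" "\<And>x. 0 \<le> f x" "\<And>y. 0 \<le> g y"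
  shows "(\<lambda>(x, y). f x * g y) summable_on UNIV"
proof -
  have "(\<lambda>(x, y). f x * g y) summable_on (SIGMA x:UNIV. UNIV)"
  proof (rule summable_on_SigmaI)
    show "((\<lambda>y. case (x, y) of (x, y) \<Rightarrow> f x * g y) has_sum f x * infsum g UNIV) UNIV" for x
      unfolding prod.case by (intro has_sum_cmult_right has_sum_infsum assms)
    show "(\<lambda>x. f x * infsum g UNIV) summable_on UNIV"
      by (intro summable_on_cmult_left assms)
  qed (use assms in auto)
  then show ?thesis by simp
qed

lemma has_sum_times:
  fixes f :: "'i \<Rightarrow> complex" and g :: "'j \<Rightarrow> complex"
  assumes f: "(f has_sum F) UNIV" "(\<lambda>x. cmod (f x)) summable_on UNIV"
    and g: "(g has_sum G) UNIV" "(\<lambda>y. cmod (g y)) summable_on UNIV"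
  shows "((\<lambda>(x, y). f x * g y) has_sum F * G) UNIV" "(\<lambda>p. cmod (case p of (x, y) \<Rightarrow> f x * g y)) summable_on UNIV"
proof -
  show abs: "(\<lambda>p. cmod (case p of (x, y) \<Rightarrow> f x * g y)) summable_on UNIV"
    using summable_on_times[OF f(2) g(2)] by (simp add: norm_mult case_prod_unfold)
  have "((\<lambda>(x, y). f x * g y) has_sum F * G) (SIGMA x:UNIV. UNIV)"
  proof (rule has_sum_SigmaI)
    show "((\<lambda>y. case (x, y) of (x, y) \<Rightarrow> f x * g y) has_sum f x * G) UNIV" for x
      unfolding prod.case by (rule has_sum_cmult_right[OF g(1)])
    show "((\<lambda>x. f x * G) has_sum F * G) UNIV" by (rule has_sum_cmult_left[OF f(1)])
    show "(\<lambda>(x, y). f x * g y) summable_on (SIGMA x:UNIV. UNIV)"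
      using abs_summable_summable[OF abs] by simp
  qed
  then show "((\<lambda>(x, y). f x * g y) has_sum F * G) UNIV" by simp
qed

lemma rapid_square_summable:
  assumes "rapid F"
  shows "(\<lambda>n. (cmod (F n))\<^sup>2) summable_on UNIV"
proof -
  \<comment> \<open>Exponent 3 because \<open>(1 + i) * (1 + j) * (1 + k)\<close> is at most the
    cube of the weight; after squaring, the majorant is a product of three convergent
    series.\<close>
  obtain B where B: "\<And>n. (1 + real (degree n)) ^ 3 * cmod (F n) \<le> B"
    using assms unfolding rapid_def by blast
  define q where "q = (\<lambda>i::nat. 1 / (1 + real i)\<^sup>2)"
  have "summable (\<lambda>i. inverse ((real (Suc i))\<^sup>2))"
    using inverse_power_summable[of 2, where ?'a = real] by (subst summable_Suc_iff) simp
  then have "summable (\<lambda>i. norm (q i))" by (simp add: q_def inverse_eq_divide)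
  then have q: "q summable_on UNIV" by (rule norm_summable_imp_summable_on)
  have q0: "0 \<le> q i" for i by (simp add: q_def)
  have "(\<lambda>(j, k). q j * q k) summable_on UNIV" by (rule summable_on_times[OF q q q0 q0])
  then have "(\<lambda>(i, p). q i * (case p of (j, k) \<Rightarrow> q j * q k)) summable_on UNIV"
    by (rule summable_on_times[OF q _ q0]) (auto simp: q0)
  then have "(\<lambda>n. B\<^sup>2 * (case n of (i, p) \<Rightarrow> q i * (case p of (j, k) \<Rightarrow> q j * q k))) summable_on UNIV"
    by (rule summable_on_cmult_right)
  then show ?thesis
  proof (rule summable_on_comparison_test)
    fix n :: idx
    obtain i j k where n: "n = (i, j, k)" by (cases n)
    let ?d = "1 + real (degree n)"
    have d: "real (degree n) = real i + real j + real k" by (simp add: n degree_def occ_def)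
    have "(1 + real i) * ((1 + real j) * (1 + real k)) \<le> ?d * (?d * ?d)"
      by (intro mult_mono) (simp_all add: d)
    then have "((1 + real i) * ((1 + real j) * (1 + real k))) * cmod (F n) \<le> ?d ^ 3 * cmod (F n)"
      by (intro mult_right_mono) (simp_all add: power3_eq_cube mult.assoc)
    also have "\<dots> \<le> B" by (rule B)
    finally have "(((1 + real i) * ((1 + real j) * (1 + real k))) * cmod (F n))\<^sup>2 \<le> B\<^sup>2"
      by (intro power_mono) simp_all
    then have "(cmod (F n))\<^sup>2 \<le> B\<^sup>2 / ((1 + real i) * ((1 + real j) * (1 + real k)))\<^sup>2"
      by (simp add: power_mult_distrib pos_le_divide_eq mult.commute)
    then show "(cmod (F n))\<^sup>2 \<le> B\<^sup>2 * (case n of (i, p) \<Rightarrow> q i * (case p of (j, k) \<Rightarrow> q j * q k))"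
      by (simp add: n q_def power_mult_distrib mult_ac)
  qed simp
qed

lemma coord_Abs_rapid: "rapid F \<Longrightarrow> coord (Abs_ell2 F) = F"
  using rapid_square_summable by (simp add: Abs_ell2_inverse)

text \<open>The flag \<open>True\<close> selects annihilation because the generators act as creation
  operators: \<open>adj c * c - c * adj c = 1\<close> makes \<open>c\<close> the raising operator.
  Outside the rapidly decreasing vectors the argument of \<open>Abs_ell2\<close> may fail to be
  square summable.\<close>

definition ladder :: "3 \<times> bool \<Rightarrow> idx ell2 \<Rightarrow> idx ell2" where
  "ladder x f = Abs_ell2 ((if snd x then ann else cre) (fst x) (coord f))"

lemma coord_ladder:
  assumes "f \<in> rapidly_decreasing"
  shows "coord (ladder (l, True) f) = ann l (coord f)" "coord (ladder (l, False) f) = cre l (coord f)"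
  using assms by (simp_all add: ladder_def coord_Abs_rapid rapid_ann rapid_cre rapidly_decreasing_iff)

lemma ladder_rapid: "f \<in> rapidly_decreasing \<Longrightarrow> ladder x f \<in> rapidly_decreasing"
  by (cases x; cases "snd x") (auto simp: coord_ladder rapid_ann rapid_cre rapidly_decreasing_iff[of "ladder _ _"]
      rapidly_decreasing_iff[of f])

text \<open>The sum is reindexed along the injection \<open>up l\<close>; indices outside its range
  have occupation number 0 in mode \<open>l\<close>, where the created sequence vanishes.\<close>

lemma ladder_adjoint:
  assumes f: "f \<in> rapidly_decreasing" and g: "g \<in> rapidly_decreasing"
  shows "cinner (ladder (l, b) f) g = cinner f (ladder (l, \<not> b) g)"
proof -
  have main: "cinner (ladder (l, False) f) g = cinner f (ladder (l, True) g)"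
    if f: "f \<in> rapidly_decreasing" and g: "g \<in> rapidly_decreasing" for f g
  proof -
    let ?h = "\<lambda>n. cre l (coord f) n * cnj (coord g n)"
    have inj: "inj (up l)" by (rule inj_on_inverseI[of _ "down l"]) simp
    have "?h n = 0" if "n \<notin> range (up l)" for n
    proof -
      have "occ l n = 0"
      proof (rule ccontr)
        assume "occ l n \<noteq> 0"
        then have "n \<in> range (up l)" by (metis rangeI up_down)
        then show False using that by contradiction
      qed
      then show ?thesis by (simp add: cre_def)
    qed
    then have "infsum ?h UNIV = infsum ?h (range (up l))"
      by (intro infsum_cong_neutral) auto
    also have "\<dots> = infsum (?h \<circ> up l) UNIV" by (rule infsum_reindex[OF inj])
    also have "?h \<circ> up l = (\<lambda>n. coord f n * cnj (ann l (coord g) n))"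
      by (simp add: fun_eq_iff cre_def ann_def occ_up add.commute)
    finally show ?thesis using f g by (simp add: cinner_ell2_def coord_ladder)
  qed
  show ?thesis
  proof (cases b)
    case True
    then show ?thesis using main[OF g f] cinner_commute by (metis (full_types))
  qed (simp add: main[OF f g])
qed

section \<open>Coherent vectors\<close>

definition power_root_fact :: "complex \<Rightarrow> nat \<Rightarrow> complex" where
  "power_root_fact z n = z ^ n / complex_of_real (sqrt (fact n))"

text \<open>The unnormalised coherent vector, that is, the exponential of the creation operators
  weighted by \<open>w\<close>, applied to the vacuum. Without normalisation it is analytic in
  \<open>w\<close>.\<close>

definition coherent_seq :: "complex^3 \<Rightarrow> idx \<Rightarrow> complex" where
  "coherent_seq w = (\<lambda>(i, j, k). power_root_fact (w$1) i * (power_root_fact (w$2) j * power_root_fact (w$3) k))"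

definition coherent :: "complex^3 \<Rightarrow> idx ell2" where
  "coherent w = Abs_ell2 (coherent_seq w)"

definition hdot :: "complex^3 \<Rightarrow> complex^3 \<Rightarrow> complex" where
  "hdot w v = (\<Sum>l\<in>UNIV. w$l * cnj (v$l))"

lemma power_div_fact_le_exp:
  assumes "0 \<le> (x::real)"
  shows "x ^ n / fact n \<le> exp x"
proof -
  have s: "(\<lambda>n. x ^ n / fact n) sums exp x"
    using exp_converges[of x] by (simp add: divide_inverse mult.commute)
  have "(\<Sum>k\<in>{n}. x ^ k / fact k) \<le> suminf (\<lambda>k. x ^ k / fact k)"
    using s assms by (intro sum_le_suminf) (auto simp: sums_iff)
  then show ?thesis using s by (simp add: sums_iff)
qed

lemma coherent_factor_bound: "\<exists>B\<ge>0. \<forall>n. (1 + real n) ^ m * (cmod z ^ n / sqrt (fact n)) \<le> B"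
proof -
  \<comment> \<open>\<open>1 + n \<le> 2 ^ n\<close> absorbs the polynomial weight into the base;
    the square of the result is a term of the exponential series at \<open>x\<^sup>2\<close> and is
    bounded by its sum.\<close>
  define x where "x = 2 ^ m * cmod z"
  have "(1 + real n) ^ m * (cmod z ^ n / sqrt (fact n)) \<le> sqrt (exp (x\<^sup>2))" for n
  proof -
    have "1 + real n \<le> 2 ^ n" by (induction n) auto
    then have "(1 + real n) ^ m \<le> (2 ^ n) ^ m" by (intro power_mono) simp_all
    also have "(2 ^ n) ^ m = ((2 ^ m) ^ n :: real)" by (simp only: power_mult[symmetric] mult.commute)
    finally have "(1 + real n) ^ m * (cmod z ^ n / sqrt (fact n)) \<le> (2 ^ m) ^ n * (cmod z ^ n / sqrt (fact n))"
      by (intro mult_right_mono) simp_all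
    also have "\<dots> = sqrt ((x\<^sup>2) ^ n / fact n)"
    proof -
      have "0 \<le> x ^ n" by (simp add: x_def)
      moreover have "(x\<^sup>2) ^ n = (x ^ n)\<^sup>2" by (simp only: power_mult[symmetric] mult.commute)
      ultimately have "sqrt ((x\<^sup>2) ^ n / fact n) = x ^ n / sqrt (fact n)" by (simp add: real_sqrt_divide)
      then show ?thesis by (simp add: x_def power_mult_distrib)
    qed
    also have "\<dots> \<le> sqrt (exp (x\<^sup>2))"
      by (intro real_sqrt_le_mono power_div_fact_le_exp) simp
    finally show ?thesis .
  qed
  then show ?thesis by (intro exI[of _ "sqrt (exp (x\<^sup>2))"]) simp
qed

lemma rapid_coherent_seq: "rapid (coherent_seq w)"
  unfolding rapid_def
proof
  fix m
  obtain A where A: "\<And>l. 0 \<le> A l" "\<And>l n. (1 + real n) ^ m * (cmod (w$l) ^ n / sqrt (fact n)) \<le> A l"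
    using choice[of "\<lambda>l B. 0 \<le> B \<and> (\<forall>n. (1 + real n) ^ m * (cmod (w$l) ^ n / sqrt (fact n)) \<le> B)"]
      coherent_factor_bound[of m] by blast
  have "(1 + real (degree (i, j, k))) ^ m * cmod (coherent_seq w (i, j, k)) \<le> A 1 * (A 2 * A 3)" for i j k
  proof -
    have "1 + real (degree (i, j, k)) \<le> (1 + real i) * ((1 + real j) * (1 + real k))"
      by (simp add: degree_def occ_def algebra_simps)
    then have "(1 + real (degree (i, j, k))) ^ m \<le> ((1 + real i) * ((1 + real j) * (1 + real k))) ^ m"
      by (intro power_mono) simp_all
    then have "(1 + real (degree (i, j, k))) ^ m * cmod (coherent_seq w (i, j, k))
       \<le> ((1 + real i) * ((1 + real j) * (1 + real k))) ^ m * cmod (coherent_seq w (i, j, k))"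
      by (intro mult_right_mono) simp_all
    also have "\<dots> = ((1 + real i) ^ m * (cmod (w$1) ^ i / sqrt (fact i))) *
       (((1 + real j) ^ m * (cmod (w$2) ^ j / sqrt (fact j))) * ((1 + real k) ^ m * (cmod (w$3) ^ k / sqrt (fact k))))"
      by (simp add: coherent_seq_def power_root_fact_def norm_mult norm_divide norm_power power_mult_distrib mult_ac)
    also have "\<dots> \<le> A 1 * (A 2 * A 3)"
      by (intro mult_mono A mult_nonneg_nonneg) (simp_all add: A)
    finally show ?thesis .
  qed
  then show "\<exists>B. \<forall>n. (1 + real (degree n)) ^ m * cmod (coherent_seq w n) \<le> B"
    by (intro exI[of _ "A 1 * (A 2 * A 3)"]) auto
qed

lemma coord_coherent: "coord (coherent w) = coherent_seq w"
  by (simp add: coherent_def coord_Abs_rapid rapid_coherent_seq)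

lemma coherent_rapid: "coherent w \<in> rapidly_decreasing"
  by (simp add: rapidly_decreasing_iff coord_coherent rapid_coherent_seq)

lemma ann_coherent: "ladder (l, True) (coherent w) = (w$l) *\<^sub>C coherent w"
proof (rule ell2_eqI)
  fix n :: idx
  obtain i j k where n: "n = (i, j, k)" by (cases n)
  have s: "complex_of_real (sqrt (real i + 1)) * power_root_fact z (Suc i) = z * power_root_fact z i" for z i
  proof -
    have "sqrt (fact (Suc i)) = sqrt (real i + 1) * sqrt (fact i)"
      by (simp add: real_sqrt_mult add.commute)
    moreover have "sqrt (real i + 1) \<noteq> 0" by (simp add: add_nonneg_eq_0_iff)
    ultimately show ?thesis by (simp add: power_root_fact_def)
  qed
  have "ann l (coherent_seq w) n = w$l * coherent_seq w n"
    using exhaust_3[of l] s[of i "w$1"] s[of j "w$2"] s[of k "w$3"]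
    by (auto simp: n ann_def occ_def up_def coherent_seq_def mult.assoc[symmetric])
  then show "coord (ladder (l, True) (coherent w)) n = coord ((w$l) *\<^sub>C coherent w) n"
    by (simp add: coord_ladder[OF coherent_rapid] coord_coherent coord_scaleC)
qed

text \<open>The sum factors into three exponential series, one for each mode. This kernel carries
  the later computations with coherent vectors.\<close>

lemma cinner_coherent: "cinner (coherent w) (coherent v) = exp (hdot w v)"
proof -
  have e: "((\<lambda>n. x ^ n / fact n) has_sum exp x) UNIV" "(\<lambda>n. cmod (x ^ n / fact n)) summable_on UNIV" for x :: complex
  proof -
    have n: "summable (\<lambda>n. norm (x ^ n / fact n))"
      using summable_norm_exp[of x] by (simp add: norm_mult norm_divide norm_power norm_inverse divide_inverse mult.commute)
    moreover have "(\<lambda>n. x ^ n / fact n) sums exp x"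
      using exp_converges[of x] by (simp add: divide_inverse mult.commute scaleR_conv_of_real)
    ultimately show "((\<lambda>n. x ^ n / fact n) has_sum exp x) UNIV" by (rule norm_summable_imp_has_sum)
    show "(\<lambda>n. cmod (x ^ n / fact n)) summable_on UNIV"
      using n by (intro norm_summable_imp_summable_on) simp
  qed
  let ?z = "\<lambda>l. w$l * cnj (v$l)"
  note 23 = has_sum_times[OF e[of "?z 2"] e[of "?z 3"]]
  note 123 = has_sum_times[OF e[of "?z 1"] 23]
  have sq: "complex_of_real (sqrt (fact n)) * complex_of_real (sqrt (fact n)) = fact n" for n
    by (simp flip: of_real_mult)
  have t: "power_root_fact a n * cnj (power_root_fact b n) = (a * cnj b) ^ n / fact n" for a b n
    by (simp add: power_root_fact_def power_mult_distrib sq)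
  have "coherent_seq w n * cnj (coherent_seq v n) =
      (case n of (i, p) \<Rightarrow> ?z 1 ^ i / fact i * (case p of (j, k) \<Rightarrow> ?z 2 ^ j / fact j * (?z 3 ^ k / fact k)))" for n
    by (cases n) (simp only: coherent_seq_def prod.case t[symmetric] complex_cnj_mult mult_ac)
  then have "cinner (coherent w) (coherent v) = exp (?z 1) * (exp (?z 2) * exp (?z 3))"
    unfolding cinner_ell2_def coord_coherent using 123(1) by (simp add: infsumI)
  then show ?thesis by (simp add: hdot_def sum_3 exp_add mult.assoc)
qed

text \<open>Once the lower coefficients vanish, division by \<open>z ^ n\<close> leaves a series
  with constant term \<open>c n\<close> whose sum is 0 away from the origin; then \<open>z\<close>
  tends to 0.\<close>

lemma power_series_coeff_zero:
  fixes c :: "nat \<Rightarrow> complex"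
  assumes "\<And>z. (\<lambda>n. c n * z ^ n) sums 0"
  shows "c n = 0"
proof (induction n rule: less_induct)
  case (less n)
  have "(\<lambda>k. c (k + n) * z ^ k) sums 0" if "z \<noteq> 0" for z
  proof -
    have "(\<lambda>k. c (k + n) * z ^ (k + n)) sums (0 - (\<Sum>i<n. c i * z ^ i))"
      using sums_split_initial_segment[OF assms[of z], of n] by simp
    then have "(\<lambda>k. c (k + n) * z ^ (k + n)) sums 0" using less by simp
    from sums_mult[OF this, of "1 / z ^ n"] show ?thesis using that by (simp add: power_add)
  qed
  then have "((\<lambda>z. 0) \<longlongrightarrow> c (0 + n)) (at (0::complex))"
    by (intro powser_limit_0_strong[where s = 1 and a = "\<lambda>k. c (k + n)"]) auto
  then show ?case using tendsto_const_iff[of "at (0::complex)" 0 "c n"] by simp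
qed

text \<open>Separates one variable, with the remaining ones absorbed into the summation over
  \<open>y\<close>; iteration reduces a power series in three variables to one variable.\<close>

lemma partial_power_series_zero:
  fixes g :: "nat \<Rightarrow> 'y \<Rightarrow> complex"
  assumes "\<And>z. ((\<lambda>(i, y). z ^ i * g i y) has_sum 0) UNIV"
  shows "(g i has_sum 0) UNIV"
proof -
  have "(\<lambda>(i, y). 1 ^ i * g i y) summable_on (SIGMA i:UNIV. UNIV)"
    using assms[of 1] by (auto simp: summable_on_def)
  then have "(\<lambda>y. case (i, y) of (i, y) \<Rightarrow> 1 ^ i * g i y) summable_on UNIV" for i
    using summable_on_SigmaD1[of "\<lambda>i y. 1 ^ i * g i y" UNIV "\<lambda>_. UNIV" i] by simp
  then have g: "(g i has_sum infsum (g i) UNIV) UNIV" for i by simp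
  have "(\<lambda>i. infsum (g i) UNIV * z ^ i) sums 0" for z
  proof (rule has_sum_imp_sums)
    have "((\<lambda>(i, y). z ^ i * g i y) has_sum 0) (SIGMA i:UNIV. UNIV)" using assms[of z] by simp
    then show "((\<lambda>i. infsum (g i) UNIV * z ^ i) has_sum 0) UNIV"
    proof (rule has_sum_SigmaD)
      show "((\<lambda>y. case (i, y) of (i, y) \<Rightarrow> z ^ i * g i y) has_sum infsum (g i) UNIV * z ^ i) UNIV" for i
        unfolding prod.case using has_sum_cmult_right[OF g[of i], of "z ^ i"] by (simp add: mult.commute)
    qed
  qed
  then have "infsum (g i) UNIV = 0" by (rule power_series_coeff_zero)
  then show ?thesis using g[of i] by simp
qed

lemma total_coherent: "total coherent"
proof (rule total_orthI, rule ell2_eqI)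
  fix f :: "idx ell2" and n :: idx
  assume orth: "\<And>w. cinner f (coherent w) = 0"
  \<comment> \<open>Dividing by the square roots of factorials turns the inner product with a
    coherent vector into a power series in the conjugated parameters, with these
    coefficients.\<close>
  define a where "a i j k = coord f (i, j, k) / (complex_of_real (sqrt (fact i)) * (complex_of_real (sqrt (fact j)) * complex_of_real (sqrt (fact k))))"
    for i j k
  have "((\<lambda>(i, p). z1 ^ i * (case p of (j, k) \<Rightarrow> z2 ^ j * (z3 ^ k * a i j k))) has_sum 0) UNIV" for z1 z2 z3
  proof -
    let ?w = "\<chi> l::3. cnj (if l = 1 then z1 else if l = 2 then z2 else z3)"
    have "((\<lambda>n. coord f n * cnj (coord (coherent ?w) n)) has_sum 0) UNIV"
      using has_sum_infsum[OF square_summable_prod[OF coord_square_summable[of f] coord_square_summable[of "coherent ?w"]]]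
        orth[of ?w] unfolding cinner_ell2_def by simp
    moreover have "coord f n * cnj (coord (coherent ?w) n) =
        (case n of (i, p) \<Rightarrow> z1 ^ i * (case p of (j, k) \<Rightarrow> z2 ^ j * (z3 ^ k * a i j k)))" for n
      by (cases n) (simp add: coord_coherent coherent_seq_def power_root_fact_def a_def mult_ac)
    ultimately show ?thesis by simp
  qed
  then have "((\<lambda>(j, k). z2 ^ j * (z3 ^ k * a i j k)) has_sum 0) UNIV" for z2 z3 i
    by (rule partial_power_series_zero)
  then have "((\<lambda>k. z3 ^ k * a i j k) has_sum 0) UNIV" for z3 i j
    by (rule partial_power_series_zero)
  then have "(\<lambda>k. a i j k * z3 ^ k) sums 0" for z3 i j
    by (intro has_sum_imp_sums) (simp add: mult.commute)
  then have a0: "a i j k = 0" for i j k by (rule power_series_coeff_zero)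
  obtain i j k where n: "n = (i, j, k)" by (cases n)
  show "coord f n = coord 0 n" using a0[of i j k] by (simp add: n a_def coord_ell2)
qed

section \<open>The Fock representation of the CCR\<close>

lemma csubspace_rapidly_decreasing: "csubspace rapidly_decreasing"
proof -
  have r: "rapidly_decreasing = {f. rapid (coord f)}" using rapidly_decreasing_iff by blast
  have "coord 0 = (\<lambda>n::idx. 0)" "coord (f + g) = (\<lambda>n. coord f n + coord g n)" "coord (c *\<^sub>C f) = (\<lambda>n. c * coord f n)"
    for f g :: "idx ell2" and c by (simp_all add: fun_eq_iff coord_ell2 coord_scaleC)
  then show ?thesis unfolding csubspace_def r
    using rapid_zero rapid_add rapid_scale by simp
qed

lemma csubspace_closure:
  fixes D :: "'h::complex_hilbert set"
  assumes "csubspace D"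
  shows "csubspace (closure D)"
  unfolding csubspace_def
proof (intro conjI ballI allI)
  show "0 \<in> closure D" using csubspaceD(1)[OF assms] closure_subset by blast
next
  fix x y assume "x \<in> closure D" "y \<in> closure D"
  then obtain X Y where "\<And>n. X n \<in> D" "X \<longlonglongrightarrow> x" "\<And>n. Y n \<in> D" "Y \<longlonglongrightarrow> y"
    unfolding closure_sequential by blast
  then have "\<forall>n. X n + Y n \<in> D" "(\<lambda>n. X n + Y n) \<longlonglongrightarrow> x + y"
    by (auto intro: csubspaceD(2)[OF assms] tendsto_add)
  then show "x + y \<in> closure D" unfolding closure_sequential by (intro exI[of _ "\<lambda>n. X n + Y n"]) simp
next
  fix c x assume "x \<in> closure D"
  then obtain X where "\<And>n. X n \<in> D" "X \<longlonglongrightarrow> x" unfolding closure_sequential by blast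
  then have "\<forall>n. c *\<^sub>C X n \<in> D" "(\<lambda>n. c *\<^sub>C X n) \<longlonglongrightarrow> c *\<^sub>C x"
    by (auto intro: csubspaceD(3)[OF assms] bounded_linear.tendsto[OF bounded_linear_scaleC])
  then show "c *\<^sub>C x \<in> closure D" unfolding closure_sequential by (intro exI[of _ "\<lambda>n. c *\<^sub>C X n"]) simp
qed

lemma dense_rapidly_decreasing: "closure rapidly_decreasing = UNIV"
proof -
  have "coherent w \<in> closure rapidly_decreasing" for w
    using coherent_rapid closure_subset by blast
  then have "x \<in> closure rapidly_decreasing" for x
    by (rule totalD[OF total_coherent csubspace_closure[OF csubspace_rapidly_decreasing] closed_closure])
  then show ?thesis by blast
qed

interpretation fock: operator_family rapidly_decreasing ladder
proof
  fix f g :: "idx ell2" and x :: "3 \<times> bool" and c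
  assume f: "f \<in> rapidly_decreasing"
  obtain l b where x: "x = (l, b)" by (cases x)
  show "ladder x (c *\<^sub>C f) = c *\<^sub>C ladder x f"
    using f csubspaceD(3)[OF csubspace_rapidly_decreasing f, of c]
    by (intro ell2_eqI; cases b) (simp_all add: x coord_ladder ann_def cre_def coord_scaleC)
  assume g: "g \<in> rapidly_decreasing"
  show "ladder x (f + g) = ladder x f + ladder x g"
    using f g csubspaceD(2)[OF csubspace_rapidly_decreasing f g]
    by (intro ell2_eqI; cases b) (simp_all add: x coord_ladder ann_def cre_def coord_ell2 distrib_left)
qed (simp_all add: csubspace_rapidly_decreasing dense_rapidly_decreasing ladder_rapid ladder_adjoint)

lemma of_real_sqrt_square: "0 \<le> x \<Longrightarrow> complex_of_real (sqrt x) * (complex_of_real (sqrt x) * z) = complex_of_real x * z"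
  by (simp add: mult.assoc[symmetric] flip: of_real_mult)

text \<open>The number operator of mode \<open>l\<close>; it also drives the proof that smooth
  vectors decrease rapidly.\<close>

lemma cre_ann: "cre l (ann l F) n = complex_of_real (real (occ l n)) * F n"
proof (cases "occ l n = 0")
  case False
  then have "real (occ l (down l n)) + 1 = real (occ l n)" by (simp add: occ_down)
  then show ?thesis
    using of_real_sqrt_square[of "real (occ l n)" "F n"] False by (simp add: ann_def cre_def up_down)
qed (simp add: cre_def)

lemma cre_ann_commute:
  "ann l (cre l F) n - cre l (ann l F) n = F n"
  "l \<noteq> m \<Longrightarrow> ann l (cre m F) n = cre m (ann l F) n"
  "cre l (cre m F) n = cre m (cre l F) n"
proof -
  have a: "ann l (cre l F) n = (complex_of_real (real (occ l n)) + 1) * F n"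
    using of_real_sqrt_square[of "real (occ l n) + 1" "F n"] by (simp add: ann_def cre_def occ_up add.commute)
  show "ann l (cre l F) n - cre l (ann l F) n = F n" by (simp add: a cre_ann algebra_simps)
  show "l \<noteq> m \<Longrightarrow> ann l (cre m F) n = cre m (ann l F) n"
    by (auto simp: ann_def cre_def occ_up occ_down up_down_commute)
  show "cre l (cre m F) n = cre m (cre l F) n"
    by (cases "l = m") (auto simp: cre_def occ_down down_commute)
qed

lemma fock_relations:
  assumes "q \<in> ccr_relations" "f \<in> rapidly_decreasing"
  shows "fock.evaluate q f = 0"
proof (rule ell2_eqI)
  fix n
  note [simp] = fock.evaluate_diff fock.evaluate_mult fock.evaluate_gen assms(2) ladder_rapid coord_ladder coord_ell2
  show "coord (fock.evaluate q f) n = coord 0 n"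
    using assms(1) cre_ann_commute(1)[of _ "coord f" n] cre_ann_commute(2)[of _ _ "coord f" n]
      cre_ann_commute(3)[of _ _ "coord f" n] by (auto simp: ccr_relations_def)
qed

section \<open>Smooth vectors of representations of the Heisenberg group\<close>

lemma C_k_SucI:
  fixes f :: "'a::euclidean_space \<Rightarrow> 'b::real_normed_vector"
  assumes "\<And>x. (f has_derivative f' x) (at x)" "\<And>v. C_k k (\<lambda>x. f' x v)"
  shows "C_k (Suc k) f"
proof -
  have "frechet_derivative f (at x) = f' x" for x
    using frechet_derivative_at[OF assms(1)[of x]] by simp
  then show ?thesis
    using assms by (auto simp: differentiable_on_def differentiable_def)
qed

lemma C_k_SucD:
  fixes f :: "'a::euclidean_space \<Rightarrow> 'b::real_normed_vector"
  assumes "C_k (Suc k) f"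
  shows "(f has_derivative frechet_derivative f (at x)) (at x)" "C_k k (\<lambda>x. frechet_derivative f (at x) v)"
  using assms by (auto simp: differentiable_on_def frechet_derivative_works)

lemma C_k_continuous:
  fixes f :: "'a::euclidean_space \<Rightarrow> 'b::real_normed_vector"
  shows "C_k k f \<Longrightarrow> continuous_on UNIV f"
  by (cases k) (simp_all add: differentiable_imp_continuous_on)

lemma C_k_Suc:
  fixes f :: "'a::euclidean_space \<Rightarrow> 'b::real_normed_vector"
  shows "C_k (Suc k) f \<Longrightarrow> C_k k f"
proof (induction k arbitrary: f)
  case 0
  then show ?case using C_k_continuous[of "Suc 0" f] by simp
next
  case (Suc k)
  show ?case using C_k_SucD[OF Suc.prems] Suc.IH by (intro C_k_SucI) auto
qed

lemma C_k_linear: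
  fixes f :: "'a::euclidean_space \<Rightarrow> 'b::real_normed_vector" and L :: "'b \<Rightarrow> 'c::real_normed_vector"
  assumes L: "bounded_linear L"
  shows "C_k k f \<Longrightarrow> C_k k (\<lambda>x. L (f x))"
proof (induction k arbitrary: f)
  case 0
  then show ?case by (simp add: bounded_linear.continuous_on[OF L])
next
  case (Suc k)
  show ?case
    by (rule C_k_SucI[OF bounded_linear.has_derivative[OF L C_k_SucD(1)[OF Suc.prems]]])
      (rule Suc.IH[OF C_k_SucD(2)[OF Suc.prems]])
qed

lemma C_k_add:
  fixes f g :: "'a::euclidean_space \<Rightarrow> 'b::real_normed_vector"
  shows "C_k k f \<Longrightarrow> C_k k g \<Longrightarrow> C_k k (\<lambda>x. f x + g x)"
proof (induction k arbitrary: f g)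
  case 0
  then show ?case by (simp add: continuous_on_add)
next
  case (Suc k)
  show ?case
    by (rule C_k_SucI[OF has_derivative_add[OF C_k_SucD(1)[OF Suc.prems(1)] C_k_SucD(1)[OF Suc.prems(2)]]])
      (rule Suc.IH[OF C_k_SucD(2)[OF Suc.prems(1)] C_k_SucD(2)[OF Suc.prems(2)]])
qed

text \<open>In group coordinates the derivative of an orbit map acquires a factor
  \<open>symp g X\<close>, which is linear in \<open>g\<close>; this lemma covers such
  coefficients.\<close>

lemma C_k_scaleR_linear:
  fixes f :: "'a::euclidean_space \<Rightarrow> 'b::real_normed_vector" and l :: "'a \<Rightarrow> real"
  assumes l: "bounded_linear l"
  shows "C_k k f \<Longrightarrow> C_k k (\<lambda>x. l x *\<^sub>R f x)"
proof (induction k arbitrary: f)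
  case 0
  then show ?case by (simp add: continuous_on_scaleR linear_continuous_on[OF l])
next
  case (Suc k)
  show ?case
  proof (rule C_k_SucI)
    fix x
    show "((\<lambda>x. l x *\<^sub>R f x) has_derivative (\<lambda>v. l x *\<^sub>R frechet_derivative f (at x) v + l v *\<^sub>R f x)) (at x)"
      by (rule has_derivative_scaleR[OF bounded_linear_imp_has_derivative[OF l] C_k_SucD(1)[OF Suc.prems]])
  next
    fix v
    show "C_k k (\<lambda>x. l x *\<^sub>R frechet_derivative f (at x) v + l v *\<^sub>R f x)"
      by (intro C_k_add Suc.IH C_k_SucD(2)[OF Suc.prems] C_k_linear[OF bounded_linear_scaleR_right] C_k_Suc[OF Suc.prems])
  qed
qed

section \<open>The group law and orbit maps\<close>

definition symp :: "heis \<Rightarrow> heis \<Rightarrow> real" where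
  "symp g h = fst g \<bullet> fst (snd h) - fst (snd g) \<bullet> fst h"

definition centre :: heis where
  "centre = (0, 0, 1)"

text \<open>Ordinary addition with a central correction; group identities become linear algebra for
  \<open>symp\<close>.\<close>

lemma heis_mult: "g \<otimes>\<^bsub>heisenberg\<^esub> h = g + h + (symp g h / 2) *\<^sub>R centre"
  by (cases g; cases h) (simp add: heisenberg_def symp_def centre_def)

lemma symp_simps: "symp g 0 = 0" "symp 0 g = 0" "symp g g = 0" "symp g (h + k) = symp g h + symp g k"
  "symp (g + h) k = symp g k + symp h k" "symp g (r *\<^sub>R h) = r * symp g h" "symp (r *\<^sub>R g) h = r * symp g h"
  "symp g centre = 0" "symp centre g = 0" "symp g (- h) = - symp g h" "symp (- g) h = - symp g h"
  "symp g (h - k) = symp g h - symp g k"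
  by (simp_all add: symp_def centre_def inner_add_left inner_add_right inner_commute inner_diff_right algebra_simps)

lemma bounded_linear_symp: "bounded_linear (\<lambda>h. symp g h)" "bounded_linear (\<lambda>g. symp g h)"
proof -
  have "linear (\<lambda>h. symp g h)" "linear (\<lambda>g. symp g h)" by (rule linearI; simp add: symp_simps)+
  then show "bounded_linear (\<lambda>h. symp g h)" "bounded_linear (\<lambda>g. symp g h)"
    by (simp_all only: linear_conv_bounded_linear)
qed

lemma has_vector_derivative_compose_line:
  assumes "(f has_derivative f') (at x)"
  shows "((\<lambda>s. f (x + s *\<^sub>R v)) has_vector_derivative f' v) (at 0)"
proof -
  have "((\<lambda>s::real. x + s *\<^sub>R v) has_derivative (\<lambda>s. s *\<^sub>R v)) (at 0)"
    by (auto intro!: derivative_eq_intros)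
  then have "((\<lambda>s. f (x + s *\<^sub>R v)) has_derivative (\<lambda>s. f' (s *\<^sub>R v))) (at 0)"
    by (rule has_derivative_compose) (use assms in simp)
  then show ?thesis
    using has_derivative_bounded_linear[OF assms] by (simp add: has_vector_derivative_def linear_simps)
qed

locale heis_rep =
  fixes U :: "heis \<Rightarrow> 'h::complex_hilbert \<Rightarrow> 'h"
  assumes rep: "strongly_continuous_unitary_rep U"
begin

lemma U_unitary: "unitary (U g)"
  using rep[unfolded strongly_continuous_unitary_rep_def, THEN conjunct1] by (rule spec)

lemmas U_simps = unitaryD[OF U_unitary]

lemma U_mult: "U g (U h \<xi>) = U (g + h + (symp g h / 2) *\<^sub>R centre) \<xi>"
proof -
  have "U (g \<otimes>\<^bsub>heisenberg\<^esub> h) = U g \<circ> U h"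
    using rep[unfolded strongly_continuous_unitary_rep_def, THEN conjunct2, THEN conjunct1, THEN spec] by (rule spec)
  then show ?thesis by (simp add: heis_mult o_def fun_eq_iff del: split_paired_All)
qed

lemma U_continuous: "continuous_on UNIV (\<lambda>g. U g \<xi>)"
  using rep[unfolded strongly_continuous_unitary_rep_def, THEN conjunct2, THEN conjunct2] by (rule spec)

lemma U_zero [simp]: "U 0 \<xi> = \<xi>"
proof -
  have "U 0 (U 0 \<xi>) = U 0 \<xi>" by (simp add: U_mult symp_simps)
  then show ?thesis by (rule injD[OF bij_is_inj[OF U_simps(9)]])
qed

lemma U_line: "U (a *\<^sub>R X) (U (b *\<^sub>R X) \<xi>) = U ((a + b) *\<^sub>R X) \<xi>"
  by (simp add: U_mult symp_simps scaleR_add_left)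

lemma U_inverse: "U X (U (- X) \<xi>) = \<xi>" "U (- X) (U X \<xi>) = \<xi>"
  by (simp_all add: U_mult symp_simps)

lemma U_adjoint: "cinner (U X \<xi>) \<eta> = cinner \<xi> (U (- X) \<eta>)"
proof -
  have "cinner (U X \<xi>) (U X (U (- X) \<eta>)) = cinner \<xi> (U (- X) \<eta>)" by (rule U_simps(3))
  then show ?thesis by (simp add: U_inverse)
qed

text \<open>With the central correction put into the argument, left translation reduces
  differentiability at \<open>g\<close> to differentiability at 0.\<close>

lemma U_translate: "U (g + h) \<xi> = U g (U (h - (symp g h / 2) *\<^sub>R centre) \<xi>)"
  by (simp add: U_mult symp_simps algebra_simps)

lemma line_derivative:
  assumes "((\<lambda>s. U (s *\<^sub>R X) \<xi>) has_vector_derivative d) (at 0)"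
  shows "((\<lambda>s. U (s *\<^sub>R X) \<xi>) has_vector_derivative U (s *\<^sub>R X) d) (at s)"
proof -
  have "((\<lambda>r. r - s) has_vector_derivative 1) (at s)"
    by (auto intro!: derivative_eq_intros)
  then have "((\<lambda>r. U ((r - s) *\<^sub>R X) \<xi>) has_vector_derivative d) (at s)"
    using vector_diff_chain_at[of "\<lambda>r. r - s" 1 s "\<lambda>s. U (s *\<^sub>R X) \<xi>" d] assms by (simp add: o_def)
  from bounded_linear.has_vector_derivative[OF U_simps(8)[of "s *\<^sub>R X"] this]
  show ?thesis by (simp add: U_line)
qed

text \<open>The orbit map of \<open>differential U X \<xi>\<close> is the derivative of the orbit
  map of \<open>\<xi>\<close> along the left-invariant vector field of \<open>X\<close>. The
  coefficients of that field are affine in \<open>g\<close>, so the result is again smooth.\<close>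

lemma smooth_differential:
  assumes "\<xi> \<in> smooth_vectors U"
  shows "((\<lambda>s. U (s *\<^sub>R X) \<xi>) has_vector_derivative differential U X \<xi>) (at 0)"
    and "differential U X \<xi> \<in> smooth_vectors U"
proof -
  define f where "f = (\<lambda>g. U g \<xi>)"
  define f' where "f' g = frechet_derivative f (at g)" for g
  have C: "C_k k f" for k using assms by (simp add: smooth_vectors_def f_def)
  have f': "(f has_derivative f' g) (at g)" for g
    unfolding f'_def by (rule C_k_SucD(1)[OF C[of "Suc 0"]])
  have 0: "((\<lambda>s. U (s *\<^sub>R X) \<xi>) has_vector_derivative f' 0 X) (at 0)"
    using has_vector_derivative_compose_line[OF f'[of 0], of X] by (simp add: f_def)
  have d: "differential U X \<xi> = f' 0 X"
    unfolding differential_def by (rule vector_derivative_at[OF 0])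
  show "((\<lambda>s. U (s *\<^sub>R X) \<xi>) has_vector_derivative differential U X \<xi>) (at 0)"
    using 0 by (simp add: d)
  have g: "U g (f' 0 X) = f' g X + (symp g X / 2) *\<^sub>R f' g centre" for g
  proof -
    \<comment> \<open>The left-invariant vector field of \<open>X\<close> at \<open>g\<close>: the
      group product of \<open>g\<close> and \<open>s *\<^sub>R X\<close> runs along the straight
      line \<open>g + s *\<^sub>R ?v\<close>.\<close>
    let ?v = "X + (symp g X / 2) *\<^sub>R centre"
    have "((\<lambda>s. U g (U (s *\<^sub>R X) \<xi>)) has_vector_derivative U g (f' 0 X)) (at 0)"
      by (rule bounded_linear.has_vector_derivative[OF U_simps(8) 0])
    moreover have "U g (U (s *\<^sub>R X) \<xi>) = f (g + s *\<^sub>R ?v)" for s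
      by (simp add: U_mult f_def symp_simps scaleR_add_right add.assoc)
    ultimately have "((\<lambda>s. f (g + s *\<^sub>R ?v)) has_vector_derivative U g (f' 0 X)) (at 0)" by simp
    then have "U g (f' 0 X) = f' g ?v"
      using has_vector_derivative_compose_line[OF f'[of g], of ?v] by (rule vector_derivative_unique_at)
    then show ?thesis
      using has_derivative_bounded_linear[OF f'[of g]] by (simp add: linear_simps)
  qed
  have "C_k k (\<lambda>g. f' g X + (symp g X / 2) *\<^sub>R f' g centre)" for k
    unfolding f'_def
    by (intro C_k_add C_k_scaleR_linear C_k_SucD(2)[OF C]
        bounded_linear_compose[OF bounded_linear_divide bounded_linear_symp(2)])
  then show "differential U X \<xi> \<in> smooth_vectors U" by (simp add: smooth_vectors_def d g)
qed

text \<open>The mean value inequality turns strong continuity at the identity into Frechet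
  differentiability there.\<close>

lemma smooth_vectorsI:
  assumes V: "\<And>\<xi> X. \<xi> \<in> V \<Longrightarrow> T X \<xi> \<in> V"
    and lin: "\<And>\<xi>. \<xi> \<in> V \<Longrightarrow> linear (\<lambda>X. T X \<xi>)"
    and deriv: "\<And>\<xi> X. \<xi> \<in> V \<Longrightarrow> ((\<lambda>s. U (s *\<^sub>R X) \<xi>) has_vector_derivative T X \<xi>) (at 0)"
  shows "V \<subseteq> smooth_vectors U"
proof -
  have bl: "bounded_linear (\<lambda>X. T X \<xi>)" if "\<xi> \<in> V" for \<xi>
    using lin[OF that] by (simp add: linear_linear)
  \<comment> \<open>The curve \<open>?f\<close> has derivative
    \<open>U (s *\<^sub>R X) (T X \<xi>) - T X \<xi>\<close>, so \<open>B\<close> bounds its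
    increment over the unit interval, and this increment is the first-order error.\<close>
  have mean: "norm (U X \<xi> - \<xi> - T X \<xi>) \<le> B"
    if \<xi>: "\<xi> \<in> V" and B: "\<And>s. s \<in> {0..1} \<Longrightarrow> norm (U (s *\<^sub>R X) (T X \<xi>) - T X \<xi>) \<le> B" for \<xi> X B
  proof -
    let ?f = "\<lambda>s. U (s *\<^sub>R X) \<xi> - s *\<^sub>R T X \<xi>"
    have "(?f has_vector_derivative U (s *\<^sub>R X) (T X \<xi>) - T X \<xi>) (at s within {0..1})" for s
      by (rule has_vector_derivative_at_within)
        (auto intro!: derivative_eq_intros line_derivative[OF deriv[OF \<xi>]])
    then have "(?f has_derivative (\<lambda>h. h *\<^sub>R (U (s *\<^sub>R X) (T X \<xi>) - T X \<xi>))) (at s within {0..1})" for s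
      by (simp add: has_vector_derivative_def)
    moreover have "onorm (\<lambda>h. h *\<^sub>R (U (s *\<^sub>R X) (T X \<xi>) - T X \<xi>)) \<le> B" if "s \<in> {0..1}" for s
    proof (rule onorm_bound)
      show "0 \<le> B" using B[of 0] by simp
      show "norm (x *\<^sub>R (U (s *\<^sub>R X) (T X \<xi>) - T X \<xi>)) \<le> B * norm x" for x
        using mult_left_mono[OF B[OF that], of "\<bar>x\<bar>"] by (simp add: mult.commute)
    qed
    ultimately have "norm (?f 1 - ?f 0) \<le> B * norm (1 - 0 :: real)"
      by (intro differentiable_bound[of "{0..1}" ?f "\<lambda>s h. h *\<^sub>R (U (s *\<^sub>R X) (T X \<xi>) - T X \<xi>)"]) auto
    then show ?thesis by (simp add: algebra_simps)
  qed
  have at0: "((\<lambda>X. U X \<xi>) has_derivative (\<lambda>X. T X \<xi>)) (at 0)" if \<xi>: "\<xi> \<in> V" for \<xi>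
    unfolding has_derivative_at
  proof (intro conjI bl[OF \<xi>])
    \<comment> \<open>The dimension of the group. \<open>T X \<xi>\<close> is a combination of the
      finitely many vectors \<open>T b \<xi>\<close>, so strong continuity at these, each with
      tolerance \<open>e / ?N\<close>, controls all directions at once.\<close>
    let ?N = "real (card (Basis :: heis set))"
    have small: "\<exists>d>0. \<forall>X. norm X < d \<longrightarrow> norm (U X \<xi> - \<xi> - T X \<xi>) \<le> e * norm X" if e: "e > 0" for e
    proof -
      have N: "?N > 0" by (simp add: card_gt_0_iff)
      have "\<exists>d>0. \<forall>X. norm X < d \<longrightarrow> norm (U X \<eta> - \<eta>) < e / ?N" for \<eta>
      proof -
        have "e / ?N > 0" using e N by simp
        then obtain d where "d > 0" "\<forall>X\<in>UNIV. dist X 0 < d \<longrightarrow> dist (U X \<eta>) (U 0 \<eta>) < e / ?N"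
          using U_continuous[of \<eta>] unfolding continuous_on_iff by blast
        then show ?thesis unfolding dist_norm U_zero diff_zero by blast
      qed
      then obtain d where d: "\<And>\<eta>. d \<eta> > 0" "\<And>\<eta> X. norm X < d \<eta> \<Longrightarrow> norm (U X \<eta> - \<eta>) < e / ?N"
        using choice[of "\<lambda>\<eta> d. d > 0 \<and> (\<forall>X. norm X < d \<longrightarrow> norm (U X \<eta> - \<eta>) < e / ?N)"] by blast
      define d0 where "d0 = Min ((\<lambda>b. d (T b \<xi>)) ` Basis)"
      have d0: "d0 > 0" "\<And>b. b \<in> Basis \<Longrightarrow> d0 \<le> d (T b \<xi>)"
        unfolding d0_def by (simp_all add: d(1))
      have "norm (U X \<xi> - \<xi> - T X \<xi>) \<le> e * norm X" if X: "norm X < d0" for X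
      proof (rule mean[OF \<xi>])
        fix s :: real assume s: "s \<in> {0..1}"
        have TX: "T X \<xi> = (\<Sum>b\<in>Basis. (X \<bullet> b) *\<^sub>R T b \<xi>)"
          using linear_sum[OF lin[OF \<xi>], of "\<lambda>b. (X \<bullet> b) *\<^sub>R b" Basis] linear_cmul[OF lin[OF \<xi>]]
          by (simp add: euclidean_representation)
        have "U (s *\<^sub>R X) (T X \<xi>) - T X \<xi> = (\<Sum>b\<in>Basis. (X \<bullet> b) *\<^sub>R (U (s *\<^sub>R X) (T b \<xi>) - T b \<xi>))"
          unfolding TX linear_sum[OF bounded_linear.linear[OF U_simps(8)]] linear_simps(5)[OF U_simps(8)]
          by (simp add: scaleR_diff_right sum_subtractf)
        also have "norm \<dots> \<le> (\<Sum>b\<in>(Basis::heis set). norm X * (e / ?N))"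
        proof (rule sum_norm_le)
          fix b :: heis assume b: "b \<in> Basis"
          have "norm (s *\<^sub>R X) \<le> norm X" using s by (simp add: mult_left_le_one_le)
          then have "norm (U (s *\<^sub>R X) (T b \<xi>) - T b \<xi>) \<le> e / ?N"
            using d(2)[of "s *\<^sub>R X" "T b \<xi>"] d0(2)[OF b] X by (intro less_imp_le) linarith
          then show "norm ((X \<bullet> b) *\<^sub>R (U (s *\<^sub>R X) (T b \<xi>) - T b \<xi>)) \<le> norm X * (e / ?N)"
            unfolding norm_scaleR using Basis_le_norm[OF b, of X] by (intro mult_mono) auto
        qed
        also have "\<dots> = e * norm X" using N by simp
        finally show "norm (U (s *\<^sub>R X) (T X \<xi>) - T X \<xi>) \<le> e * norm X" .
      qed
      then show ?thesis using d0(1) by blast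
    qed
    show "(\<lambda>h. norm (U (0 + h) \<xi> - U 0 \<xi> - T h \<xi>) / norm h) \<midarrow>0\<rightarrow> 0"
      unfolding LIM_eq
    proof (intro allI impI)
      fix e :: real assume "0 < e"
      then obtain d where d: "d > 0" "\<And>X. norm X < d \<Longrightarrow> norm (U X \<xi> - \<xi> - T X \<xi>) \<le> e / 2 * norm X"
        using small[OF half_gt_zero] by blast
      have "norm (norm (U (0 + h) \<xi> - U 0 \<xi> - T h \<xi>) / norm h - 0) < e" if "h \<noteq> 0" "norm (h - 0) < d" for h
      proof -
        have "norm (U h \<xi> - \<xi> - T h \<xi>) / norm h \<le> e / 2"
          using d(2)[of h] that by (simp add: divide_le_eq)
        moreover have "0 \<le> norm (U h \<xi> - \<xi> - T h \<xi>) / norm h" by simp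
        ultimately have "\<bar>norm (U h \<xi> - \<xi> - T h \<xi>) / norm h\<bar> < e" using \<open>0 < e\<close> by linarith
        then show ?thesis by (simp only: real_norm_def add_0 U_zero diff_zero)
      qed
      then show "\<exists>s>0. \<forall>h. h \<noteq> 0 \<and> norm (h - 0) < s \<longrightarrow> norm (norm (U (0 + h) \<xi> - U 0 \<xi> - T h \<xi>) / norm h - 0) < e"
        using d(1) by blast
    qed
  qed
  \<comment> \<open>Translation by \<open>g\<close> moves the point to the identity; the central
    correction in \<open>U_translate\<close> contributes the term with \<open>symp g h\<close> and
    the factor \<open>- 1 / 2\<close>.\<close>
  have everywhere: "((\<lambda>X. U X \<xi>) has_derivative (\<lambda>h. U g (T h \<xi>) + (symp g h * (- 1 / 2)) *\<^sub>R U g (T centre \<xi>))) (at g)"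
    if \<xi>: "\<xi> \<in> V" for \<xi> g
  proof -
    let ?L = "\<lambda>h. h - (symp g h / 2) *\<^sub>R centre"
    have L: "bounded_linear ?L"
      by (intro bounded_linear_sub bounded_linear_ident bounded_linear_compose[OF bounded_linear_scaleR_left]
          bounded_linear_compose[OF bounded_linear_divide bounded_linear_symp(1)])
    have "((\<lambda>h. ?L (h - g)) has_derivative ?L) (at g)"
      by (rule bounded_linear.has_derivative[OF L]) (auto intro!: derivative_eq_intros)
    then have "((\<lambda>h. U (?L (h - g)) \<xi>) has_derivative (\<lambda>h. T (?L h) \<xi>)) (at g)"
      by (rule has_derivative_compose) (use at0[OF \<xi>] in \<open>simp add: symp_simps\<close>)
    from bounded_linear.has_derivative[OF U_simps(8)[of g] this]
    have "((\<lambda>h. U (g + (h - g)) \<xi>) has_derivative (\<lambda>h. U g (T (?L h) \<xi>))) (at g)"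
      by (simp only: U_translate[of g])
    moreover have "U g (T (?L h) \<xi>) = U g (T h \<xi>) + (symp g h * (- 1 / 2)) *\<^sub>R U g (T centre \<xi>)" for h
      by (simp add: linear_simps[OF bl[OF \<xi>]] linear_simps[OF U_simps(8)])
    ultimately show ?thesis by simp
  qed
  \<comment> \<open>The derivative of an orbit map of a vector in \<open>V\<close> is built from
    orbit maps of vectors in \<open>V\<close> with constant and linear coefficients, so each order
    of smoothness yields the next.\<close>
  have "\<forall>\<xi>\<in>V. C_k k (\<lambda>g. U g \<xi>)" for k
  proof (induction k)
    case 0
    then show ?case by (simp add: U_continuous)
  next
    case (Suc k)
    show ?case
    proof
      fix \<xi> assume \<xi>: "\<xi> \<in> V"
      have l: "bounded_linear (\<lambda>g. symp g v * (- 1 / 2))" for v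
        by (rule bounded_linear_compose[OF bounded_linear_mult_left bounded_linear_symp(2)])
      show "C_k (Suc k) (\<lambda>g. U g \<xi>)"
        by (rule C_k_SucI[OF everywhere[OF \<xi>]], rule C_k_add[OF bspec[OF Suc V[OF \<xi>]]],
            rule C_k_scaleR_linear[OF l bspec[OF Suc V[OF \<xi>]]])
    qed
  qed
  then show ?thesis unfolding smooth_vectors_def by blast
qed

end

lemma smooth_intertwine:
  assumes "heis_rep U" "heis_rep U'" and L: "bounded_linear L" and comm: "\<And>g. L (U g \<xi>) = U' g (L \<xi>)"
    and \<xi>: "\<xi> \<in> smooth_vectors U"
  shows "L \<xi> \<in> smooth_vectors U'" "L (differential U X \<xi>) = differential U' X (L \<xi>)"
proof -
  interpret U: heis_rep U by fact
  show "L \<xi> \<in> smooth_vectors U'"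
    unfolding smooth_vectors_def comm[symmetric] mem_Collect_eq
    using \<xi> by (intro allI C_k_linear[OF L]) (simp add: smooth_vectors_def)
  have "((\<lambda>s. U' (s *\<^sub>R X) (L \<xi>)) has_vector_derivative L (differential U X \<xi>)) (at 0)"
    unfolding comm[symmetric] by (rule bounded_linear.has_vector_derivative[OF L U.smooth_differential(1)[OF \<xi>]])
  then show "L (differential U X \<xi>) = differential U' X (L \<xi>)"
    unfolding differential_def[of U'] by (rule vector_derivative_at[symmetric])
qed

section \<open>The Fock representation of the Heisenberg group\<close>

lemma hdot_simps: "hdot (u + v) w = hdot u w + hdot v w" "hdot w (u + v) = hdot w u + hdot w v"
  "cnj (hdot u v) = hdot v u" "hdot 0 w = 0" "hdot w 0 = 0"
  by (simp_all add: hdot_def distrib_left distrib_right sum.distrib mult.commute)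

lemma hdot_scaleR: "hdot (r *\<^sub>R u) v = of_real r * hdot u v" "hdot u (r *\<^sub>R v) = of_real r * hdot u v"
  by (simp_all add: hdot_def sum_distrib_left scaleR_conv_of_real[where 'a = complex] mult_ac)

lemma continuous_on_hdot [continuous_intros]:
  "continuous_on S f \<Longrightarrow> continuous_on S g \<Longrightarrow> continuous_on S (\<lambda>x. hdot (f x) (g x))"
  unfolding hdot_def by (intro continuous_intros)

text \<open>The squared distance of two coherent vectors is an explicit expression in the kernel
  \<open>exp (hdot w v)\<close>, so continuity of the kernel suffices.\<close>

lemma continuous_coherent: "continuous_on UNIV coherent"
  unfolding continuous_on_def
proof
  fix v
  let ?N = "\<lambda>w. Re (exp (hdot w w)) - 2 * Re (exp (hdot w v)) + Re (exp (hdot v v))"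
  have "continuous_on UNIV ?N" by (intro continuous_intros)
  then have "isCont ?N v" by (simp add: continuous_on_eq_continuous_at)
  then have "(?N \<longlongrightarrow> ?N v) (at v)" by (rule isContD)
  moreover have "?N v = 0" by simp
  moreover have "?N w = (norm (coherent w - coherent v))\<^sup>2" for w
    by (subst norm_diff_square) (simp add: norm_eq_Re_cinner cinner_coherent)
  ultimately have "((\<lambda>w. (norm (coherent w - coherent v))\<^sup>2) \<longlongrightarrow> 0) (at v)" by simp
  then have "((\<lambda>w. sqrt ((norm (coherent w - coherent v))\<^sup>2)) \<longlongrightarrow> sqrt 0) (at v)" by (rule tendsto_real_sqrt)
  then show "(coherent \<longlongrightarrow> coherent v) (at v)"
    by (subst LIM_zero_iff[symmetric], subst tendsto_norm_zero_iff[symmetric]) simp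
qed

text \<open>The coefficient of the creation operators in \<open>\<i> (p \<bullet> P + q \<bullet> Q)\<close>.\<close>

definition amp :: "heis \<Rightarrow> complex^3" where
  "amp X = (\<chi> l. (\<i> * complex_of_real (fst (snd X) $ l) - complex_of_real (fst X $ l)) / complex_of_real (sqrt 2))"

lemma amp_linear: "amp (X + Y) = amp X + amp Y" "amp (r *\<^sub>R X) = r *\<^sub>R amp X" "amp 0 = 0"
  "amp centre = 0" "amp (- X) = - amp X"
  by (simp_all add: amp_def vec_eq_iff centre_def algebra_simps diff_divide_distrib add_divide_distrib scaleR_conv_of_real[where 'a = complex])

lemma hdot_amp_self: "hdot (amp X) (amp X) = complex_of_real (((norm (fst X))\<^sup>2 + (norm (fst (snd X)))\<^sup>2) / 2)"
proof -
  have "amp X $ l * cnj (amp X $ l) = complex_of_real (((fst X $ l)\<^sup>2 + (fst (snd X) $ l)\<^sup>2) / 2)" for l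
    unfolding complex_norm_square[symmetric] amp_def vec_lambda_beta
    by (simp add: norm_divide power_divide cmod_power2)
  then have "hdot (amp X) (amp X) = complex_of_real (\<Sum>l\<in>UNIV. ((fst X $ l)\<^sup>2 + (fst (snd X) $ l)\<^sup>2) / 2)"
    unfolding hdot_def of_real_sum by (rule sum.cong[OF refl])
  also have "(\<Sum>l\<in>UNIV. ((fst X $ l)\<^sup>2 + (fst (snd X) $ l)\<^sup>2) / 2) = ((norm (fst X))\<^sup>2 + (norm (fst (snd X)))\<^sup>2) / 2"
  proof -
    have "(norm v)\<^sup>2 = (\<Sum>l\<in>UNIV. (v $ l)\<^sup>2)" for v :: "real^3"
      unfolding power2_norm_eq_inner inner_vec_def by (simp add: power2_eq_square)
    then show ?thesis by (simp add: sum.distrib sum_divide_distrib[symmetric])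
  qed
  finally show ?thesis .
qed

text \<open>The imaginary part of the hermitian form is half the symplectic form; this is how the
  cocycle of the group law arises in \<open>weyl_mult\<close>.\<close>

lemma hdot_amp_symp: "hdot (amp X) (amp Y) - hdot (amp Y) (amp X) = \<i> * complex_of_real (symp X Y)"
proof -
  have s: "complex_of_real (sqrt 2) * complex_of_real (sqrt 2) = 2" by (simp flip: of_real_mult)
  have "amp X $ l * cnj (amp Y $ l) - amp Y $ l * cnj (amp X $ l)
      = \<i> * complex_of_real (fst X $ l * fst (snd Y) $ l - fst (snd X) $ l * fst Y $ l)" for l
  proof -
    define c where "c = complex_of_real (sqrt 2)"
    have "amp A $ l * cnj (amp B $ l) = ((\<i> * complex_of_real (fst (snd A) $ l) - complex_of_real (fst A $ l)) *
        (- \<i> * complex_of_real (fst (snd B) $ l) - complex_of_real (fst B $ l))) / (c * c)" for A B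
      by (simp add: amp_def c_def)
    note this[unfolded s[folded c_def]]
    then show ?thesis by (simp only:) (simp add: field_simps)
  qed
  then have "hdot (amp X) (amp Y) - hdot (amp Y) (amp X)
      = (\<Sum>l\<in>UNIV. \<i> * complex_of_real (fst X $ l * fst (snd Y) $ l - fst (snd X) $ l * fst Y $ l))"
    unfolding hdot_def sum_subtractf[symmetric] by simp
  also have "\<dots> = \<i> * complex_of_real (\<Sum>l\<in>UNIV. fst X $ l * fst (snd Y) $ l - fst (snd X) $ l * fst Y $ l)"
    by (simp only: sum_distrib_left of_real_sum)
  finally show ?thesis by (simp only: symp_def inner_vec_def inner_real_def sum_subtractf)
qed

text \<open>The value of the displacement operator on a coherent vector: splitting the exponential
  into a creation and an annihilation part costs the factor with
  \<open>hdot (amp X) (amp X) / 2\<close>, and the annihilation part acts on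
  \<open>coherent w\<close> by the factor with \<open>hdot w (amp X)\<close>.\<close>

definition displaced :: "heis \<Rightarrow> complex^3 \<Rightarrow> idx ell2" where
  "displaced X w = exp (\<i> * complex_of_real (snd (snd X)) - hdot (amp X) (amp X) / 2 - hdot w (amp X)) *\<^sub>C coherent (w + amp X)"

lemma displaced_gram: "cinner (coherent w) (coherent v) = cinner (displaced X w) (displaced X v)"
  by (simp add: displaced_def cinner_scaleC_left cinner_scaleC_right cinner_coherent exp_cnj hdot_simps
      mult_exp_exp algebra_simps)

text \<open>Displacement permutes the coherent vectors up to nonzero scalars, so the displaced
  family has the same closed span.\<close>

lemma displaced_total: "total (displaced X)"
  unfolding total_def
proof (intro allI impI)
  fix M assume M: "csubspace M \<and> closed M \<and> range (displaced X) \<subseteq> M"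
  have "coherent v \<in> M" for v
  proof -
    let ?w = "v - amp X"
    let ?c = "\<i> * complex_of_real (snd (snd X)) - hdot (amp X) (amp X) / 2 - hdot ?w (amp X)"
    have "exp (- ?c) *\<^sub>C displaced X ?w = coherent v"
      by (simp only: displaced_def scaleC_scaleC mult_exp_exp) simp
    moreover have "exp (- ?c) *\<^sub>C displaced X ?w \<in> M"
      using M by (intro csubspaceD(3)) auto
    ultimately show ?thesis by simp
  qed
  then have "x \<in> M" for x
    using M by - (rule totalD[OF total_coherent], auto)
  then show "M = UNIV" by blast
qed

definition weyl :: "heis \<Rightarrow> idx ell2 \<Rightarrow> idx ell2" where
  "weyl X = (SOME W. unitary W \<and> (\<forall>w. W (coherent w) = displaced X w))"

lemma weyl: "unitary (weyl X)" "weyl X (coherent w) = displaced X w"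
proof -
  have *: "unitary (weyl X) \<and> (\<forall>w. weyl X (coherent w) = displaced X w)"
    unfolding weyl_def
    by (rule someI_ex[OF unitary_extension[where u = coherent and v = "displaced X", OF displaced_gram total_coherent displaced_total]])
  show "unitary (weyl X)" using * by (rule conjunct1)
  show "weyl X (coherent w) = displaced X w" using *[THEN conjunct2] by (rule spec)
qed

lemma weyl_mult: "weyl X (weyl Y f) = weyl (X + Y + (symp X Y / 2) *\<^sub>R centre) f"
proof -
  let ?Z = "X + Y + (symp X Y / 2) *\<^sub>R centre"
  have on_coherent: "weyl X (weyl Y (coherent w)) = weyl ?Z (coherent w)" for w
  proof -
    have a: "amp ?Z = amp X + amp Y" by (simp add: amp_linear)
    have t: "snd (snd ?Z) = snd (snd X) + snd (snd Y) + symp X Y / 2" by (simp add: centre_def)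
    have s: "\<i> * complex_of_real (symp X Y / 2) = hdot (amp X) (amp Y) / 2 - hdot (amp Y) (amp X) / 2"
      using hdot_amp_symp[of X Y] by (simp add: diff_divide_distrib[symmetric])
    have "weyl X (weyl Y (coherent w)) =
      (exp (\<i> * complex_of_real (snd (snd Y)) - hdot (amp Y) (amp Y) / 2 - hdot w (amp Y)) *
       exp (\<i> * complex_of_real (snd (snd X)) - hdot (amp X) (amp X) / 2 - hdot (w + amp Y) (amp X))) *\<^sub>C
       coherent (w + amp Y + amp X)"
      by (simp add: weyl displaced_def unitaryD(2)[OF weyl(1)] scaleC_scaleC)
    also have "\<dots> = displaced ?Z w"
      unfolding displaced_def a t mult_exp_exp of_real_add distrib_left s hdot_simps
      by (simp add: algebra_simps add_divide_distrib)
    finally show ?thesis by (simp only: weyl)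
  qed
  show ?thesis
    by (rule total_eqI[OF total_coherent, of "\<lambda>f. weyl X (weyl Y f)" "weyl ?Z"])
      (simp_all add: on_coherent unitaryD[OF weyl(1)] bounded_linear_compose[OF unitaryD(8)[OF weyl(1)] unitaryD(8)[OF weyl(1)]])
qed

lemma continuous_amp: "continuous_on UNIV amp"
proof -
  have "linear amp" by (rule linearI) (simp_all add: amp_linear)
  then show ?thesis by (simp add: linear_continuous_on linear_conv_bounded_linear)
qed

text \<open>Unitarity makes convergence of orbit maps uniform in the group element. Strong
  continuity thus follows from continuity on a total family.\<close>

lemma closed_subspace_continuous:
  fixes U :: "'g::metric_space \<Rightarrow> 'h::complex_hilbert \<Rightarrow> 'h"
  assumes U: "\<And>g. unitary (U g)"
  shows "csubspace {\<xi>. continuous_on UNIV (\<lambda>g. U g \<xi>)}" "closed {\<xi>. continuous_on UNIV (\<lambda>g. U g \<xi>)}"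
proof -
  show "csubspace {\<xi>. continuous_on UNIV (\<lambda>g. U g \<xi>)}"
    unfolding csubspace_def by (auto simp: unitaryD[OF U] intro!: continuous_intros)
  show "closed {\<xi>. continuous_on UNIV (\<lambda>g. U g \<xi>)}"
    unfolding closed_sequential_limits
  proof (intro allI impI, elim conjE)
    fix X \<xi> assume X: "\<forall>n. X n \<in> {\<xi>. continuous_on UNIV (\<lambda>g. U g \<xi>)}" "X \<longlonglongrightarrow> \<xi>"
    have "uniform_limit UNIV (\<lambda>n g. U g (X n)) (\<lambda>g. U g \<xi>) sequentially"
      using X(2) by (simp add: uniform_limit_iff tendsto_iff dist_norm unitaryD(5)[OF U] flip: unitaryD(7)[OF U])
    then have "continuous_on UNIV (\<lambda>g. U g \<xi>)"
      by (rule uniform_limit_theorem[rotated]) (use X(1) in auto)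
    then show "\<xi> \<in> {\<xi>. continuous_on UNIV (\<lambda>g. U g \<xi>)}" by simp
  qed
qed

lemma weyl_rep: "strongly_continuous_unitary_rep weyl"
  unfolding strongly_continuous_unitary_rep_def
proof (intro conjI allI)
  show "weyl (g \<otimes>\<^bsub>heisenberg\<^esub> h) = weyl g \<circ> weyl h" for g h
    by (rule ext) (simp only: heis_mult o_def weyl_mult)
  fix \<xi>
  have "continuous_on UNIV (\<lambda>X. displaced X w)" for w
    unfolding displaced_def
    by (intro continuous_intros continuous_amp continuous_on_compose2[OF continuous_coherent]) auto
  then have "coherent w \<in> {\<xi>. continuous_on UNIV (\<lambda>g. weyl g \<xi>)}" for w by (simp only: weyl(2) mem_Collect_eq)
  then have "\<xi> \<in> {\<xi>. continuous_on UNIV (\<lambda>g. weyl g \<xi>)}"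
    by (rule totalD[OF total_coherent closed_subspace_continuous[OF weyl(1)]])
  then show "continuous_on UNIV (\<lambda>g. weyl g \<xi>)" by simp
qed (rule weyl(1))

interpretation weyl: heis_rep weyl
  by standard (rule weyl_rep)

section \<open>Generators of the displacement group\<close>

definition generator_op :: "heis \<Rightarrow> idx ell2 \<Rightarrow> idx ell2" where
  "generator_op X = fock.evaluate (heis_embed X)"

lemma generator_op_closed: "f \<in> rapidly_decreasing \<Longrightarrow> generator_op X f \<in> rapidly_decreasing"
  unfolding generator_op_def by (rule fock.evaluate_linear(1))

lemma heis_embed_altdef:
  "heis_embed X = (\<Sum>j\<in>UNIV. scalar (complex_of_real (fst X $ j / sqrt 2)) * (adj (gen j) - gen j)
      + scalar (\<i> * complex_of_real (fst (snd X) $ j / sqrt 2)) * (adj (gen j) + gen j))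
    + scalar (\<i> * complex_of_real (snd (snd X)))"
  by (cases X) (simp add: heis_embed_def)

lemma generator_op_eq:
  assumes f: "f \<in> rapidly_decreasing"
  shows "generator_op X f = (\<Sum>l\<in>UNIV. (amp X $ l) *\<^sub>C ladder (l, False) f - cnj (amp X $ l) *\<^sub>C ladder (l, True) f)
    + (\<i> * complex_of_real (snd (snd X))) *\<^sub>C f"
proof -
  have sum: "fock.evaluate (\<Sum>j\<in>I. p j) f = (\<Sum>j\<in>I. fock.evaluate (p j) f)" for p and I :: "3 set"
    by (induction I rule: infinite_finite_induct) (simp_all add: fock.evaluate_add)
  have "fock.evaluate (scalar (complex_of_real (fst X $ j / sqrt 2)) * (adj (gen j) - gen j)
      + scalar (\<i> * complex_of_real (fst (snd X) $ j / sqrt 2)) * (adj (gen j) + gen j)) f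
    = (amp X $ j) *\<^sub>C ladder (j, False) f - cnj (amp X $ j) *\<^sub>C ladder (j, True) f" for j
  proof -
    have e: "amp X $ j = \<i> * complex_of_real (fst (snd X) $ j / sqrt 2) - complex_of_real (fst X $ j / sqrt 2)"
      "cnj (amp X $ j) = - (\<i> * complex_of_real (fst (snd X) $ j / sqrt 2)) - complex_of_real (fst X $ j / sqrt 2)"
      by (simp_all add: amp_def diff_divide_distrib)
    show ?thesis
      unfolding e
      by (intro ell2_eqI)
        (simp add: fock.evaluate_add fock.evaluate_mult[OF f] fock.evaluate_diff fock.evaluate_gen fock.evaluate_scalar
          coord_ell2 coord_scaleC algebra_simps del: of_real_divide)
  qed
  then show ?thesis
    unfolding generator_op_def heis_embed_altdef by (simp add: fock.evaluate_add sum fock.evaluate_scalar)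
qed

lemma generator_op_linear:
  assumes "f \<in> rapidly_decreasing"
  shows "linear (\<lambda>X. generator_op X f)"
proof (rule linearI; rule ell2_eqI)
  fix X Y :: heis and r :: real and n
  have c: "coord (\<Sum>l\<in>I. F l) n = (\<Sum>l\<in>I. coord (F l) n)" for F :: "3 \<Rightarrow> idx ell2" and I
    by (induction I rule: infinite_finite_induct) (simp_all add: coord_ell2)
  show "coord (generator_op (X + Y) f) n = coord (generator_op X f + generator_op Y f) n"
    by (simp add: generator_op_eq[OF assms] coord_ell2 coord_scaleC c amp_linear algebra_simps sum.distrib sum_subtractf)
  show "coord (generator_op (r *\<^sub>R X) f) n = coord (r *\<^sub>R generator_op X f) n"
    by (simp add: generator_op_eq[OF assms] coord_ell2 coord_scaleC coord_scaleR c amp_linear algebra_simps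
        sum_distrib_left scaleR_conv_of_real[where 'a = complex])
qed

lemma adj_heis_embed: "adj (heis_embed X) = - heis_embed X"
proof -
  have sum: "adj (\<Sum>j\<in>I. p j) = (\<Sum>j\<in>I. adj (p j))" for p :: "3 \<Rightarrow> 3 free_star" and I
    by (induction I rule: infinite_finite_induct) (simp_all add: adj_add)
  show ?thesis
    unfolding heis_embed_altdef minus_add_distrib sum_negf[symmetric]
    by (simp add: sum adj_add adj_diff adj_scalar_mult scalar_minus del: of_real_divide)
      (simp add: algebra_simps)
qed

lemma generator_op_skew:
  "f \<in> rapidly_decreasing \<Longrightarrow> g \<in> rapidly_decreasing \<Longrightarrow> cinner (generator_op X f) g = - cinner f (generator_op X g)"
  unfolding generator_op_def
  by (simp add: fock.evaluate_adjoint adj_heis_embed fock.evaluate_minus cinner_minus_right)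

text \<open>Applied to the squared norm of an error, this makes the error itself of smaller order
  than \<open>s\<close>. The mean value theorem gives \<open>f s = s * f' x\<close> with
  \<open>x\<close> between 0 and \<open>s\<close>, and \<open>f' x / x\<close> tends to 0.\<close>

lemma second_order_small:
  fixes f :: "real \<Rightarrow> real"
  assumes f: "\<And>s. (f has_real_derivative f' s) (at s)" "f 0 = 0" and f': "(f' has_real_derivative 0) (at 0)" "f' 0 = 0"
  shows "((\<lambda>s. f s / s\<^sup>2) \<longlongrightarrow> 0) (at 0)"
  unfolding LIM_eq
proof (intro allI impI)
  fix e :: real assume e: "0 < e"
  have "(\<lambda>h. f' h / h) \<midarrow>0\<rightarrow> 0" using f' by (simp add: DERIV_def)
  then obtain d where d: "d > 0" "\<And>h. h \<noteq> 0 \<Longrightarrow> norm (h - 0) < d \<Longrightarrow> norm (f' h / h - 0) < e"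
    using LIM_D[OF \<open>(\<lambda>h. f' h / h) \<midarrow>0\<rightarrow> 0\<close> e] by blast
  have "norm (f s / s\<^sup>2 - 0) < e" if s: "s \<noteq> 0" "norm (s - 0) < d" for s
  proof -
    have "\<exists>x. x \<noteq> 0 \<and> \<bar>x\<bar> < \<bar>s\<bar> \<and> f s = s * f' x"
    proof (cases "s > 0")
      case True
      then obtain x where "0 < x" "x < s" "f s - f 0 = (s - 0) * f' x" using MVT2[of 0 s f f', OF True f(1)] by blast
      then show ?thesis using f(2) by (intro exI[of _ x]) auto
    next
      case False
      then have "s < 0" using s by simp
      then obtain x where "s < x" "x < 0" "f 0 - f s = (0 - s) * f' x" using MVT2[of s 0 f f', OF _ f(1)] by blast
      then show ?thesis using f(2) by (intro exI[of _ x]) auto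
    qed
    then obtain x where x: "x \<noteq> 0" "\<bar>x\<bar> < \<bar>s\<bar>" "f s = s * f' x" by blast
    have "\<bar>f' x\<bar> < e * \<bar>x\<bar>" using d(2)[of x] x s by (simp add: divide_less_eq)
    also have "\<dots> \<le> e * \<bar>s\<bar>" using x e by simp
    finally have "\<bar>f' x\<bar> / \<bar>s\<bar> < e" using s by (simp add: divide_less_eq)
    moreover have "f s / s\<^sup>2 = f' x / s" using x(3) s by (simp add: power2_eq_square)
    ultimately show ?thesis by simp
  qed
  then show "\<exists>d>0. \<forall>s. s \<noteq> 0 \<and> norm (s - 0) < d \<longrightarrow> norm (f s / s\<^sup>2 - 0) < e" using d(1) by blast
qed

lemma has_real_derivative_Re:
  assumes "(G has_field_derivative D) (at (complex_of_real s))"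
  shows "((\<lambda>s. Re (G (complex_of_real s))) has_real_derivative Re D) (at s)"
  using bounded_linear.has_vector_derivative[OF bounded_linear_Re has_vector_derivative_real_field[OF assms]]
  by (simp add: has_real_derivative_iff_has_vector_derivative)

lemma cinner_sum_right: "cinner x (\<Sum>i\<in>I. f i) = (\<Sum>i\<in>I. cinner x (f i :: 'h::complex_hilbert))"
  by (induction I rule: infinite_finite_induct) (simp_all add: cinner_add_right)

text \<open>The squared norm of the first-order error expands by the kernel into the real part of an
  explicit entire function \<open>G\<close>; this function and its first two derivatives vanish at
  0.\<close>

lemma coherent_derivative:
  "((\<lambda>s. coherent (w + s *\<^sub>R a)) has_vector_derivative (\<Sum>l\<in>UNIV. (a $ l) *\<^sub>C ladder (l, False) (coherent w))) (at 0)"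
proof -
  define k where "k = (\<Sum>l\<in>UNIV. (a $ l) *\<^sub>C ladder (l, False) (coherent w))"
  define m b E where "m = hdot w a" and "b = hdot a a" and "E = exp (hdot w w)"
  have cr: "ladder (l, False) (coherent u) \<in> rapidly_decreasing" for l u
    by (rule ladder_rapid[OF coherent_rapid])
  \<comment> \<open>The creation operators in \<open>k\<close> are moved to the other side, where
    the coherent vector is an eigenvector of annihilation; this makes inner products with
    \<open>k\<close> explicit.\<close>
  have kc: "cinner k (coherent v) = hdot a v * exp (hdot w v)" for v
    by (simp add: k_def cinner_sum_left cinner_scaleC_left cinner_scaleC_right ladder_adjoint[OF coherent_rapid coherent_rapid]
        ann_coherent cinner_coherent hdot_def[of a] sum_distrib_right mult.assoc)
  have ann_cre: "ladder (l, True) (ladder (j, False) (coherent w)) =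
      (w $ l) *\<^sub>C ladder (j, False) (coherent w) + (if j = l then coherent w else 0)" for l j
  proof (rule ell2_eqI)
    fix n
    have "coord (ladder (l, True) (coherent w)) = (\<lambda>n. w $ l * coord (coherent w) n)"
      by (simp add: ann_coherent fun_eq_iff coord_scaleC)
    then have "ann l (coord (coherent w)) = (\<lambda>n. w $ l * coord (coherent w) n)"
      by (simp add: coord_ladder[OF coherent_rapid])
    then have "cre j (ann l (coord (coherent w))) n = w $ l * cre j (coord (coherent w)) n"
      by (simp add: cre_def)
    then show "coord (ladder (l, True) (ladder (j, False) (coherent w))) n =
      coord ((w $ l) *\<^sub>C ladder (j, False) (coherent w) + (if j = l then coherent w else 0)) n"
      using cre_ann_commute(1)[of l "coord (coherent w)" n] cre_ann_commute(2)[of l j "coord (coherent w)" n]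
      by (auto simp: coord_ladder[OF cr] coord_ladder[OF coherent_rapid] coord_ell2 coord_scaleC algebra_simps)
  qed
  have ck: "cinner (coherent w) k = m * E"
    using kc[of w] cinner_commute[of "coherent w" k] by (simp add: hdot_simps exp_cnj m_def E_def)
  have E_cnj: "cnj E = E" and b_cnj: "cnj b = b" and m_cnj: "hdot a w = cnj m"
    by (simp_all add: E_def b_def m_def exp_cnj hdot_simps)
  have kk: "cinner k k = (m * cnj m + b) * E"
  proof -
    have cl: "cinner (coherent w) (ladder (j, False) (coherent w)) = w $ j * E" for j
      using ladder_adjoint[OF coherent_rapid coherent_rapid, of j True w w]
      by (simp add: ann_coherent cinner_scaleC_left cinner_coherent E_def)
    have "cinner (ladder (l, False) (coherent w)) (ladder (j, False) (coherent w))
        = (cnj (w $ l) * w $ j + (if l = j then 1 else 0)) * E" for l j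
      using ladder_adjoint[OF coherent_rapid cr, of l False w j w]
      by (auto simp: ann_cre cinner_simps cl cinner_coherent E_def[symmetric] algebra_simps)
    then have "cinner k (ladder (j, False) (coherent w)) = (\<Sum>l\<in>UNIV. a $ l * ((cnj (w $ l) * w $ j + (if l = j then 1 else 0)) * E))" for j
      by (simp add: k_def cinner_sum_left cinner_scaleC_left)
    also have "\<dots> j = (cnj m * w $ j + a $ j) * E" for j
    proof -
      have "a $ l * ((cnj (w $ l) * w $ j + (if l = j then 1 else 0)) * E)
        = a $ l * cnj (w $ l) * (w $ j * E) + (if l = j then a $ j * E else 0)" for l
        by (simp add: algebra_simps)
      then have "(\<Sum>l\<in>UNIV. a $ l * ((cnj (w $ l) * w $ j + (if l = j then 1 else 0)) * E))
        = (\<Sum>l\<in>UNIV. a $ l * cnj (w $ l) * (w $ j * E)) + (\<Sum>l\<in>UNIV. if l = j then a $ j * E else 0)"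
        by (simp only: sum.distrib)
      also have "\<dots> = hdot a w * (w $ j * E) + a $ j * E"
        by (simp only: sum_distrib_right[symmetric] hdot_def[of a w]) simp
      finally show ?thesis by (simp add: m_cnj algebra_simps)
    qed
    finally have kl: "cinner k (ladder (j, False) (coherent w)) = (cnj m * w $ j + a $ j) * E" for j .
    have "cinner k k = (\<Sum>j\<in>UNIV. cnj (a $ j) * ((cnj m * w $ j + a $ j) * E))"
      by (subst (2) k_def) (simp add: cinner_sum_right cinner_scaleC_right kl)
    also have "\<dots> = (\<Sum>j\<in>UNIV. w $ j * cnj (a $ j) * (cnj m * E) + a $ j * cnj (a $ j) * E)"
      by (simp add: algebra_simps)
    also have "\<dots> = hdot w a * (cnj m * E) + hdot a a * E"
      by (simp only: sum.distrib sum_distrib_right[symmetric] hdot_def)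
    finally show ?thesis by (simp add: m_def[symmetric] b_def[symmetric] algebra_simps)
  qed
  \<comment> \<open>The nine inner products in the expansion of \<open>cinner (?D s) (?D s)\<close>,
    with the real parameter replaced by a complex \<open>z\<close> that is never conjugated, so that
    complex differentiation applies.\<close>
  define G where "G z = E * (exp (z * (m + cnj m) + z * z * b) - exp (z * cnj m) - z * (m + z * b) * exp (z * cnj m)
      - exp (z * m) + 1 + z * m - z * (cnj m + z * b) * exp (z * m) + z * cnj m + z * z * (m * cnj m + b))" for z
  define G' where "G' z = E * ((m + cnj m + 2 * z * b) * exp (z * (m + cnj m) + z * z * b) - cnj m * exp (z * cnj m)
      - (m + 2 * z * b) * exp (z * cnj m) - z * (m + z * b) * (cnj m * exp (z * cnj m)) - m * exp (z * m) + m
      - (cnj m + 2 * z * b) * exp (z * m) - z * (cnj m + z * b) * (m * exp (z * m)) + cnj m + 2 * z * (m * cnj m + b))" for z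
  have dG: "(G has_field_derivative G' z) (at z)" for z
    unfolding G_def G'_def by (rule DERIV_cong, (rule derivative_intros)+) (simp add: algebra_simps)
  have dG': "(G' has_field_derivative 0) (at 0)"
    unfolding G'_def by (rule DERIV_cong, (rule derivative_intros)+) (simp, simp add: algebra_simps)
  let ?D = "\<lambda>s. coherent (w + s *\<^sub>R a) - coherent w - s *\<^sub>R k"
  have N: "(norm (?D s))\<^sup>2 = Re (G (complex_of_real s))" for s
  proof -
    let ?z = "complex_of_real s" and ?u = "coherent (w + s *\<^sub>R a)"
    have uu: "cinner ?u ?u = E * exp (?z * (m + cnj m) + ?z * ?z * b)"
      by (simp add: cinner_coherent hdot_simps hdot_scaleR m_cnj E_def mult_exp_exp algebra_simps flip: m_def b_def)
    have uc: "cinner ?u (coherent w) = E * exp (?z * cnj m)"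
      by (simp add: cinner_coherent hdot_simps hdot_scaleR m_cnj E_def mult_exp_exp)
    have cu: "cinner (coherent w) ?u = E * exp (?z * m)"
      by (simp add: cinner_coherent hdot_simps hdot_scaleR E_def mult_exp_exp flip: m_def)
    have ku: "cinner k ?u = (cnj m + ?z * b) * (E * exp (?z * m))"
      by (simp add: kc hdot_simps hdot_scaleR m_cnj E_def mult_exp_exp flip: m_def b_def)
    have uk: "cinner ?u k = (m + ?z * b) * (E * exp (?z * cnj m))"
      using cinner_commute[of ?u k] by (simp add: ku E_cnj b_cnj exp_cnj)
    have kc': "cinner k (coherent w) = cnj m * E" using kc[of w] by (simp add: m_cnj E_def)
    have cc: "cinner (coherent w) (coherent w) = E" by (simp add: cinner_coherent E_def)
    have sr: "s *\<^sub>R k = ?z *\<^sub>C k" by (simp add: scaleC_of_real)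
    have "cinner (?D s) (?D s) = G ?z"
      unfolding sr G_def cinner_simps uu uc cu ku uk kc' cc ck kk by (simp add: algebra_simps)
    then show ?thesis by (simp only: norm_eq_Re_cinner)
  qed
  have small: "((\<lambda>s. Re (G (complex_of_real s)) / s\<^sup>2) \<longlongrightarrow> 0) (at 0)"
  proof (rule second_order_small[where f' = "\<lambda>s. Re (G' (complex_of_real s))"])
    show "((\<lambda>s. Re (G (complex_of_real s))) has_real_derivative Re (G' (complex_of_real s))) (at s)" for s
      by (rule has_real_derivative_Re[OF dG])
    show "((\<lambda>s. Re (G' (complex_of_real s))) has_real_derivative 0) (at 0)"
      using has_real_derivative_Re[of G' 0 0] dG' by simp
  qed (simp_all add: G_def G'_def)
  have "((\<lambda>s. sqrt (Re (G (complex_of_real s)) / s\<^sup>2)) \<longlongrightarrow> sqrt 0) (at 0)"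
    by (rule tendsto_real_sqrt[OF small])
  moreover have "sqrt (Re (G (complex_of_real s)) / s\<^sup>2) = norm (?D s) / norm s" for s
    unfolding N[symmetric] by (simp add: real_sqrt_divide)
  ultimately show ?thesis
    unfolding has_vector_derivative_def has_derivative_at k_def[symmetric]
    by (simp add: bounded_linear_scaleR_left)
qed

lemma generator_op_scale: "f \<in> rapidly_decreasing \<Longrightarrow> generator_op X (c *\<^sub>C f) = c *\<^sub>C generator_op X f"
  unfolding generator_op_def by (rule fock.evaluate_linear(3))

lemma weyl_coherent_derivative:
  "((\<lambda>s. weyl (s *\<^sub>R X) (coherent w)) has_vector_derivative generator_op X (coherent w)) (at 0)"
proof -
  define a m b t where "a = amp X" and "m = hdot w a" and "b = hdot a a" and "t = complex_of_real (snd (snd X))"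
  define k where "k = (\<Sum>l\<in>UNIV. (a $ l) *\<^sub>C ladder (l, False) (coherent w))"
  have W: "weyl (s *\<^sub>R X) (coherent w) = exp (of_real s * (\<i> * t - m) - of_real s * of_real s * b / 2) *\<^sub>C coherent (w + s *\<^sub>R a)" for s
    by (simp add: weyl displaced_def amp_linear hdot_scaleR a_def[symmetric] m_def[symmetric] b_def[symmetric] t_def algebra_simps)
  have "((\<lambda>z. exp (z * (\<i> * t - m) - z * z * b / 2)) has_field_derivative (\<i> * t - m)) (at (complex_of_real 0))"
    by (auto intro!: derivative_eq_intros)
  from has_vector_derivative_real_field[OF this, of UNIV]
  have e: "((\<lambda>s. exp (of_real s * (\<i> * t - m) - of_real s * of_real s * b / 2)) has_vector_derivative (\<i> * t - m)) (at 0)"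
    by simp
  have "((\<lambda>s. weyl (s *\<^sub>R X) (coherent w)) has_vector_derivative k + (\<i> * t - m) *\<^sub>C coherent w) (at 0)"
    unfolding W using bounded_bilinear.has_vector_derivative[OF bounded_bilinear_scaleC e coherent_derivative[of w a]]
    by (simp add: k_def)
  moreover have "generator_op X (coherent w) = k + (\<i> * t - m) *\<^sub>C coherent w"
  proof -
    have "(\<Sum>l\<in>UNIV. cnj (a $ l) *\<^sub>C ladder (l, True) (coherent w)) = m *\<^sub>C coherent w"
    proof -
      have "(\<Sum>l\<in>I. c l *\<^sub>C x) = (\<Sum>l\<in>I. c l) *\<^sub>C (x :: idx ell2)" for c x and I :: "3 set"
        by (induction I rule: infinite_finite_induct) (simp_all add: scaleC_add_left)
      then show ?thesis by (simp add: ann_coherent scaleC_scaleC m_def hdot_def mult.commute)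
    qed
    moreover have "(u - v) *\<^sub>C x = u *\<^sub>C x - v *\<^sub>C x" for u v and x :: "idx ell2"
      using scaleC_add_left[of u "- v" x] by (simp add: scaleC_minus_left)
    ultimately show ?thesis
      by (simp add: generator_op_eq[OF coherent_rapid] a_def[symmetric] t_def[symmetric] sum_subtractf k_def)
  qed
  ultimately show ?thesis by simp
qed

lemma displaced_rapid: "displaced X w \<in> rapidly_decreasing"
  unfolding displaced_def by (rule csubspaceD(3)[OF csubspace_rapidly_decreasing coherent_rapid])

text \<open>A displaced coherent vector is a multiple of a coherent vector, so the derivative at 0
  is available at every point of the curve.\<close>

lemma weyl_coherent_derivative_at:
  "((\<lambda>s. weyl (s *\<^sub>R X) (coherent w)) has_vector_derivative generator_op X (displaced (r *\<^sub>R X) w)) (at r)"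
proof -
  obtain c v where d: "displaced (r *\<^sub>R X) w = c *\<^sub>C coherent v" unfolding displaced_def by blast
  have "((\<lambda>s. weyl (s *\<^sub>R X) (displaced (r *\<^sub>R X) w)) has_vector_derivative generator_op X (displaced (r *\<^sub>R X) w)) (at 0)"
    unfolding d unitaryD(2)[OF weyl(1)] generator_op_scale[OF coherent_rapid]
    by (rule bounded_linear.has_vector_derivative[OF bounded_linear_scaleC weyl_coherent_derivative])
  moreover have "((\<lambda>s. s - r) has_vector_derivative 1) (at r)" by (auto intro!: derivative_eq_intros)
  ultimately have "((\<lambda>s. weyl ((s - r) *\<^sub>R X) (displaced (r *\<^sub>R X) w)) has_vector_derivative generator_op X (displaced (r *\<^sub>R X) w)) (at r)"
    using vector_diff_chain_at[of "\<lambda>s. s - r" 1 r "\<lambda>s. weyl (s *\<^sub>R X) (displaced (r *\<^sub>R X) w)"] by (simp add: o_def)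
  then show ?thesis by (simp add: weyl(2)[symmetric] weyl.U_line)
qed

text \<open>Tested against coherent vectors the derivative is known; integrating the strongly continuous
  curve \<open>weyl (s X) (generator_op X f)\<close> turns this into a strong derivative.\<close>

lemma weyl_derivative:
  assumes f: "f \<in> rapidly_decreasing"
  shows "((\<lambda>s. weyl (s *\<^sub>R X) f) has_vector_derivative generator_op X f) (at 0)"
proof -
  define g where "g s = weyl (s *\<^sub>R X) (generator_op X f)" for s
  have gc: "continuous_on S g" for S
    unfolding g_def by (rule continuous_on_compose2[OF weyl.U_continuous]) (auto intro!: continuous_intros)
  \<comment> \<open>The primitive starts at \<open>- 1\<close>, so that 0 is an interior point and a
    two-sided derivative results.\<close>
  define Y where "Y s = integral {-1..s} g" for s
  have Y: "(Y has_vector_derivative g s) (at s within {-1..1})" if "s \<in> {-1..1}" for s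
    unfolding Y_def by (rule integral_has_vector_derivative[OF gc that])
  \<comment> \<open>The group element is moved onto the coherent vector, where the derivative is
    known; skewness of the generator then moves it back to \<open>f\<close>.\<close>
  have weak: "((\<lambda>s. cinner (weyl (s *\<^sub>R X) f) (coherent w)) has_vector_derivative cinner (g s) (coherent w)) (at s)" for s w
  proof -
    have "((\<lambda>s. cinner f (weyl (s *\<^sub>R (- X)) (coherent w))) has_vector_derivative
        cinner f (generator_op (- X) (displaced (s *\<^sub>R (- X)) w))) (at s)"
      by (rule bounded_linear.has_vector_derivative[OF bounded_bilinear.bounded_linear_right[OF bounded_bilinear_cinner]
            weyl_coherent_derivative_at])
    moreover have "cinner f (generator_op (- X) (displaced (s *\<^sub>R (- X)) w)) = cinner (g s) (coherent w)"
    proof -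
      have "generator_op (- X) h = - generator_op X h" if "h \<in> rapidly_decreasing" for h
        using linear_neg[OF generator_op_linear[OF that], of X] by simp
      then have "cinner f (generator_op (- X) (displaced (s *\<^sub>R (- X)) w)) = cinner (generator_op X f) (displaced (s *\<^sub>R (- X)) w)"
        by (simp add: generator_op_skew[OF f] displaced_rapid cinner_minus_right)
      then show ?thesis by (simp add: g_def weyl.U_adjoint weyl(2))
    qed
    ultimately show ?thesis by (simp add: weyl.U_adjoint)
  qed
  have const: "weyl (s *\<^sub>R X) f - Y s = weyl (0 *\<^sub>R X) f - Y 0" if s: "s \<in> {-1..1}" for s
  proof -
    have "cinner (weyl (s *\<^sub>R X) f - Y s - (weyl (0 *\<^sub>R X) f - Y 0)) (coherent w) = 0" for w
    proof -
      let ?h = "\<lambda>s. cinner (weyl (s *\<^sub>R X) f) (coherent w) - cinner (Y s) (coherent w)"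
      have "(?h has_vector_derivative 0) (at s within {-1..1})" if "s \<in> {-1..1}" for s
        using has_vector_derivative_diff[OF has_vector_derivative_at_within[OF weak[where s = s and w = w]]
          bounded_linear.has_vector_derivative[OF bounded_linear_cinner_left[where b = "coherent w"] Y[OF that]]] by simp
      then obtain c where c: "\<And>s. s \<in> {-1..1} \<Longrightarrow> ?h s = c"
        using has_vector_derivative_zero_constant[of "{-1..1}" ?h] by auto
      have "?h s = ?h 0" using c[OF s] c[of 0] by simp
      then show ?thesis by (simp add: cinner_diff_left)
    qed
    then have "weyl (s *\<^sub>R X) f - Y s - (weyl (0 *\<^sub>R X) f - Y 0) = 0" by (rule total_orth[OF total_coherent])
    then show ?thesis by simp
  qed
  have "(Y has_vector_derivative g 0) (at 0)"
    using Y[of 0] by (simp add: at_within_Icc_at)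
  then have "((\<lambda>s. Y s + (weyl (0 *\<^sub>R X) f - Y 0)) has_vector_derivative g 0) (at 0)"
    by (auto intro!: derivative_eq_intros)
  moreover have "Y s + (weyl (0 *\<^sub>R X) f - Y 0) = weyl (s *\<^sub>R X) f" if "s \<in> {-1<..<1}" for s
    using const[of s] that by (simp add: algebra_simps)
  ultimately have "((\<lambda>s. weyl (s *\<^sub>R X) f) has_vector_derivative g 0) (at 0)"
    using has_vector_derivative_transform_within_open[of "\<lambda>s. Y s + (weyl (0 *\<^sub>R X) f - Y 0)" "g 0" 0 "{-1<..<1}"]
    by simp
  then show ?thesis by (simp add: g_def)
qed

lemma rapidly_decreasing_smooth: "rapidly_decreasing \<subseteq> smooth_vectors weyl"
  by (rule weyl.smooth_vectorsI[where T = generator_op])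
    (simp_all add: generator_op_closed generator_op_linear weyl_derivative)

lemma differential_weyl: "f \<in> rapidly_decreasing \<Longrightarrow> differential weyl X f = generator_op X f"
  unfolding differential_def by (rule vector_derivative_at[OF weyl_derivative])

section \<open>Smooth vectors of the displacement group\<close>

definition basis_vec :: "idx \<Rightarrow> idx ell2" where
  "basis_vec n = Abs_ell2 (\<lambda>m. if m = n then 1 else 0)"

lemma rapid_delta: "rapid (\<lambda>m. if m = n then 1 else 0)"
  unfolding rapid_def
proof
  fix k
  have "(1 + real (degree m)) ^ k * cmod (if m = n then 1 else 0) \<le> (1 + real (degree n)) ^ k" for m
    by simp
  then show "\<exists>B. \<forall>m. (1 + real (degree m)) ^ k * cmod (if m = n then 1 else 0) \<le> B" by blast
qed

lemma coord_basis_vec: "coord (basis_vec n) = (\<lambda>m. if m = n then 1 else 0)"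
  by (simp only: basis_vec_def coord_Abs_rapid[OF rapid_delta])

lemma basis_vec_rapid: "basis_vec n \<in> rapidly_decreasing"
  unfolding rapidly_decreasing_iff coord_basis_vec by (rule rapid_delta)

lemma cinner_basis_vec: "cinner f (basis_vec n) = coord f n"
proof -
  have "cinner f (basis_vec n) = infsum (\<lambda>m. coord f m * cnj (if m = n then 1 else 0)) {n}"
    unfolding cinner_ell2_def coord_basis_vec by (rule infsum_cong_neutral) auto
  then show ?thesis by simp
qed

lemma ladder_basis_vec:
  "ladder (l, False) (basis_vec n) = complex_of_real (sqrt (real (occ l n) + 1)) *\<^sub>C basis_vec (up l n)"
  "ladder (l, True) (basis_vec n) = complex_of_real (sqrt (real (occ l n))) *\<^sub>C basis_vec (down l n)"
proof (rule_tac [!] ell2_eqI)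
  fix m
  have "occ l m = 0 \<or> (down l m = n \<longleftrightarrow> m = up l n)" using up_down[of l m] by auto
  then show "coord (ladder (l, False) (basis_vec n)) m =
      coord (complex_of_real (sqrt (real (occ l n) + 1)) *\<^sub>C basis_vec (up l n)) m"
    by (auto simp: coord_ladder[OF basis_vec_rapid] coord_basis_vec coord_scaleC cre_def occ_up add.commute)
  have "up l m = n \<longleftrightarrow> occ l n \<noteq> 0 \<and> m = down l n" using up_down[of l n] by (auto simp: occ_up)
  then show "coord (ladder (l, True) (basis_vec n)) m =
      coord (complex_of_real (sqrt (real (occ l n))) *\<^sub>C basis_vec (down l n)) m"
    by (auto simp: coord_ladder[OF basis_vec_rapid] coord_basis_vec coord_scaleC ann_def occ_down of_nat_diff)
qed

lemma coord_le_norm: "cmod (coord f n) \<le> norm (f :: 'i ell2)"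
  using L2_set_le_norm_ell2[of "{n}" f] by simp

lemma (in heis_rep) csubspace_smooth_vectors: "csubspace (smooth_vectors U)"
proof -
  have "C_k k (\<lambda>g::heis. 0::'h)" for k by (induction k) simp_all
  then show ?thesis
    unfolding csubspace_def smooth_vectors_def
    by (auto simp: U_simps(1,2,6) intro: C_k_add C_k_linear[OF bounded_linear_scaleC])
qed

text \<open>The derivative is tested against basis vectors, which are rapidly decreasing. The
  formula therefore holds for a smooth \<open>f\<close> whose decay is not yet known, with
  \<open>cre\<close> and \<open>ann\<close> acting on its bare coordinates.\<close>

lemma coord_differential_weyl:
  assumes f: "f \<in> smooth_vectors weyl"
  shows "coord (differential weyl X f) n =
    (\<Sum>l\<in>UNIV. amp X $ l * cre l (coord f) n - cnj (amp X $ l) * ann l (coord f) n)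
    + \<i> * complex_of_real (snd (snd X)) * coord f n"
proof -
  let ?e = "basis_vec n"
  have neg: "generator_op (- X) ?e = - generator_op X ?e"
    by (rule linear_neg[OF generator_op_linear[OF basis_vec_rapid]])
  have "((\<lambda>s. cinner (weyl (s *\<^sub>R X) f) ?e) has_vector_derivative cinner (differential weyl X f) ?e) (at 0)"
    by (rule bounded_linear.has_vector_derivative[OF bounded_linear_cinner_left weyl.smooth_differential(1)[OF f]])
  moreover have "((\<lambda>s. cinner f (weyl (s *\<^sub>R (- X)) ?e)) has_vector_derivative cinner f (generator_op (- X) ?e)) (at 0)"
    by (rule bounded_linear.has_vector_derivative[OF bounded_bilinear.bounded_linear_right[OF bounded_bilinear_cinner]
          weyl_derivative[OF basis_vec_rapid]])
  then have "((\<lambda>s. cinner (weyl (s *\<^sub>R X) f) ?e) has_vector_derivative cinner f (generator_op (- X) ?e)) (at 0)"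
    by (simp add: weyl.U_adjoint)
  ultimately have "coord (differential weyl X f) n = - cinner f (generator_op X ?e)"
    unfolding neg cinner_minus_right cinner_basis_vec by (rule vector_derivative_unique_at)
  also have "cinner f (generator_op X ?e) =
      (\<Sum>l\<in>UNIV. cnj (amp X $ l) * ann l (coord f) n - amp X $ l * cre l (coord f) n)
      - \<i> * complex_of_real (snd (snd X)) * coord f n"
    by (simp add: generator_op_eq[OF basis_vec_rapid] cinner_sum_right cinner_simps ladder_basis_vec
        cinner_basis_vec ann_def cre_def mult.assoc)
  finally show ?thesis by (simp add: sum_subtractf)
qed

text \<open>The directions of one \<open>p\<close> and one \<open>q\<close> coordinate give
  multiples of the difference and of the sum of \<open>ann\<close> and \<open>cre\<close>; complex
  combinations recover both.\<close>

lemma smooth_ladder: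
  assumes f: "f \<in> smooth_vectors weyl"
  shows "\<exists>g\<in>smooth_vectors weyl. coord g = ann l (coord f)" "\<exists>g\<in>smooth_vectors weyl. coord g = cre l (coord f)"
proof -
  let ?c = "1 / complex_of_real (sqrt 2)"
  define dp dq where "dp = differential weyl (axis l 1, 0, 0) f" and "dq = differential weyl (0, axis l 1, 0) f"
  have s: "complex_of_real (sqrt 2) * complex_of_real (sqrt 2) = 2" by (simp flip: of_real_mult)
  have p: "amp (axis l 1, 0, 0) $ m = (if m = l then - ?c else 0)"
    and q: "amp (0, axis l 1, 0) $ m = (if m = l then \<i> * ?c else 0)" for m
    by (auto simp: amp_def axis_def)
  have dp: "coord dp n = ?c * (ann l (coord f) n - cre l (coord f) n)" for n
  proof -
    have "amp (axis l 1, 0, 0) $ m * cre m (coord f) n - cnj (amp (axis l 1, 0, 0) $ m) * ann m (coord f) n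
      = (if m = l then ?c * (ann l (coord f) n - cre l (coord f) n) else 0)" for m
      unfolding p by (simp add: algebra_simps)
    then show ?thesis unfolding dp_def coord_differential_weyl[OF f] by simp
  qed
  have dq: "coord dq n = \<i> * ?c * (ann l (coord f) n + cre l (coord f) n)" for n
  proof -
    have "amp (0, axis l 1, 0) $ m * cre m (coord f) n - cnj (amp (0, axis l 1, 0) $ m) * ann m (coord f) n
      = (if m = l then \<i> * ?c * (ann l (coord f) n + cre l (coord f) n) else 0)" for m
      unfolding q by (simp add: algebra_simps)
    then show ?thesis unfolding dq_def coord_differential_weyl[OF f] by simp
  qed
  have sm: "dp \<in> smooth_vectors weyl" "dq \<in> smooth_vectors weyl"
    unfolding dp_def dq_def by (rule weyl.smooth_differential(2)[OF f])+
  note sub = csubspaceD[OF weyl.csubspace_smooth_vectors]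
  have "coord (?c *\<^sub>C dp - (\<i> * ?c) *\<^sub>C dq) n = (?c * ?c + ?c * ?c) * ann l (coord f) n" for n
    by (simp add: coord_ell2 coord_scaleC dp dq del: times_divide_eq_right times_divide_eq_left mult_1_left mult_1_right)
      (simp add: algebra_simps)
  then have "coord (?c *\<^sub>C dp - (\<i> * ?c) *\<^sub>C dq) = ann l (coord f)" by (simp add: s fun_eq_iff del: split_paired_All)
  then show "\<exists>g\<in>smooth_vectors weyl. coord g = ann l (coord f)"
    by (rule bexI) (intro sub sm)
  have "coord ((- ?c) *\<^sub>C dp - (\<i> * ?c) *\<^sub>C dq) n = (?c * ?c + ?c * ?c) * cre l (coord f) n" for n
    by (simp add: coord_ell2 coord_scaleC dp dq del: times_divide_eq_right times_divide_eq_left mult_1_left mult_1_right)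
      (simp add: algebra_simps)
  then have "coord ((- ?c) *\<^sub>C dp - (\<i> * ?c) *\<^sub>C dq) = cre l (coord f)" by (simp add: s fun_eq_iff del: split_paired_All)
  then show "\<exists>g\<in>smooth_vectors weyl. coord g = cre l (coord f)"
    by (rule bexI) (intro sub sm)
qed

text \<open>Smooth vectors are stable under the number operators \<open>cre l \<circ> ann l\<close>, which multiply
  by the coordinates of the index.\<close>

lemma smooth_rapidly_decreasing: "smooth_vectors weyl \<subseteq> rapidly_decreasing"
proof
  fix f assume f: "f \<in> smooth_vectors weyl"
  have number: "\<exists>h\<in>smooth_vectors weyl. \<forall>n. coord h n = (1 + complex_of_real (real (degree n))) * coord g n"
    if g: "g \<in> smooth_vectors weyl" for g
  proof -
    have "\<exists>h\<in>smooth_vectors weyl. coord h = (\<lambda>n. complex_of_real (real (occ l n)) * coord g n)" for l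
    proof -
      obtain k where k: "k \<in> smooth_vectors weyl" "coord k = ann l (coord g)" using smooth_ladder(1)[OF g] by blast
      obtain h where h: "h \<in> smooth_vectors weyl" "coord h = cre l (coord k)" using smooth_ladder(2)[OF k(1)] by blast
      have "coord h = (\<lambda>n. complex_of_real (real (occ l n)) * coord g n)" by (simp add: h(2) k(2) cre_ann fun_eq_iff)
      then show ?thesis using h(1) by blast
    qed
    note occ = this
    obtain h1 h2 h3 where h: "h1 \<in> smooth_vectors weyl" "coord h1 = (\<lambda>n. complex_of_real (real (occ 1 n)) * coord g n)"
      "h2 \<in> smooth_vectors weyl" "coord h2 = (\<lambda>n. complex_of_real (real (occ 2 n)) * coord g n)"
      "h3 \<in> smooth_vectors weyl" "coord h3 = (\<lambda>n. complex_of_real (real (occ 3 n)) * coord g n)"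
      using occ[of 1] occ[of 2] occ[of 3] by blast
    have "coord (g + h1 + h2 + h3) n = (1 + complex_of_real (real (degree n))) * coord g n" for n
      by (simp add: coord_ell2 h degree_def algebra_simps)
    moreover have "g + h1 + h2 + h3 \<in> smooth_vectors weyl"
      by (intro csubspaceD(2)[OF weyl.csubspace_smooth_vectors] g h)
    ultimately show ?thesis by blast
  qed
  have "\<exists>h\<in>smooth_vectors weyl. \<forall>n. coord h n = (1 + complex_of_real (real (degree n))) ^ m * coord f n" for m
  proof (induction m)
    case 0
    then show ?case using f by auto
  next
    case (Suc m)
    then obtain g where g: "g \<in> smooth_vectors weyl" "\<And>n. coord g n = (1 + complex_of_real (real (degree n))) ^ m * coord f n"
      by blast
    show ?case using number[OF g(1)] by (simp add: g(2) mult.assoc)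
  qed
  note powers = this
  show "f \<in> rapidly_decreasing"
    unfolding rapidly_decreasing_iff rapid_def
  proof
    fix m
    \<comment> \<open>A coordinate is bounded by the norm, so \<open>norm h\<close> serves as the
      constant for exponent \<open>m\<close>.\<close>
    obtain h where h: "\<And>n. coord h n = (1 + complex_of_real (real (degree n))) ^ m * coord f n" using powers[of m] by blast
    have "cmod ((1 + complex_of_real (real (degree n))) ^ m) = (1 + real (degree n)) ^ m" for n
    proof -
      have "(1 + complex_of_real (real (degree n))) ^ m = complex_of_real ((1 + real (degree n)) ^ m)" by simp
      then show ?thesis by (simp only: norm_of_real) simp
    qed
    then have "(1 + real (degree n)) ^ m * cmod (coord f n) \<le> norm h" for n
      using coord_le_norm[of h n] by (simp add: h norm_mult)
    then show "\<exists>B. \<forall>n. (1 + real (degree n)) ^ m * cmod (coord f n) \<le> B" by blast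
  qed
qed

definition fock_rep :: "3 free_star set \<Rightarrow> idx ell2 \<Rightarrow> idx ell2" where
  "fock_rep = fock.represent ccr_relations"

lemma fock_rep_cls: "f \<in> rapidly_decreasing \<Longrightarrow> fock_rep (cls ccr_relations p) f = fock.evaluate p f"
  unfolding fock_rep_def by (rule fock.represent_cls[OF fock_relations])

lemma star_rep_fock: "star_rep ccr_algebra rapidly_decreasing fock_rep"
  unfolding fock_rep_def ccr_algebra_def by (rule fock.star_rep_represent[OF fock_relations])

lemma smooth_vectors_weyl: "smooth_vectors weyl = rapidly_decreasing"
  using rapidly_decreasing_smooth smooth_rapidly_decreasing by (rule subset_antisym[rotated])

lemma integrable_fock: "integrable_rep rapidly_decreasing fock_rep"
  unfolding integrable_rep_def
  by (intro conjI star_rep_fock exI[of _ weyl] weyl_rep)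
    (simp_all add: smooth_vectors_weyl fock_rep_cls differential_weyl generator_op_def)

section \<open>Irreducibility\<close>

lemma basis_vec_in_invariant:
  assumes E: "csubspace E" and vac: "basis_vec (0, 0, 0) \<in> E" and inv: "\<And>l f. f \<in> E \<Longrightarrow> ladder (l, False) f \<in> E"
  shows "basis_vec n \<in> E"
proof (induction "degree n" arbitrary: n)
  case 0
  then have "n = (0, 0, 0)" by (cases n) (simp add: degree_def occ_def)
  then show ?case using vac by simp
next
  case (Suc d)
  then have "\<exists>l. occ l n \<noteq> 0" by - (rule ccontr, simp add: degree_def)
  then obtain l where l: "occ l n \<noteq> 0" by blast
  define m where "m = down l n"
  have n: "n = up l m" by (simp add: m_def up_down[OF l])
  have "basis_vec m \<in> E" using Suc by (simp add: n degree_up)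
  then have "(1 / complex_of_real (sqrt (real (occ l m) + 1))) *\<^sub>C ladder (l, False) (basis_vec m) \<in> E"
    by (intro csubspaceD(3)[OF E] inv)
  moreover have "complex_of_real (sqrt (real (occ l m) + 1)) \<noteq> 0"
    by (simp add: add_nonneg_eq_0_iff)
  ultimately show ?case by (simp add: ladder_basis_vec scaleC_scaleC n[symmetric])
qed

text \<open>Any coordinate other than that of the vacuum is read off, with a nonzero factor, by some
  annihilation operator at a lowered index.\<close>

lemma killed_by_ann:
  assumes f: "f \<in> rapidly_decreasing" and 0: "\<And>l. ladder (l, True) f = 0"
  shows "f = coord f (0, 0, 0) *\<^sub>C basis_vec (0, 0, 0)"
proof (rule ell2_eqI)
  fix n
  show "coord f n = coord (coord f (0, 0, 0) *\<^sub>C basis_vec (0, 0, 0)) n"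
  proof (cases "n = (0, 0, 0)")
    case False
    have "occ l (0, 0, 0) = 0" for l by (simp add: occ_def)
    then have "\<exists>l. occ l n \<noteq> 0"
      using idx_eqI[of n "(0, 0, 0)"] False by metis
    then obtain l where l: "occ l n \<noteq> 0" by blast
    have "ann l (coord f) (down l n) = 0"
      using 0[of l] coord_ladder(1)[OF f, of l] by (metis coord_ell2(1))
    moreover have "sqrt (real (occ l (down l n)) + 1) \<noteq> 0" by (simp add: add_nonneg_eq_0_iff)
    ultimately show ?thesis using False by (simp add: ann_def up_down[OF l] coord_scaleC coord_basis_vec)
  qed (simp add: coord_scaleC coord_basis_vec)
qed

lemma ladder_irreducible:
  assumes D: "csubspace D1" "csubspace D2" and orth: "\<And>f g. f \<in> D1 \<Longrightarrow> g \<in> D2 \<Longrightarrow> cinner f g = 0"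
    and sum: "rapidly_decreasing = {f + g |f g. f \<in> D1 \<and> g \<in> D2}"
    and inv: "\<And>x f. f \<in> D1 \<Longrightarrow> ladder x f \<in> D1" "\<And>x f. f \<in> D2 \<Longrightarrow> ladder x f \<in> D2"
  shows "D1 = {0} \<or> D2 = {0}"
proof -
  let ?e = "basis_vec (0, 0, 0)"
  have sub: "D1 \<subseteq> rapidly_decreasing" "D2 \<subseteq> rapidly_decreasing"
  proof -
    have "f + 0 \<in> rapidly_decreasing" if "f \<in> D1" for f unfolding sum using that csubspaceD(1)[OF D(2)] by blast
    then show "D1 \<subseteq> rapidly_decreasing" by auto
    have "0 + f \<in> rapidly_decreasing" if "f \<in> D2" for f unfolding sum using that csubspaceD(1)[OF D(1)] by blast
    then show "D2 \<subseteq> rapidly_decreasing" by auto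
  qed
  obtain f g where fg: "f \<in> D1" "g \<in> D2" "?e = f + g"
    using basis_vec_rapid[of "(0, 0, 0)"] unfolding sum by blast
  \<comment> \<open>Annihilation maps the two components of the vacuum to opposite vectors in
    orthogonal subspaces, so both images vanish and each component is a multiple of the
    vacuum.\<close>
  have kill: "ladder (l, True) f = 0 \<and> ladder (l, True) g = 0" for l
  proof -
    have "ladder (l, True) f + ladder (l, True) g = ladder (l, True) ?e"
      unfolding fg(3) by (rule fock.T_add[symmetric]) (use fg(1,2) sub in blast)+
    also have "\<dots> = 0" by (simp add: ladder_basis_vec occ_def)
    finally have eq: "ladder (l, True) f = - ladder (l, True) g" by (simp add: eq_neg_iff_add_eq_0)
    have "cinner (ladder (l, True) f) (ladder (l, True) g) = 0" by (intro orth inv fg)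
    then have "ladder (l, True) g = 0" by (simp add: eq cinner_minus_left)
    then show ?thesis using eq by simp
  qed
  \<comment> \<open>If one summand contains a nonzero multiple of the vacuum, creation operators
    produce all basis vectors in it, and a vector orthogonal to these is 0.\<close>
  have all: "E = {0}" if E: "csubspace E" and E': "csubspace E'" "\<And>l h. h \<in> E' \<Longrightarrow> ladder (l, False) h \<in> E'"
    and e: "h \<in> E'" "h = c *\<^sub>C ?e" "h \<noteq> 0" and o: "\<And>h k. h \<in> E' \<Longrightarrow> k \<in> E \<Longrightarrow> cinner k h = 0" for E E' h c
  proof -
    have c: "c \<noteq> 0" using e(2,3) by auto
    have "?e = (1 / c) *\<^sub>C h" using c by (simp add: e(2) scaleC_scaleC)
    then have "?e \<in> E'" using csubspaceD(3)[OF E'(1) e(1)] by simp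
    then have b: "basis_vec n \<in> E'" for n by (rule basis_vec_in_invariant[OF E'(1) _ E'(2)])
    have "k = 0" if "k \<in> E" for k
    proof (rule ell2_eqI)
      fix n show "coord k n = coord 0 n"
        using o[OF b that, of n] by (simp add: cinner_basis_vec coord_ell2)
    qed
    then show ?thesis using csubspaceD(1)[OF E] by blast
  qed
  have orth': "cinner k h = 0" if "h \<in> D1" "k \<in> D2" for h k
    using orth[OF that] cinner_commute[of k h] by simp
  show ?thesis
  proof (cases "f = 0")
    case False
    have "f = coord f (0, 0, 0) *\<^sub>C ?e" by (rule killed_by_ann) (use fg(1) sub kill in blast)+
    from all[OF D(2) D(1) inv(1) fg(1) this False orth'] show ?thesis by blast
  next
    case True
    have "?e \<noteq> 0"
    proof
      assume "?e = 0"
      then have "coord ?e (0, 0, 0) = coord (0 :: idx ell2) (0, 0, 0)" by simp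
      then show False by (simp add: coord_basis_vec coord_ell2)
    qed
    then have "g \<noteq> 0" using fg(3) True by simp
    have "g = coord g (0, 0, 0) *\<^sub>C ?e" by (rule killed_by_ann) (use fg(2) sub kill in blast)+
    from all[OF D(1) D(2) inv(2) fg(2) this \<open>g \<noteq> 0\<close> orth] show ?thesis by blast
  qed
qed

section \<open>The representation on the tensor cube\<close>

lemma tensor3_ladder:
  "tensor3 creation id id F n = cre 1 F n" "tensor3 id creation id F n = cre 2 F n" "tensor3 id id creation F n = cre 3 F n"
  "tensor3 annihilation id id F n = ann 1 F n" "tensor3 id annihilation id F n = ann 2 F n"
  "tensor3 id (creation \<circ> creation) id F n = cre 2 (cre 2 F) n"
  "tensor3 annihilation creation id F n = ann 1 (cre 2 F) n"
  "tensor3 (annihilation \<circ> annihilation) id id F n = ann 1 (ann 1 F) n"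
  by (cases n; simp add: tensor3_def creation_def annihilation_def cre_def ann_def occ_def up_def down_def add.commute)+

context iso_parameters
begin

definition pi_rep :: "generator free_star set \<Rightarrow> idx ell2 \<Rightarrow> idx ell2" where
  "pi_rep X = fock_rep (phi X)"

lemma pi_rep_cls: "f \<in> rapidly_decreasing \<Longrightarrow> pi_rep (cls (A_relations x1 x2) p) f = fock.evaluate (free_hom forward p) f"
  by (simp add: pi_rep_def phi_cls fock_rep_cls)

lemma star_rep_pi: "star_rep (A_algebra x1 x2) rapidly_decreasing pi_rep"
  unfolding pi_rep_def
  by (rule star_rep_iso[OF star_rep_fock]) (use canonical_iso_phi in \<open>simp add: canonical_iso_def\<close>)

lemma well_behaved_pi: "well_behaved x1 x2 rapidly_decreasing pi_rep"
  unfolding well_behaved_def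
  by (intro conjI star_rep_pi exI[of _ phi] exI[of _ fock_rep] canonical_iso_phi integrable_fock) (simp add: pi_rep_def)

lemma irreducible_pi: "irreducible_rep (A_algebra x1 x2) rapidly_decreasing pi_rep"
  unfolding irreducible_rep_def
proof (intro conjI allI impI, goal_cases)
  case 1
  have "coord (basis_vec (0, 0, 0)) (0, 0, 0) \<noteq> coord (0 :: idx ell2) (0, 0, 0)" by (simp add: coord_basis_vec coord_ell2)
  then have "basis_vec (0, 0, 0) \<noteq> 0" by (rule contrapos_nn) (simp only:)
  then show ?case using basis_vec_rapid[of "(0, 0, 0)"] by blast
next
  case (2 D1 D2)
  note * = 2[THEN conjunct2]
  note D = 2[THEN conjunct1] *[THEN conjunct1]
  have orth: "\<And>f g. f \<in> D1 \<Longrightarrow> g \<in> D2 \<Longrightarrow> cinner f g = 0"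
    using *[THEN conjunct2, THEN conjunct1] by blast
  note sum = *[THEN conjunct2, THEN conjunct2, THEN conjunct1]
  have inv: "\<And>X. X \<in> carrier (A_algebra x1 x2) \<Longrightarrow> pi_rep X ` D1 \<subseteq> D1 \<and> pi_rep X ` D2 \<subseteq> D2"
    using *[THEN conjunct2, THEN conjunct2, THEN conjunct2] by (rule bspec)
  have sub: "f \<in> rapidly_decreasing" if "f \<in> D1 \<or> f \<in> D2" for f
  proof -
    have "f + 0 \<in> rapidly_decreasing" if "f \<in> D1" for f unfolding sum using that csubspaceD(1)[OF D(2)] by blast
    moreover have "0 + f \<in> rapidly_decreasing" if "f \<in> D2" for f unfolding sum using that csubspaceD(1)[OF D(1)] by blast
    ultimately show ?thesis using that by auto
  qed
  \<comment> \<open>The ladder operators are themselves represented elements, namely the classes of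
    \<open>backward l\<close> and of its adjoint, so invariance under the algebra implies invariance
    under them.\<close>
  have lad: "\<exists>X\<in>carrier (A_algebra x1 x2). \<forall>f\<in>rapidly_decreasing. pi_rep X f = ladder (l, b) f" for l b
  proof (rule bexI)
    let ?p = "if b then adj (backward l) else backward l"
    show "\<forall>f\<in>rapidly_decreasing. pi_rep (cls (A_relations x1 x2) ?p) f = ladder (l, b) f"
      by (cases b) (simp_all add: pi_rep_cls free_hom_adj forward_backward fock.evaluate_gen)
    show "cls (A_relations x1 x2) ?p \<in> carrier (A_algebra x1 x2)"
      unfolding A_algebra_def presented_simps by (rule rangeI)
  qed
  have i1: "ladder x f \<in> D1" if f: "f \<in> D1" for x f
  proof -
    obtain X where X: "X \<in> carrier (A_algebra x1 x2)" "\<forall>f\<in>rapidly_decreasing. pi_rep X f = ladder (fst x, snd x) f"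
      using lad by (rule bexE)
    have "pi_rep X f = ladder x f" using bspec[OF X(2) sub] f by simp
    moreover
    have "pi_rep X f \<in> D1" using inv[OF X(1)] f by blast
    ultimately show ?thesis by (simp only:)
  qed
  have i2: "ladder x f \<in> D2" if f: "f \<in> D2" for x f
  proof -
    obtain X where X: "X \<in> carrier (A_algebra x1 x2)" "\<forall>f\<in>rapidly_decreasing. pi_rep X f = ladder (fst x, snd x) f"
      using lad by (rule bexE)
    have "pi_rep X f = ladder x f" using bspec[OF X(2) sub] f by simp
    moreover
    have "pi_rep X f \<in> D2" using inv[OF X(1)] f by blast
    ultimately show ?thesis by (simp only:)
  qed
  show ?case by (rule ladder_irreducible[OF D orth sum i1 i2])
qed

lemma pi_formulas:
  assumes f: "f \<in> rapidly_decreasing"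
  shows "coord (pi_rep (A_elem x1 x2 Ga1) f) n = tensor3 creation id id (coord f) n"
    "coord (pi_rep (A_elem x1 x2 Ga2) f) n =
         complex_of_real (sqrt (1 + (cmod x2)\<^sup>2 / (cmod x1)\<^sup>2)) * tensor3 id id creation (coord f) n
         - x2 / complex_of_real (cmod x1) * tensor3 id annihilation id (coord f) n
         + cnj x1 / 2 * tensor3 id (creation \<circ> creation) id (coord f) n
         + complex_of_real (cmod x1) * tensor3 annihilation creation id (coord f) n
         + x1 / 2 * tensor3 (annihilation \<circ> annihilation) id id (coord f) n"
    "coord (pi_rep (A_elem x1 x2 GA) f) n =
         complex_of_real (cmod x1) * tensor3 id creation id (coord f) n
         + x1 * tensor3 annihilation id id (coord f) n"
  unfolding A_elem_def pi_rep_cls[OF f] free_hom_gen tensor3_ladder forward_def generator.case image_A_def image_a2_def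
    r_def s_def power2_eq_square[of "gen _"] power2_eq_square[of "adj _"]
  by (simp_all add: fock.evaluate_add fock.evaluate_diff fock.evaluate_mult f ladder_rapid fock.evaluate_gen
      fock.evaluate_scalar coord_ell2 coord_scaleC coord_ladder)

end

section \<open>Gaussian integrals\<close>

lemma lborel_integral_prod:
  fixes f :: "'v::euclidean_space \<Rightarrow> real \<Rightarrow> complex"
  assumes f: "\<And>b. integrable lborel (f b)"
  shows "integrable lborel (\<lambda>y::'v. \<Prod>b\<in>Basis. f b (y \<bullet> b))"
    and "(LINT y|lborel. (\<Prod>b\<in>Basis. f b (y \<bullet> b))) = (\<Prod>b\<in>(Basis::'v set). (LINT x|lborel. f b x))"
proof -
  interpret product_sigma_finite "\<lambda>_::'v. lborel :: real measure" ..
  have [measurable]: "f b \<in> borel_measurable borel" for b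
    using borel_measurable_integrable[OF f[of b]] by simp
  let ?T = "\<lambda>g. \<Sum>b\<in>(Basis::'v set). g b *\<^sub>R b"
  have T: "?T \<in> measurable (\<Pi>\<^sub>M b\<in>(Basis::'v set). lborel) borel" by measurable
  have F: "(\<lambda>y::'v. \<Prod>b\<in>Basis. f b (y \<bullet> b)) \<in> borel_measurable borel" by measurable
  have e: "(\<Prod>b\<in>Basis. f b (?T g \<bullet> b)) = (\<Prod>b\<in>Basis. f b (g b))" for g
    by (rule prod.cong) simp_all
  show "integrable lborel (\<lambda>y::'v. \<Prod>b\<in>Basis. f b (y \<bullet> b))"
    unfolding lborel_eq[where 'a = 'v] integrable_distr_eq[OF T F] e
    by (rule product_integrable_prod[OF finite_Basis f])
  show "(LINT y|lborel. (\<Prod>b\<in>Basis. f b (y \<bullet> b))) = (\<Prod>b\<in>(Basis::'v set). (LINT x|lborel. f b x))"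
    unfolding lborel_eq[where 'a = 'v] integral_distr[OF T F] e
    by (rule product_integral_prod[OF finite_Basis f])
qed

text \<open>The characteristic function of the standard normal distribution, freed of the
  normalisation \<open>sqrt (2 * pi)\<close>.\<close>

lemma gaussian_1d:
  "integrable lborel (\<lambda>x. complex_of_real (exp (- x\<^sup>2 / 2)) * exp (\<i> * complex_of_real (x * t)))"
  "(LINT x|lborel. complex_of_real (exp (- x\<^sup>2 / 2)) * exp (\<i> * complex_of_real (x * t)))
    = complex_of_real (sqrt (2 * pi) * exp (- t\<^sup>2 / 2))"
proof -
  let ?c = "complex_of_real (sqrt (2 * pi))"
  have e: "complex_of_real (exp (- x\<^sup>2 / 2)) * exp (\<i> * complex_of_real (x * t))
      = ?c * (std_normal_density x *\<^sub>R iexp (t * x))" for x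
    by (simp add: std_normal_density_def scaleR_conv_of_real mult.commute)
  have i: "integrable lborel (\<lambda>x. std_normal_density x *\<^sub>R iexp (t * x))"
    by (rule Bochner_Integration.integrable_bound[OF integrable_normal_density[OF zero_less_one, of 0]]) auto
  then show "integrable lborel (\<lambda>x. complex_of_real (exp (- x\<^sup>2 / 2)) * exp (\<i> * complex_of_real (x * t)))"
    unfolding e by (intro integrable_mult_right)
  have "(LINT x|lborel. std_normal_density x *\<^sub>R iexp (t * x)) = char std_normal_distribution t"
    unfolding char_def by (subst integral_density) auto
  then show "(LINT x|lborel. complex_of_real (exp (- x\<^sup>2 / 2)) * exp (\<i> * complex_of_real (x * t)))
    = complex_of_real (sqrt (2 * pi) * exp (- t\<^sup>2 / 2))"
    unfolding e integral_mult_right_zero char_std_normal_distribution by simp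
qed

lemma gaussian_integral:
  fixes b :: "'v::euclidean_space"
  shows "integrable lborel (\<lambda>y. complex_of_real (exp (- (norm y)\<^sup>2 / 2)) * exp (\<i> * complex_of_real (y \<bullet> b)))"
    and "(LINT y|lborel. complex_of_real (exp (- (norm y)\<^sup>2 / 2)) * exp (\<i> * complex_of_real (y \<bullet> b)))
      = complex_of_real (sqrt (2 * pi) ^ DIM('v) * exp (- (norm b)\<^sup>2 / 2))"
proof -
  have n: "(norm y)\<^sup>2 = (\<Sum>c\<in>Basis. (y \<bullet> c)\<^sup>2)" for y :: 'v
    unfolding power2_norm_eq_inner by (subst euclidean_inner) (simp add: power2_eq_square)
  have g: "exp (- (norm y)\<^sup>2 / 2) = (\<Prod>c\<in>Basis. exp (- (y \<bullet> c)\<^sup>2 / 2))" for y :: 'v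
    by (simp add: n exp_sum[symmetric] sum_negf sum_divide_distrib)
  have p: "exp (\<i> * complex_of_real (y \<bullet> b)) = (\<Prod>c\<in>Basis. exp (\<i> * complex_of_real ((y \<bullet> c) * (b \<bullet> c))))" for y :: 'v
    by (subst euclidean_inner) (simp add: exp_sum[symmetric] sum_distrib_left)
  have e: "complex_of_real (exp (- (norm y)\<^sup>2 / 2)) * exp (\<i> * complex_of_real (y \<bullet> b))
      = (\<Prod>c\<in>Basis. complex_of_real (exp (- (y \<bullet> c)\<^sup>2 / 2)) * exp (\<i> * complex_of_real ((y \<bullet> c) * (b \<bullet> c))))" for y :: 'v
    unfolding g p of_real_prod prod.distrib ..
  note prod = lborel_integral_prod[of "\<lambda>c x. complex_of_real (exp (- x\<^sup>2 / 2)) * exp (\<i> * complex_of_real (x * (b \<bullet> c)))",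
      OF gaussian_1d(1)]
  show "integrable lborel (\<lambda>y. complex_of_real (exp (- (norm y)\<^sup>2 / 2)) * exp (\<i> * complex_of_real (y \<bullet> b)))"
    unfolding e by (rule prod(1))
  have "(LINT y|lborel. complex_of_real (exp (- (norm y)\<^sup>2 / 2)) * exp (\<i> * complex_of_real (y \<bullet> b)))
      = (\<Prod>c\<in>(Basis::'v set). complex_of_real (sqrt (2 * pi) * exp (- (b \<bullet> c)\<^sup>2 / 2)))"
    unfolding e prod(2) gaussian_1d(2) ..
  also have "\<dots> = complex_of_real (\<Prod>c\<in>(Basis::'v set). sqrt (2 * pi) * exp (- (b \<bullet> c)\<^sup>2 / 2))"
    by (rule of_real_prod[symmetric])
  also have "(\<Prod>c\<in>(Basis::'v set). sqrt (2 * pi) * exp (- (b \<bullet> c)\<^sup>2 / 2)) = sqrt (2 * pi) ^ DIM('v) * exp (- (norm b)\<^sup>2 / 2)"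
    unfolding prod.distrib g by simp
  finally show "(LINT y|lborel. complex_of_real (exp (- (norm y)\<^sup>2 / 2)) * exp (\<i> * complex_of_real (y \<bullet> b)))
      = complex_of_real (sqrt (2 * pi) ^ DIM('v) * exp (- (norm b)\<^sup>2 / 2))" .
qed

lemma lborel_integral_translate:
  fixes f :: "'v::euclidean_space \<Rightarrow> complex"
  assumes "f \<in> borel_measurable borel"
  shows "(LINT x|lborel. f (c + x)) = (LINT x|lborel. f x)"
    and "integrable lborel (\<lambda>x. f (c + x)) \<longleftrightarrow> integrable lborel f"
proof -
  have m: "(+) c \<in> measurable lborel borel" by measurable
  show "(LINT x|lborel. f (c + x)) = (LINT x|lborel. f x)"
    using integral_distr[OF m assms] by (simp add: lborel_distr_plus)
  show "integrable lborel (\<lambda>x. f (c + x)) \<longleftrightarrow> integrable lborel f"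
    using integrable_distr_eq[OF m assms] by (simp add: lborel_distr_plus)
qed

lemma lborel_integral_scale:
  fixes f :: "'v::euclidean_space \<Rightarrow> complex"
  assumes f: "f \<in> borel_measurable borel" and c: "c \<noteq> 0"
  shows "(LINT x|lborel. f x) = complex_of_real (\<bar>c\<bar> ^ DIM('v)) * (LINT x|lborel. f (c *\<^sub>R x))"
proof -
  have m: "(\<lambda>x::'v. c *\<^sub>R x) \<in> measurable lborel borel" by measurable
  have "(LINT x|lborel. f x) = (LINT x|density (distr lborel borel (\<lambda>x. 0 + c *\<^sub>R x)) (\<lambda>_. \<bar>c\<bar> ^ DIM('v)). f x)"
    by (simp only: lborel_affine[OF c, symmetric])
  also have "\<dots> = (LINT x|distr lborel borel (\<lambda>x. c *\<^sub>R x). \<bar>c\<bar> ^ DIM('v) *\<^sub>R f x)"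
    by (subst integral_density) (use f in \<open>auto simp: measurable_distr_eq1\<close>)
  also have "\<dots> = (LINT x|lborel. \<bar>c\<bar> ^ DIM('v) *\<^sub>R f (c *\<^sub>R x))"
    by (rule integral_distr[OF m]) (use f in measurable)
  finally show ?thesis by (simp only: scaleR_conv_of_real integral_mult_right_zero)
qed

section \<open>Gaussians and symplectic phases on phase space\<close>

type_synonym phase_space = "(real^3) \<times> (real^3)"

definition om :: "phase_space \<Rightarrow> phase_space \<Rightarrow> real" where
  "om z w = fst z \<bullet> snd w - snd z \<bullet> fst w"

lemma om_simps: "om (z + z') w = om z w + om z' w" "om z (w + w') = om z w + om z w'" "om z z = 0"
  "om (- z) w = - om z w" "om z (- w) = - om z w" "om (r *\<^sub>R z) w = r * om z w" "om z (r *\<^sub>R w) = r * om z w"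
  "om (z - z') w = om z w - om z' w" "om z (w - w') = om z w - om z w'"
  by (simp_all add: om_def inner_add_left inner_add_right inner_diff_left inner_diff_right inner_commute algebra_simps)

text \<open>Turns the symplectic phase into an ordinary Fourier phase at a rotated vector of equal
  norm, so that the Gaussian integral applies.\<close>

lemma om_inner: "om z w = z \<bullet> (snd w, - fst w)"
  by (cases z) (simp add: om_def)

lemma norm_rotated: "norm ((snd w, - fst w) :: phase_space) = norm w" for w :: phase_space
  by (cases w) (simp add: norm_Pair add.commute)

lemma continuous_on_om [continuous_intros]:
  "continuous_on S f \<Longrightarrow> continuous_on S g \<Longrightarrow> continuous_on S (\<lambda>x. om (f x) (g x))"
  unfolding om_def by (intro continuous_intros)

text \<open>The vacuum expectation value of the displacement by \<open>z\<close>, as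
  \<open>weyl_vacuum\<close> confirms.\<close>

definition gauss :: "phase_space \<Rightarrow> real" where
  "gauss z = exp (- (norm z)\<^sup>2 / 4)"

definition phase :: "real \<Rightarrow> complex" where
  "phase t = exp (\<i> * complex_of_real t)"

lemma phase_simps: "phase (s + t) = phase s * phase t" "cmod (phase t) = 1" "phase 0 = 1" "cnj (phase t) = phase (- t)"
  by (simp_all add: phase_def distrib_left exp_add exp_cnj)

lemma continuous_gauss [continuous_intros]: "continuous_on S f \<Longrightarrow> continuous_on S (\<lambda>x. gauss (f x))"
  unfolding gauss_def by (intro continuous_intros) auto

lemma continuous_phase [continuous_intros]: "continuous_on S f \<Longrightarrow> continuous_on S (\<lambda>x. phase (f x))"
  unfolding phase_def by (intro continuous_intros)

lemma gauss_simps: "gauss 0 = 1" "gauss (- z) = gauss z" "0 < gauss z" "gauss z \<le> 1"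
  by (simp_all add: gauss_def)

lemma phase_gaussian:
  "(LINT y|lborel. complex_of_real (exp (- (norm y)\<^sup>2 / 2)) * phase (om y c))
    = complex_of_real (sqrt (2 * pi) ^ DIM(phase_space) * exp (- (norm c)\<^sup>2 / 2))"
  unfolding phase_def om_inner gaussian_integral(2) norm_rotated ..

lemma integrable_gauss: "integrable lborel gauss"
proof -
  let ?f = "\<lambda>y::phase_space. complex_of_real (exp (- (norm y)\<^sup>2 / 2))"
  have f: "integrable lborel ?f" using gaussian_integral(1)[of "0::phase_space"] by simp
  have m: "(\<lambda>x::phase_space. (1 / sqrt 2) *\<^sub>R x) \<in> measurable lborel borel" by measurable
  have "integrable (density (distr lborel borel (\<lambda>x. 0 + (1 / sqrt 2) *\<^sub>R x)) (\<lambda>_. \<bar>1 / sqrt 2\<bar> ^ DIM(phase_space))) ?f"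
    using f by (subst lborel_affine[symmetric]) simp_all
  then have "integrable (distr lborel borel (\<lambda>x. (1 / sqrt 2) *\<^sub>R x)) (\<lambda>x. \<bar>1 / sqrt 2\<bar> ^ DIM(phase_space) *\<^sub>R ?f x)"
    by (subst (asm) integrable_density) (auto simp: measurable_distr_eq1)
  then have "integrable lborel (\<lambda>x. \<bar>1 / sqrt 2\<bar> ^ DIM(phase_space) *\<^sub>R ?f ((1 / sqrt 2) *\<^sub>R x))"
    by (subst (asm) integrable_distr_eq[OF m]) auto
  then have "integrable lborel (\<lambda>x. inverse (\<bar>1 / sqrt 2\<bar> ^ DIM(phase_space)) *\<^sub>R
      (\<bar>1 / sqrt 2\<bar> ^ DIM(phase_space) *\<^sub>R ?f ((1 / sqrt 2) *\<^sub>R x)))"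
    by (rule integrable_scaleR_right)
  moreover have "inverse (\<bar>1 / sqrt 2\<bar> ^ DIM(phase_space)) *\<^sub>R (\<bar>1 / sqrt 2\<bar> ^ DIM(phase_space) *\<^sub>R ?f ((1 / sqrt 2) *\<^sub>R x))
      = complex_of_real (gauss x)" for x
    by (simp add: gauss_def power_divide)
  ultimately have "integrable lborel (\<lambda>x. complex_of_real (gauss x))" by (simp only:)
  then show ?thesis using complex_of_real_integrable_eq by blast
qed

lemma integrable_gauss_bounded:
  fixes h :: "phase_space \<Rightarrow> complex"
  assumes "continuous_on UNIV h" "\<And>z. cmod (h z) \<le> M"
  shows "integrable lborel (\<lambda>z. complex_of_real (gauss z) * h z)"
proof (rule Bochner_Integration.integrable_bound)
  show "integrable lborel (\<lambda>z. M * gauss z)" using integrable_gauss by simp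
  show "(\<lambda>z. complex_of_real (gauss z) * h z) \<in> borel_measurable lborel"
    unfolding measurable_lborel2 using assms(1) by (intro borel_measurable_continuous_onI continuous_intros; simp)
  have "norm (complex_of_real (gauss z) * h z) \<le> norm (M * gauss z)" for z
  proof -
    have "0 \<le> M" using assms(2)[of 0] norm_ge_zero order_trans by blast
    then show ?thesis
      using mult_left_mono[OF assms(2)[of z], of "gauss z"] gauss_simps(3)[of z]
      by (simp add: norm_mult abs_mult mult.commute less_imp_le)
  qed
  then show "AE z in lborel. norm (complex_of_real (gauss z) * h z) \<le> norm (M * gauss z)" by simp
qed

text \<open>A shift to the midpoint \<open>d\<close> separates the two Gaussians and reduces the
  phase to one with frequency \<open>c\<close>. The Fourier transform contributes
  \<open>exp (- (norm c)\<^sup>2 / 2)\<close>, and the parallelogram law for \<open>d\<close> and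
  \<open>c\<close> restores \<open>gauss g * gauss u\<close>.\<close>

lemma gauss_gauss_phase:
  "(LINT z|lborel. complex_of_real (gauss z * gauss (u - z - g)) * phase ((om z g + om (z + g) u) / 2))
    = complex_of_real (sqrt (2 * pi) ^ DIM(phase_space)) * complex_of_real (gauss g * gauss u)"
proof -
  define d where "d = (1 / 2) *\<^sub>R (u - g)"
  define c where "c = (1 / 2) *\<^sub>R (g + u)"
  let ?f = "\<lambda>z. complex_of_real (gauss z * gauss (u - z - g)) * phase ((om z g + om (z + g) u) / 2)"
  have m: "?f \<in> borel_measurable borel" by (intro borel_measurable_continuous_onI continuous_intros; simp; simp)
  have nn: "(norm (d + y))\<^sup>2 + (norm (u - (d + y) - g))\<^sup>2 = 2 * (norm y)\<^sup>2 + 2 * (norm d)\<^sup>2" for y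
  proof -
    have "u - (d + y) - g = d - y" by (simp add: d_def algebra_simps flip: scaleR_2)
    show ?thesis unfolding \<open>u - (d + y) - g = d - y\<close>
      by (simp add: power2_norm_eq_inner inner_add_left inner_add_right inner_diff_left inner_diff_right inner_commute)
  qed
  have ph: "(om (d + y) g + om ((d + y) + g) u) / 2 = om y c" for y
  proof -
    have "om u g = - om g u" by (simp add: om_def inner_commute)
    then show ?thesis by (simp add: om_simps d_def c_def algebra_simps)
  qed
  have "?f (d + y) = complex_of_real (exp (- (norm d)\<^sup>2 / 2)) * (complex_of_real (exp (- (norm y)\<^sup>2 / 2)) * phase (om y c))" for y
  proof -
    have "gauss (d + y) * gauss (u - (d + y) - g) = exp (- ((norm (d + y))\<^sup>2 + (norm (u - (d + y) - g))\<^sup>2) / 4)"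
      by (simp add: gauss_def exp_add[symmetric] add_divide_distrib diff_divide_distrib)
    also have "\<dots> = exp (- (norm d)\<^sup>2 / 2) * exp (- (norm y)\<^sup>2 / 2)"
      unfolding nn exp_add[symmetric] by (simp add: field_simps)
    finally show ?thesis unfolding ph by simp
  qed
  then have "(LINT z|lborel. ?f z) = complex_of_real (exp (- (norm d)\<^sup>2 / 2)) *
      complex_of_real (sqrt (2 * pi) ^ DIM(phase_space) * exp (- (norm c)\<^sup>2 / 2))"
    using lborel_integral_translate(1)[OF m, of d] by (simp only: integral_mult_right_zero phase_gaussian)
  also have "exp (- (norm d)\<^sup>2 / 2) * (sqrt (2 * pi) ^ DIM(phase_space) * exp (- (norm c)\<^sup>2 / 2))
      = sqrt (2 * pi) ^ DIM(phase_space) * (gauss g * gauss u)"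
  proof -
    have "(norm d)\<^sup>2 + (norm c)\<^sup>2 = ((norm g)\<^sup>2 + (norm u)\<^sup>2) / 2"
      unfolding d_def c_def power2_norm_eq_inner
      by (simp add: inner_add_left inner_add_right inner_diff_left inner_diff_right inner_commute field_simps)
    then have "- (norm d)\<^sup>2 / 2 + - (norm c)\<^sup>2 / 2 = - (norm g)\<^sup>2 / 4 + - (norm u)\<^sup>2 / 4"
      by (simp add: field_simps)
    then have "exp (- (norm d)\<^sup>2 / 2) * exp (- (norm c)\<^sup>2 / 2) = gauss g * gauss u"
      unfolding gauss_def exp_add[symmetric] by (rule arg_cong)
    then show ?thesis by simp
  qed
  then have "complex_of_real (exp (- (norm d)\<^sup>2 / 2)) * complex_of_real (sqrt (2 * pi) ^ DIM(phase_space) * exp (- (norm c)\<^sup>2 / 2))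
      = complex_of_real (sqrt (2 * pi) ^ DIM(phase_space)) * complex_of_real (gauss g * gauss u)"
    by (simp only: of_real_mult[symmetric])
  finally show ?thesis .
qed

text \<open>Scalar form of the identity P U(g) P = const exp(-|g|^2/4) P for the Gaussian average P.
  After the substitution \<open>u = z + g + w\<close> the order of integration is exchanged, and
  \<open>gauss_gauss_phase\<close> evaluates the integral over \<open>z\<close>.\<close>

lemma twisted_convolution:
  fixes h :: "phase_space \<Rightarrow> complex"
  assumes h: "continuous_on UNIV h" "\<And>z. cmod (h z) \<le> M"
  shows "(LINT z|lborel. complex_of_real (gauss z) * (LINT w|lborel. complex_of_real (gauss w) *
      (phase ((om z g + om (z + g) w) / 2) * h (z + g + w))))
    = complex_of_real (sqrt (2 * pi) ^ DIM(phase_space)) * complex_of_real (gauss g) * (LINT u|lborel. complex_of_real (gauss u) * h u)"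
proof -
  have hc: "continuous_on S (\<lambda>x. h (f x))" if "continuous_on S f" for S :: "'x::topological_space set" and f
    by (rule continuous_on_compose2[OF h(1) that]) auto
  define F where "F z u = complex_of_real (gauss z * gauss (u - z - g)) * phase ((om z g + om (z + g) u) / 2) * h u" for z u
  have inner: "complex_of_real (gauss z) * (LINT w|lborel. complex_of_real (gauss w) *
      (phase ((om z g + om (z + g) w) / 2) * h (z + g + w))) = (LINT u|lborel. F z u)" for z
  proof -
    have m: "F z \<in> borel_measurable borel"
      unfolding F_def by (intro borel_measurable_continuous_onI continuous_intros hc; simp; simp)
    have "F z ((z + g) + w) = complex_of_real (gauss z) * (complex_of_real (gauss w) *
      (phase ((om z g + om (z + g) w) / 2) * h (z + g + w)))" for w
    proof -
      have "om (z + g) ((z + g) + w) = om (z + g) w" by (simp only: om_simps(2,3) add_0)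
      moreover have "(z + g) + w - z - g = w" by simp
      ultimately show ?thesis unfolding F_def by (simp only: of_real_mult mult.assoc)
    qed
    then show ?thesis
      using lborel_integral_translate(1)[OF m, of "z + g"] by (simp only: integral_mult_right_zero)
  qed
  have gi: "integrable lborel (\<lambda>u. gauss (u - z - g))" "(LINT u|lborel. gauss (u - z - g)) = (LINT u|lborel. gauss u)" for z
  proof -
    have gm: "(\<lambda>u. complex_of_real (gauss u)) \<in> borel_measurable borel"
      by (intro borel_measurable_continuous_onI continuous_intros; simp; simp)
    have "u - z - g = - (z + g) + u" for u :: phase_space by simp
    then show "integrable lborel (\<lambda>u. gauss (u - z - g))" "(LINT u|lborel. gauss (u - z - g)) = (LINT u|lborel. gauss u)"
      using lborel_integral_translate[OF gm, of "- (z + g)"] integrable_gauss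
      by (simp_all only: complex_of_real_integrable_eq integral_complex_of_real of_real_eq_iff)
  qed
  \<comment> \<open>The majorant for Fubini; by translation invariance the inner integral does not
    depend on \<open>z\<close> apart from the factor \<open>gauss z\<close>.\<close>
  have "integrable (lborel \<Otimes>\<^sub>M lborel) (\<lambda>(z, u). gauss z * gauss (u - z - g))"
  proof (rule lborel_pair.Fubini_integrable)
    show "(\<lambda>(z, u). gauss z * gauss (u - z - g)) \<in> borel_measurable (lborel \<Otimes>\<^sub>M lborel)"
      unfolding lborel_prod case_prod_unfold measurable_lborel2
      by (intro borel_measurable_continuous_onI continuous_intros; simp)
    show "integrable lborel (\<lambda>z. LINT u|lborel. norm (case (z, u) of (z, u) \<Rightarrow> gauss z * gauss (u - z - g)))"
      using integrable_gauss by (simp add: gi(2) abs_mult gauss_simps(3) less_imp_le)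
    show "AE z in lborel. integrable lborel (\<lambda>u. case (z, u) of (z, u) \<Rightarrow> gauss z * gauss (u - z - g))"
      by (simp add: gi(1))
  qed
  then have "integrable (lborel \<Otimes>\<^sub>M lborel) (\<lambda>p. M * (case p of (z, u) \<Rightarrow> gauss z * gauss (u - z - g)))" by simp
  then have "integrable (lborel \<Otimes>\<^sub>M lborel) (case_prod F)"
  proof (rule Bochner_Integration.integrable_bound)
    show "case_prod F \<in> borel_measurable (lborel \<Otimes>\<^sub>M lborel)"
      unfolding lborel_prod case_prod_unfold measurable_lborel2 F_def
      by (intro borel_measurable_continuous_onI continuous_intros hc; simp; simp)
    have M: "0 \<le> M" using h(2)[of 0] norm_ge_zero order_trans by blast
    have "norm (F z u) \<le> norm (M * (gauss z * gauss (u - z - g)))" for z u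
    proof -
      have "cmod (h u) * (gauss z * gauss (u - z - g)) \<le> M * (gauss z * gauss (u - z - g))"
        by (intro mult_right_mono h(2)) (simp add: gauss_simps(3) less_imp_le)
      then show ?thesis using M
        by (simp add: F_def norm_mult abs_mult phase_simps(2) gauss_simps(3) less_imp_le mult.commute)
    qed
    then show "AE p in lborel \<Otimes>\<^sub>M lborel. norm (case_prod F p) \<le> norm (M * (case p of (z, u) \<Rightarrow> gauss z * gauss (u - z - g)))"
      by (simp add: case_prod_unfold)
  qed
  from lborel_pair.Fubini_integral[OF this]
  have "(LINT z|lborel. LINT u|lborel. F z u) = (LINT u|lborel. LINT z|lborel. F z u)" by simp
  also have "\<dots> = (LINT u|lborel. complex_of_real (sqrt (2 * pi) ^ DIM(phase_space)) * complex_of_real (gauss g) * (complex_of_real (gauss u) * h u))"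
    unfolding F_def integral_mult_left_zero gauss_gauss_phase by (simp add: mult_ac)
  finally show ?thesis unfolding inner integral_mult_right_zero .
qed

text \<open>Integrating the phases against ever wider Gaussians in \<open>g\<close> concentrates the weight at
  \<open>z = 0\<close>.\<close>

lemma gauss_phase_zero:
  fixes h :: "phase_space \<Rightarrow> complex"
  assumes h: "continuous_on UNIV h" "\<And>z. cmod (h z) \<le> M"
    and zero: "\<And>g. (LINT z|lborel. complex_of_real (gauss z) * (phase (om z g) * h z)) = 0"
  shows "h 0 = 0"
proof -
  have hc: "continuous_on S (\<lambda>x. h (f x))" if "continuous_on S f" for S :: "'x::topological_space set" and f
    by (rule continuous_on_compose2[OF h(1) that]) auto
  have M: "0 \<le> M" using h(2)[of 0] norm_ge_zero order_trans by blast
  define k where "k y = exp (- (norm y)\<^sup>2 / 2)" for y :: phase_space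
  have kc: "continuous_on S (\<lambda>x. k (f x))" if "continuous_on S f" for S :: "'x::topological_space set" and f
    unfolding k_def by (intro continuous_intros that) auto
  have ki: "integrable lborel k"
    using gaussian_integral(1)[of "0::phase_space"] by (simp add: k_def[abs_def] complex_of_real_integrable_eq)
  let ?C = "complex_of_real (sqrt (2 * pi) ^ DIM(phase_space))"
  have concentrated: "(LINT y|lborel. complex_of_real (k y) * (complex_of_real (gauss ((1 / n) *\<^sub>R y)) * h ((1 / n) *\<^sub>R y))) = 0"
    if n: "n > 0" for n :: real
  proof -
    \<comment> \<open>The hypothesis at the points \<open>n *\<^sub>R g\<close> is averaged against
      the Gaussian \<open>k\<close>; integrating over \<open>g\<close> first produces the weight
      \<open>k (n *\<^sub>R z)\<close>, concentrated near 0.\<close>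
    define F where "F g z = complex_of_real (k g) * (complex_of_real (gauss z) * (phase (om z (n *\<^sub>R g)) * h z))" for g z
    have "integrable (lborel \<Otimes>\<^sub>M lborel) (\<lambda>(g, z). k g * gauss z)"
    proof (rule lborel_pair.Fubini_integrable)
      show "(\<lambda>(g, z). k g * gauss z) \<in> borel_measurable (lborel \<Otimes>\<^sub>M lborel)"
        unfolding lborel_prod case_prod_unfold measurable_lborel2
        by (intro borel_measurable_continuous_onI continuous_intros kc; simp)
      show "integrable lborel (\<lambda>g. LINT z|lborel. norm (case (g, z) of (g, z) \<Rightarrow> k g * gauss z))"
        using ki by (simp add: abs_mult gauss_simps(3) less_imp_le k_def[abs_def])
      show "AE g in lborel. integrable lborel (\<lambda>z. case (g, z) of (g, z) \<Rightarrow> k g * gauss z)"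
        using integrable_gauss by simp
    qed
    then have "integrable (lborel \<Otimes>\<^sub>M lborel) (\<lambda>p. M * (case p of (g, z) \<Rightarrow> k g * gauss z))" by simp
    then have "integrable (lborel \<Otimes>\<^sub>M lborel) (case_prod F)"
    proof (rule Bochner_Integration.integrable_bound)
      show "case_prod F \<in> borel_measurable (lborel \<Otimes>\<^sub>M lborel)"
        unfolding lborel_prod case_prod_unfold measurable_lborel2 F_def
        by (intro borel_measurable_continuous_onI continuous_intros hc kc; simp)
      have "norm (F g z) \<le> norm (M * (k g * gauss z))" for g z
      proof -
        have "cmod (h z) * (k g * gauss z) \<le> M * (k g * gauss z)"
          by (intro mult_right_mono h(2)) (simp add: gauss_simps(3) less_imp_le k_def)
        then show ?thesis using M
          by (simp add: F_def norm_mult abs_mult phase_simps(2) gauss_simps(3) less_imp_le mult_ac k_def)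
      qed
      then show "AE p in lborel \<Otimes>\<^sub>M lborel. norm (case_prod F p) \<le> norm (M * (case p of (g, z) \<Rightarrow> k g * gauss z))"
        by (simp add: case_prod_unfold)
    qed
    from lborel_pair.Fubini_integral[OF this]
    have "(LINT z|lborel. LINT g|lborel. F g z) = (LINT g|lborel. LINT z|lborel. F g z)" .
    also have "(LINT g|lborel. LINT z|lborel. F g z) = 0" unfolding F_def integral_mult_right_zero zero by simp
    finally have total: "(LINT z|lborel. LINT g|lborel. F g z) = 0" .
    have "(LINT g|lborel. F g z) = ?C * (complex_of_real (gauss z) * h z * complex_of_real (k (n *\<^sub>R z)))" for z
    proof -
      have "om z (n *\<^sub>R g) = om g (- (n *\<^sub>R z))" for g by (simp add: om_def inner_commute algebra_simps)
      then have "F g z = (complex_of_real (gauss z) * h z) * (complex_of_real (exp (- (norm g)\<^sup>2 / 2)) * phase (om g (- (n *\<^sub>R z))))" for g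
        by (simp add: F_def k_def)
      then have "(LINT g|lborel. F g z) = (complex_of_real (gauss z) * h z) *
          complex_of_real (sqrt (2 * pi) ^ DIM(phase_space) * exp (- (norm (- (n *\<^sub>R z)))\<^sup>2 / 2))"
        by (simp only: integral_mult_right_zero phase_gaussian)
      then show ?thesis by (simp add: k_def)
    qed
    then have "?C * (LINT z|lborel. complex_of_real (gauss z) * h z * complex_of_real (k (n *\<^sub>R z))) = 0"
      using total by (simp only: integral_mult_right_zero)
    then have "(LINT z|lborel. complex_of_real (gauss z) * h z * complex_of_real (k (n *\<^sub>R z))) = 0" by simp
    moreover have "(\<lambda>z. complex_of_real (gauss z) * h z * complex_of_real (k (n *\<^sub>R z))) \<in> borel_measurable borel"
      by (intro borel_measurable_continuous_onI continuous_intros hc kc; simp)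
    ultimately have "complex_of_real (\<bar>1 / n\<bar> ^ DIM(phase_space)) * (LINT y|lborel.
        complex_of_real (gauss ((1 / n) *\<^sub>R y)) * h ((1 / n) *\<^sub>R y) * complex_of_real (k (n *\<^sub>R (1 / n) *\<^sub>R y))) = 0"
      using lborel_integral_scale[of "\<lambda>z. complex_of_real (gauss z) * h z * complex_of_real (k (n *\<^sub>R z))" "1 / n"] n by simp
    then show ?thesis using n by (simp add: mult_ac)
  qed
  \<comment> \<open>After rescaling, the weight \<open>k\<close> is fixed and the argument of
    \<open>gauss\<close> and \<open>h\<close> shrinks to 0, so dominated convergence leaves the
    integral of \<open>k\<close> times \<open>h 0\<close>.\<close>
  have "(\<lambda>n. LINT y|lborel. complex_of_real (k y) * (complex_of_real (gauss ((1 / (real n + 1)) *\<^sub>R y)) * h ((1 / (real n + 1)) *\<^sub>R y)))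
      \<longlonglongrightarrow> (LINT y|lborel. complex_of_real (k y) * (complex_of_real (gauss 0) * h 0))"
  proof (rule integral_dominated_convergence[where w = "\<lambda>y. M * k y"])
    show "(\<lambda>y. complex_of_real (k y) * (complex_of_real (gauss 0) * h 0)) \<in> borel_measurable lborel"
      unfolding measurable_lborel2 by (intro borel_measurable_continuous_onI continuous_intros kc; simp)
    show "(\<lambda>y. complex_of_real (k y) * (complex_of_real (gauss ((1 / (real n + 1)) *\<^sub>R y)) * h ((1 / (real n + 1)) *\<^sub>R y)))
        \<in> borel_measurable lborel" for n
      unfolding measurable_lborel2 by (intro borel_measurable_continuous_onI continuous_intros kc hc; simp)
    show "integrable lborel (\<lambda>y. M * k y)" using ki by simp
    have lim: "(\<lambda>n. (1 / (real n + 1)) *\<^sub>R y) \<longlonglongrightarrow> 0 *\<^sub>R y" for y :: phase_space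
      by (intro tendsto_scaleR lim_inverse_add_one tendsto_const)
    have gh: "isCont (\<lambda>z. complex_of_real (gauss z) * h z) 0"
    proof -
      have "continuous_on UNIV (\<lambda>z. complex_of_real (gauss z) * h z)" by (intro continuous_intros h(1))
      then show ?thesis unfolding continuous_on_eq_continuous_at[OF open_UNIV] by (rule bspec) simp
    qed
    have "(\<lambda>n. complex_of_real (k y) * (complex_of_real (gauss ((1 / (real n + 1)) *\<^sub>R y)) * h ((1 / (real n + 1)) *\<^sub>R y)))
        \<longlonglongrightarrow> complex_of_real (k y) * (complex_of_real (gauss 0) * h 0)" for y
      by (rule tendsto_mult_left, rule isCont_tendsto_compose[OF gh]) (use lim[of y] in simp)
    then show "AE y in lborel. (\<lambda>n. complex_of_real (k y) * (complex_of_real (gauss ((1 / (real n + 1)) *\<^sub>R y)) * h ((1 / (real n + 1)) *\<^sub>R y)))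
        \<longlonglongrightarrow> complex_of_real (k y) * (complex_of_real (gauss 0) * h 0)" by simp
    have "norm (complex_of_real (k y) * (complex_of_real (gauss z) * h z)) \<le> M * k y" for y z
    proof -
      have "gauss z * cmod (h z) \<le> 1 * M" by (intro mult_mono gauss_simps(4) h(2)) (simp_all add: M)
      then have "k y * (gauss z * cmod (h z)) \<le> k y * M" by (intro mult_left_mono) (simp_all add: k_def)
      then show ?thesis by (simp add: norm_mult gauss_simps(3) less_imp_le k_def mult.commute)
    qed
    then show "AE y in lborel. norm (complex_of_real (k y) * (complex_of_real (gauss ((1 / (real n + 1)) *\<^sub>R y)) * h ((1 / (real n + 1)) *\<^sub>R y)))
       \<le> M * k y" for n by simp
  qed
  then have "(LINT y|lborel. complex_of_real (k y) * (complex_of_real (gauss 0) * h 0)) = 0"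
    using concentrated[of "real _ + 1"] by (simp add: LIMSEQ_const_iff)
  moreover have "(LINT y|lborel. complex_of_real (k y)) = ?C"
    using gaussian_integral(2)[of "0::phase_space"] by (simp add: k_def)
  ultimately have "?C * h 0 = 0" by (simp only: integral_mult_left_zero gauss_simps(1)) simp
  then show ?thesis by simp
qed

section \<open>The vacuum vector\<close>

definition embed :: "phase_space \<Rightarrow> heis" where
  "embed z = (fst z, snd z, 0)"

lemma embed_simps: "embed (z + w) = embed z + embed w" "embed (- z) = - embed z" "symp (embed z) (embed w) = om z w"
  "embed 0 = 0" "fst (embed z) = fst z" "fst (snd (embed z)) = snd z" "snd (snd (embed z)) = 0"
  by (simp_all add: embed_def symp_def om_def zero_prod_def)

lemma continuous_on_embed [continuous_intros]: "continuous_on S f \<Longrightarrow> continuous_on S (\<lambda>x. embed (f x))"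
  unfolding embed_def by (intro continuous_intros)

text \<open>The centre acts by the character that the commutation relations prescribe, so the group
  reduces to operators indexed by phase space that satisfy the Weyl relations
  \<open>V_mult\<close>.\<close>

locale central_rep = heis_rep +
  assumes central: "U (t *\<^sub>R centre) \<xi> = phase t *\<^sub>C \<xi>"
begin

lemma U_add_centre: "U (g + t *\<^sub>R centre) \<xi> = phase t *\<^sub>C U g \<xi>"
proof -
  have "U (t *\<^sub>R centre) (U g \<xi>) = U (g + t *\<^sub>R centre) \<xi>"
    unfolding U_mult by (simp add: symp_simps add.commute)
  then show ?thesis by (simp add: central)
qed

lemma V_mult: "U (embed z) (U (embed w) \<xi>) = phase (om z w / 2) *\<^sub>C U (embed (z + w)) \<xi>"
  unfolding U_mult embed_simps(3) U_add_centre embed_simps(1) ..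

lemma V_adjoint: "cinner (U (embed z) \<xi>) \<eta> = cinner \<xi> (U (embed (- z)) \<eta>)"
  unfolding embed_simps(2) by (rule U_adjoint)

lemma V_continuous [continuous_intros]: "continuous_on S f \<Longrightarrow> continuous_on S (\<lambda>x. U (embed (f x)) \<xi>)"
  by (rule continuous_on_compose2[OF U_continuous]) (auto intro: continuous_on_embed)

lemma V_bound: "cmod (cinner (U (embed z) \<xi>) \<eta>) \<le> norm \<xi> * norm \<eta>"
  using cinner_Cauchy_Schwarz[of "U (embed z) \<xi>" \<eta>] by (simp add: U_simps(5))

text \<open>The sesquilinear form of the Gaussian average of the group; divided by
  \<open>sqrt (2 * pi) ^ DIM(phase_space)\<close> it belongs to an orthogonal projection.\<close>

definition form :: "'a \<Rightarrow> 'a \<Rightarrow> complex" where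
  "form \<xi> \<eta> = (LINT z|lborel. complex_of_real (gauss z) * cinner (U (embed z) \<xi>) \<eta>)"

lemma form_integrable: "integrable lborel (\<lambda>z. complex_of_real (gauss z) * cinner (U (embed z) \<xi>) \<eta>)"
  by (rule integrable_gauss_bounded[OF _ V_bound]) (intro continuous_intros)

lemma form_represented: "\<exists>v. \<forall>\<eta>. cinner v \<eta> = form \<xi> \<eta>"
proof -
  \<comment> \<open>The form is conjugate linear in its second argument, so its conjugate is the
    functional to which the Riesz theorem applies.\<close>
  let ?f = "\<lambda>\<eta>. cnj (form \<xi> \<eta>)"
  have "\<exists>v. \<forall>\<eta>. ?f \<eta> = cinner \<eta> v"
  proof (rule riesz_representation)
    show "?f (\<eta> + \<zeta>) = ?f \<eta> + ?f \<zeta>" for \<eta> \<zeta>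
      by (simp add: form_def cinner_add_right distrib_left Bochner_Integration.integral_add[OF form_integrable form_integrable])
    show "?f (c *\<^sub>C \<eta>) = c * ?f \<eta>" for c \<eta>
      by (simp add: form_def cinner_scaleC_right mult.left_commute[of _ "cnj c"])
    show "cmod (?f \<eta>) \<le> ((LINT z|lborel. gauss z) * norm \<xi>) * norm \<eta>" for \<eta>
    proof -
      have "cmod (form \<xi> \<eta>) \<le> (LINT z|lborel. gauss z * (norm \<xi> * norm \<eta>))"
        unfolding form_def
      proof (rule Bochner_Integration.integral_norm_bound_integral[OF form_integrable])
        show "integrable lborel (\<lambda>z. gauss z * (norm \<xi> * norm \<eta>))" using integrable_gauss by simp
        show "cmod (complex_of_real (gauss z) * cinner (U (embed z) \<xi>) \<eta>) \<le> gauss z * (norm \<xi> * norm \<eta>)" for z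
          using mult_left_mono[OF V_bound[of z \<xi> \<eta>], of "gauss z"] gauss_simps(3)[of z] by (simp add: norm_mult)
      qed
      then show ?thesis by (simp add: mult.assoc)
    qed
  qed
  then obtain v where "\<And>\<eta>. ?f \<eta> = cinner \<eta> v" by blast
  then have "cnj (cinner \<eta> v) = form \<xi> \<eta>" for \<eta> by (simp flip: \<open>\<And>\<eta>. ?f \<eta> = cinner \<eta> v\<close>)
  then have "cinner v \<eta> = form \<xi> \<eta>" for \<eta> using cinner_commute[of v \<eta>] by simp
  then show ?thesis by blast
qed

text \<open>Here \<open>v\<close> is the Gaussian average applied to \<open>\<xi>\<close>; the Weyl
  relations turn the iterated integral into the twisted convolution.\<close>

lemma form_twisted:
  assumes v: "\<And>\<eta>. cinner v \<eta> = form \<xi> \<eta>"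
  shows "form (U (embed g) v) \<eta> = complex_of_real (sqrt (2 * pi) ^ DIM(phase_space)) * complex_of_real (gauss g) * form \<xi> \<eta>"
proof -
  define h where "h u = cinner (U (embed u) \<xi>) \<eta>" for u
  have "cinner (U (embed z) (U (embed g) v)) \<eta> =
      (LINT w|lborel. complex_of_real (gauss w) * (phase ((om z g + om (z + g) w) / 2) * h (z + g + w)))" for z
  proof -
    have "cinner (U (embed z) (U (embed g) v)) \<eta> = form \<xi> (U (embed (- g)) (U (embed (- z)) \<eta>))"
      unfolding V_adjoint v ..
    moreover have "cinner (U (embed w) \<xi>) (U (embed (- g)) (U (embed (- z)) \<eta>))
        = phase ((om z g + om (z + g) w) / 2) * h (z + g + w)" for w
    proof -
      have "cinner (U (embed w) \<xi>) (U (embed (- g)) (U (embed (- z)) \<eta>))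
          = cinner (U (embed z) (U (embed g) (U (embed w) \<xi>))) \<eta>"
        unfolding V_adjoint[of z] V_adjoint[of g] ..
      also have "\<dots> = phase (om z g / 2) * (phase (om (z + g) w / 2) * h (z + g + w))"
        unfolding V_mult[of z g] by (simp add: V_mult cinner_scaleC_left h_def)
      finally show ?thesis by (simp add: add_divide_distrib phase_simps(1))
    qed
    ultimately show ?thesis by (simp add: form_def)
  qed
  then have "form (U (embed g) v) \<eta> = (LINT z|lborel. complex_of_real (gauss z) *
      (LINT w|lborel. complex_of_real (gauss w) * (phase ((om z g + om (z + g) w) / 2) * h (z + g + w))))"
    unfolding form_def[of "U (embed g) v"] by (simp only:)
  also have "\<dots> = complex_of_real (sqrt (2 * pi) ^ DIM(phase_space)) * complex_of_real (gauss g) * (LINT u|lborel. complex_of_real (gauss u) * h u)"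
  proof (rule twisted_convolution)
    show "continuous_on UNIV h" unfolding h_def by (intro continuous_intros)
    show "cmod (h z) \<le> norm \<xi> * norm \<eta>" for z unfolding h_def by (rule V_bound)
  qed
  finally show ?thesis by (simp only: form_def[of \<xi>] h_def)
qed

text \<open>Replacing \<open>\<zeta>\<close> by \<open>U (embed g) \<zeta>\<close> multiplies its
  matrix element by the symplectic phase of \<open>g\<close>. If the form vanished, so would all
  these phase integrals, and with them the matrix element at the origin, which is
  \<open>cinner \<zeta> \<zeta>\<close>.\<close>

lemma form_nonzero:
  assumes "\<zeta> \<noteq> (0::'a)"
  shows "\<exists>\<xi> \<eta>. form \<xi> \<eta> \<noteq> 0"
proof (rule ccontr)
  assume "\<not> (\<exists>\<xi> \<eta>. form \<xi> \<eta> \<noteq> 0)"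
  then have zero: "form \<xi> \<eta> = 0" for \<xi> \<eta> by blast
  define h where "h z = cinner (U (embed z) \<zeta>) \<zeta>" for z
  have "h 0 = 0"
  proof (rule gauss_phase_zero)
    show "continuous_on UNIV h" unfolding h_def by (intro continuous_intros)
    show "cmod (h z) \<le> norm \<zeta> * norm \<zeta>" for z unfolding h_def by (rule V_bound)
    fix g
    have "phase (om z g) * h z = cinner (U (embed z) (U (embed g) \<zeta>)) (U (embed g) \<zeta>)" for z
    proof -
      have "cinner (U (embed z) (U (embed g) \<zeta>)) (U (embed g) \<zeta>) = cinner (U (embed (- g)) (U (embed z) (U (embed g) \<zeta>))) \<zeta>"
        unfolding V_adjoint[of "- g"] by simp
      also have "\<dots> = (phase (om z g / 2) * phase (om (- g) (z + g) / 2)) * h z"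
        by (simp add: V_mult[of z g] U_simps(2) V_mult[of "- g"] cinner_scaleC_left h_def)
      also have "om (- g) (z + g) = om z g"
        by (simp add: om_def inner_add_left inner_add_right inner_commute)
      finally show ?thesis by (simp add: phase_simps(1)[symmetric])
    qed
    then have "(LINT z|lborel. complex_of_real (gauss z) * (phase (om z g) * h z)) = form (U (embed g) \<zeta>) (U (embed g) \<zeta>)"
      by (simp add: form_def)
    then show "(LINT z|lborel. complex_of_real (gauss z) * (phase (om z g) * h z)) = 0" by (simp add: zero)
  qed
  then show False using assms by (simp add: h_def embed_simps(4))
qed

text \<open>A nonzero vector \<open>v\<close> in the range of the Gaussian average works after
  normalisation: its orbit function is a multiple of \<open>gauss\<close>, and the value at 0
  identifies the multiple.\<close>

lemma vacuum_exists:
  assumes "\<zeta> \<noteq> (0::'a)"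
  shows "\<exists>\<Omega>. \<forall>z. cinner (U (embed z) \<Omega>) \<Omega> = complex_of_real (gauss z)"
proof -
  obtain \<xi> \<eta> where ne: "form \<xi> \<eta> \<noteq> 0" using form_nonzero[OF assms] by blast
  obtain v where v: "\<And>\<eta>. cinner v \<eta> = form \<xi> \<eta>" using form_represented by blast
  have v0: "v \<noteq> 0" using v[of \<eta>] ne by auto
  define C where "C = complex_of_real (sqrt (2 * pi) ^ DIM(phase_space)) * cnj (form \<xi> \<xi>)"
  have eq: "cinner (U (embed g) v) v = complex_of_real (gauss g) * C" for g
  proof -
    let ?f = "\<lambda>z. complex_of_real (gauss z) * cinner (U (embed z) \<xi>) (U (embed (- g)) v)"
    have m: "?f \<in> borel_measurable borel"
      by (intro borel_measurable_continuous_onI continuous_intros)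
    have "cinner (U (embed g) v) v = (LINT z|lborel. ?f z)"
      unfolding V_adjoint v form_def ..
    \<comment> \<open>The reflection moves the group operator to the other argument and brings the
      integral, up to conjugation, into the shape of \<open>form_twisted\<close>.\<close>
    also have "\<dots> = (LINT z|lborel. ?f ((- 1) *\<^sub>R z))"
      using lborel_integral_scale[OF m, of "- 1"] by simp
    also have "\<dots> = (LINT z|lborel. cnj (complex_of_real (gauss z) * cinner (U (embed z) (U (embed (- g)) v)) \<xi>))"
    proof -
      have "?f ((- 1) *\<^sub>R z) = cnj (complex_of_real (gauss z) * cinner (U (embed z) (U (embed (- g)) v)) \<xi>)" for z
      proof -
        have "cinner (U (embed (- z)) \<xi>) (U (embed (- g)) v) = cinner \<xi> (U (embed z) (U (embed (- g)) v))"
          unfolding V_adjoint[of "- z"] by simp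
        then show ?thesis
          by (simp add: gauss_simps(2) cinner_commute[of \<xi> "U (embed z) (U (embed (- g)) v)"])
      qed
      then show ?thesis by (simp only:)
    qed
    also have "\<dots> = cnj (form (U (embed (- g)) v) \<xi>)" unfolding form_def by (rule Bochner_Integration.integral_cnj)
    also have "\<dots> = complex_of_real (gauss g) * C"
      unfolding form_twisted[OF v] C_def by (simp add: gauss_simps(2) mult_ac)
    finally show ?thesis .
  qed
  have C: "C = complex_of_real ((norm v)\<^sup>2)"
    using eq[of 0] by (simp add: embed_simps(4) gauss_simps(1) cinner_self)
  have "cinner (U (embed z) ((1 / norm v) *\<^sub>R v)) ((1 / norm v) *\<^sub>R v) = complex_of_real (gauss z)" for z
  proof -
    have "cinner (U (embed z) ((1 / norm v) *\<^sub>R v)) ((1 / norm v) *\<^sub>R v)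
        = complex_of_real (1 / norm v) * (complex_of_real (1 / norm v) * (complex_of_real (gauss z) * C))"
      unfolding scaleC_of_real[symmetric] U_simps(2) cinner_simps eq complex_cnj_complex_of_real by (simp add: mult_ac)
    also have "\<dots> = complex_of_real (gauss z)" using v0 unfolding C by (simp add: power2_eq_square)
    finally show ?thesis .
  qed
  then show ?thesis by blast
qed

lemma U_vacuum:
  assumes "\<And>z. cinner (U (embed z) \<Omega>) \<Omega> = complex_of_real (gauss z)"
  shows "cinner (U X \<Omega>) \<Omega> = phase (snd (snd X)) * complex_of_real (gauss (fst X, fst (snd X)))"
proof -
  have "X = embed (fst X, fst (snd X)) + snd (snd X) *\<^sub>R centre"
    by (cases X) (simp add: embed_def centre_def)
  then have "U X \<Omega> = U (embed (fst X, fst (snd X)) + snd (snd X) *\<^sub>R centre) \<Omega>" by (rule arg_cong[where f = "\<lambda>X. U X \<Omega>"])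
  then have "U X \<Omega> = phase (snd (snd X)) *\<^sub>C U (embed (fst X, fst (snd X))) \<Omega>" unfolding U_add_centre .
  then show ?thesis by (simp add: cinner_scaleC_left assms)
qed

text \<open>The right side involves the group law but not the representation, so two representations
  with such vectors have equal Gram matrices on the orbits, as \<open>unitary_extension\<close>
  requires.\<close>

lemma gram_vacuum:
  assumes "\<And>z. cinner (U (embed z) \<Omega>) \<Omega> = complex_of_real (gauss z)"
  defines "k \<equiv> \<lambda>X. phase (snd (snd X)) * complex_of_real (gauss (fst X, fst (snd X)))"
  shows "cinner (U X \<Omega>) (U Y \<Omega>) = k (- Y + X + (symp (- Y) X / 2) *\<^sub>R centre)"
proof -
  have "cinner (U X \<Omega>) (U Y \<Omega>) = cinner (U (- Y) (U X \<Omega>)) \<Omega>" unfolding U_adjoint[of "- Y"] by simp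
  then show ?thesis unfolding U_mult U_vacuum[OF assms(1)] k_def .
qed

end

section \<open>The Fock vacuum and its orbit\<close>

lemma weyl_vacuum: "cinner (weyl (embed z) (coherent 0)) (coherent 0) = complex_of_real (gauss z)"
proof -
  have "hdot (amp (embed z)) (amp (embed z)) / 2 = complex_of_real ((norm z)\<^sup>2 / 4)"
    unfolding hdot_amp_self embed_simps by (cases z) (simp add: norm_Pair)
  then have "cinner (weyl (embed z) (coherent 0)) (coherent 0) = exp (- complex_of_real ((norm z)\<^sup>2 / 4))"
    unfolding weyl displaced_def cinner_scaleC_left cinner_coherent hdot_simps embed_simps \<open>hdot _ _ / 2 = _\<close> by simp
  then show ?thesis by (simp add: gauss_def exp_of_real[symmetric] del: of_real_divide)
qed

interpretation weyl: central_rep weyl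
proof
  fix t \<xi>
  have on_coherent: "weyl (t *\<^sub>R centre) (coherent w) = phase t *\<^sub>C coherent w" for w
  proof -
    have "snd (snd centre) = 1" by (simp add: centre_def)
    then show ?thesis by (simp add: weyl displaced_def amp_linear hdot_simps phase_def)
  qed
  show "weyl (t *\<^sub>R centre) \<xi> = phase t *\<^sub>C \<xi>"
    by (rule total_eqI[OF total_coherent, of "weyl (t *\<^sub>R centre)" "\<lambda>\<xi>. phase t *\<^sub>C \<xi>"])
      (simp_all add: on_coherent unitaryD[OF weyl(1)] bounded_linear_scaleC scaleC_scaleC mult.commute)
qed

lemma total_weyl_vacuum: "total (\<lambda>X. weyl X (coherent 0))"
  unfolding total_def
proof (intro allI impI)
  fix M assume M: "csubspace M \<and> closed M \<and> range (\<lambda>X. weyl X (coherent 0)) \<subseteq> M"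
  have "coherent w \<in> M" for w
  proof -
    \<comment> \<open>The inverse of \<open>amp\<close> on phase space: each coherent vector is a
      scalar multiple of a displaced vacuum.\<close>
    define X :: heis where "X = ((\<chi> l. - sqrt 2 * Re (w $ l)), (\<chi> l. sqrt 2 * Im (w $ l)), 0)"
    have w: "amp X = w"
      by (simp add: amp_def X_def vec_eq_iff complex_eq_iff)
    have "weyl X (coherent 0) = exp (\<i> * complex_of_real (snd (snd X)) - hdot w w / 2 - hdot 0 w) *\<^sub>C coherent w"
      unfolding weyl displaced_def w by simp
    moreover define c where "c = exp (\<i> * complex_of_real (snd (snd X)) - hdot w w / 2 - hdot 0 w)"
    ultimately have "weyl X (coherent 0) = c *\<^sub>C coherent w" by (simp only:)
    moreover have "c \<noteq> 0" unfolding c_def by (rule exp_not_eq_zero)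
    ultimately have "coherent w = (1 / c) *\<^sub>C weyl X (coherent 0)" by (simp add: scaleC_scaleC)
    moreover have "weyl X (coherent 0) \<in> M" using M by blast
    ultimately show ?thesis using M by (simp only: csubspaceD(3))
  qed
  then have "x \<in> M" for x using M by - (rule totalD[OF total_coherent], auto)
  then show "M = UNIV" by blast
qed

section \<open>Uniqueness\<close>

lemma star_rep_presentedD:
  assumes rep: "star_rep (presented R) D \<rho>"
  shows "csubspace D" "closure D = UNIV" "\<xi> \<in> D \<Longrightarrow> \<rho> (cls R p) \<xi> \<in> D"
    "\<xi> \<in> D \<Longrightarrow> \<rho> (cls R p) (c *\<^sub>C \<xi>) = c *\<^sub>C \<rho> (cls R p) \<xi>"
    "\<xi> \<in> D \<Longrightarrow> \<rho> (cls R (p + q)) \<xi> = \<rho> (cls R p) \<xi> + \<rho> (cls R q) \<xi>"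
    "\<xi> \<in> D \<Longrightarrow> \<rho> (cls R (scalar c * p)) \<xi> = c *\<^sub>C \<rho> (cls R p) \<xi>"
    "\<xi> \<in> D \<Longrightarrow> \<rho> (cls R (p * q)) \<xi> = \<rho> (cls R p) (\<rho> (cls R q) \<xi>)"
    "\<xi> \<in> D \<Longrightarrow> \<rho> (cls R (scalar c)) \<xi> = c *\<^sub>C \<xi>"
    "\<rho> (cls R p) 0 = 0"
proof -
  have carr: "cls R p \<in> carrier (presented R)" for p unfolding presented_simps(1) by (rule rangeI)
  show sub: "csubspace D" and "closure D = UNIV"
    and "\<xi> \<in> D \<Longrightarrow> \<rho> (cls R p) \<xi> \<in> D"
    and scale: "\<xi> \<in> D \<Longrightarrow> \<rho> (cls R p) (c *\<^sub>C \<xi>) = c *\<^sub>C \<rho> (cls R p) \<xi>" for \<xi> c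
    using rep carr by (simp_all add: star_rep_def)
  have "\<xi> \<in> D \<Longrightarrow> \<rho> (cls R p \<oplus>\<^bsub>presented R\<^esub> cls R q) \<xi> = \<rho> (cls R p) \<xi> + \<rho> (cls R q) \<xi>"
    and mult: "\<xi> \<in> D \<Longrightarrow> \<rho> (cls R p \<otimes>\<^bsub>presented R\<^esub> cls R q) \<xi> = \<rho> (cls R p) (\<rho> (cls R q) \<xi>)"
    and smult: "\<xi> \<in> D \<Longrightarrow> \<rho> (c \<odot>\<^bsub>presented R\<^esub> cls R p) \<xi> = c *\<^sub>C \<rho> (cls R p) \<xi>"
    and one: "\<xi> \<in> D \<Longrightarrow> \<rho> \<one>\<^bsub>presented R\<^esub> \<xi> = \<xi>" for c p
    using rep carr by (simp_all add: star_rep_def)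
  then show "\<xi> \<in> D \<Longrightarrow> \<rho> (cls R (p + q)) \<xi> = \<rho> (cls R p) \<xi> + \<rho> (cls R q) \<xi>"
    and "\<xi> \<in> D \<Longrightarrow> \<rho> (cls R (p * q)) \<xi> = \<rho> (cls R p) (\<rho> (cls R q) \<xi>)"
    and "\<xi> \<in> D \<Longrightarrow> \<rho> (cls R (scalar c * p)) \<xi> = c *\<^sub>C \<rho> (cls R p) \<xi>"
    unfolding presented_simps by simp_all
  show "\<xi> \<in> D \<Longrightarrow> \<rho> (cls R (scalar c)) \<xi> = c *\<^sub>C \<xi>"
    using smult[of c 1] one unfolding presented_simps by simp
  show "\<rho> (cls R p) 0 = 0"
    using scale[OF csubspaceD(1)[OF sub], of 0] by simp
qed

lemma carrier_presented: "X \<in> carrier (presented R) \<Longrightarrow> \<exists>p. X = cls R p"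
  unfolding presented_simps(1) by blast

lemma irreducible_repD:
  assumes irr: "irreducible_rep A D \<rho>"
  shows "D \<noteq> {0}"
    and "csubspace D1 \<Longrightarrow> csubspace D2 \<Longrightarrow> (\<And>\<xi> \<eta>. \<xi> \<in> D1 \<Longrightarrow> \<eta> \<in> D2 \<Longrightarrow> cinner \<xi> \<eta> = 0) \<Longrightarrow>
      D = {\<xi> + \<eta> |\<xi> \<eta>. \<xi> \<in> D1 \<and> \<eta> \<in> D2} \<Longrightarrow>
      (\<And>X \<xi>. X \<in> carrier A \<Longrightarrow> \<xi> \<in> D1 \<Longrightarrow> \<rho> X \<xi> \<in> D1) \<Longrightarrow>
      (\<And>X \<xi>. X \<in> carrier A \<Longrightarrow> \<xi> \<in> D2 \<Longrightarrow> \<rho> X \<xi> \<in> D2) \<Longrightarrow> D1 = {0} \<or> D2 = {0}"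
proof -
  show "D \<noteq> {0}" by (rule irr[unfolded irreducible_rep_def, THEN conjunct1])
next
  assume D12: "csubspace D1" "csubspace D2" "\<And>\<xi> \<eta>. \<xi> \<in> D1 \<Longrightarrow> \<eta> \<in> D2 \<Longrightarrow> cinner \<xi> \<eta> = 0"
    "D = {\<xi> + \<eta> |\<xi> \<eta>. \<xi> \<in> D1 \<and> \<eta> \<in> D2}" "\<And>X \<xi>. X \<in> carrier A \<Longrightarrow> \<xi> \<in> D1 \<Longrightarrow> \<rho> X \<xi> \<in> D1"
    "\<And>X \<xi>. X \<in> carrier A \<Longrightarrow> \<xi> \<in> D2 \<Longrightarrow> \<rho> X \<xi> \<in> D2"
  show "D1 = {0} \<or> D2 = {0}"
    by (rule irr[unfolded irreducible_rep_def, THEN conjunct2, THEN spec, of D1, THEN spec, of D2, THEN mp])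
      (intro conjI ballI image_subsetI D12; assumption)
qed

section \<open>Integrable representations and their intertwiners\<close>

lemma heis_embed_axis:
  "heis_embed (axis l 1, 0, 0) = scalar (1 / complex_of_real (sqrt 2)) * (adj (gen l) - gen l)"
  "heis_embed (0, axis l 1, 0) = scalar (\<i> / complex_of_real (sqrt 2)) * (adj (gen l) + gen l)"
  "heis_embed centre = scalar \<i>"
proof -
  have 1: "scalar (complex_of_real (axis l 1 $ j / sqrt 2)) * (adj (gen j) - gen j) =
      (if j = l then scalar (1 / complex_of_real (sqrt 2)) * (adj (gen j) - gen j) else 0)"
    and 2: "scalar (\<i> * complex_of_real (axis l 1 $ j / sqrt 2)) * (adj (gen j) + gen j) =
      (if j = l then scalar (\<i> / complex_of_real (sqrt 2)) * (adj (gen j) + gen j) else 0)" for j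
    by (simp_all add: axis_def)
  show "heis_embed (axis l 1, 0, 0) = scalar (1 / complex_of_real (sqrt 2)) * (adj (gen l) - gen l)"
    "heis_embed (0, axis l 1, 0) = scalar (\<i> / complex_of_real (sqrt 2)) * (adj (gen l) + gen l)"
    unfolding heis_embed_altdef fst_conv snd_conv 1 2 by simp_all
  show "heis_embed centre = scalar \<i>" by (simp add: heis_embed_altdef centre_def)
qed

text \<open>The CCR generators lie in the complex span of the embedded Lie algebra, so an operator
  that intertwines the differentials intertwines the whole algebra.\<close>

lemma gen_heis_embed:
  defines "c \<equiv> 1 / complex_of_real (sqrt 2)"
  shows "gen l = scalar (- c) * heis_embed (axis l 1, 0, 0) + scalar (- (\<i> * c)) * heis_embed (0, axis l 1, 0)"
    and "adj (gen l) = scalar c * heis_embed (axis l 1, 0, 0) + scalar (- (\<i> * c)) * heis_embed (0, axis l 1, 0)"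
proof -
  have s: "complex_of_real (sqrt 2) * complex_of_real (sqrt 2) = 2" by (simp flip: of_real_mult)
  have half: "scalar (1 / 2) * p + scalar (1 / 2) * p = p" for p :: "3 free_star"
  proof -
    have "scalar (1 / 2) * p + scalar (1 / 2) * p = scalar (1 / 2 + 1 / 2) * p"
      by (simp only: scalar_simps(2) distrib_right)
    then show ?thesis by (simp add: scalar_simps(1))
  qed
  have c: "c * (1 / complex_of_real (sqrt 2)) = 1 / 2" "- c * (1 / complex_of_real (sqrt 2)) = - (1 / 2)"
    "- (\<i> * c) * (\<i> / complex_of_real (sqrt 2)) = 1 / 2"
    by (simp_all add: c_def s)
  show "gen l = scalar (- c) * heis_embed (axis l 1, 0, 0) + scalar (- (\<i> * c)) * heis_embed (0, axis l 1, 0)"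
    unfolding heis_embed_axis scalar_scalar
    unfolding c scalar_minus
    using half[of "gen l"] by (simp add: distrib_left right_diff_distrib)
  show "adj (gen l) = scalar c * heis_embed (axis l 1, 0, 0) + scalar (- (\<i> * c)) * heis_embed (0, axis l 1, 0)"
    unfolding heis_embed_axis scalar_scalar c
    using half[of "adj (gen l)"] by (simp add: distrib_left right_diff_distrib)
qed

locale integrable = heis_rep U for U :: "heis \<Rightarrow> 'h::complex_hilbert \<Rightarrow> 'h" +
  fixes D :: "'h set" and \<rho> :: "3 free_star set \<Rightarrow> 'h \<Rightarrow> 'h"
  assumes star_rep: "star_rep ccr_algebra D \<rho>" and smooth: "D = smooth_vectors U"
    and diff: "\<xi> \<in> D \<Longrightarrow> \<rho> (cls ccr_relations (heis_embed X)) \<xi> = differential U X \<xi>"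
begin

lemmas rho = star_rep_presentedD[OF star_rep[unfolded ccr_algebra_def]]

lemma centre_on_domain:
  assumes \<xi>: "\<xi> \<in> D"
  shows "U (t *\<^sub>R centre) \<xi> = phase t *\<^sub>C \<xi>"
proof -
  \<comment> \<open>The derivative along the centre is multiplication by \<open>\<i>\<close>, so the
    orbit times the opposite phase is constant.\<close>
  let ?h = "\<lambda>s. phase (- s) *\<^sub>C U (s *\<^sub>R centre) \<xi>"
  have "differential U centre \<xi> = \<i> *\<^sub>C \<xi>"
    using diff[OF \<xi>, of centre] by (simp only: heis_embed_axis rho(8)[OF \<xi>])
  then have "((\<lambda>s. U (s *\<^sub>R centre) \<xi>) has_vector_derivative \<i> *\<^sub>C \<xi>) (at 0)"
    using smooth_differential(1)[of \<xi> centre] \<xi> by (simp add: smooth)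
  from line_derivative[OF this]
  have U': "((\<lambda>s. U (s *\<^sub>R centre) \<xi>) has_vector_derivative \<i> *\<^sub>C U (s *\<^sub>R centre) \<xi>) (at s)" for s
    by (simp add: U_simps(2))
  have p': "((\<lambda>s. phase (- s)) has_vector_derivative - \<i> * phase (- s)) (at s)" for s
  proof -
    have "((\<lambda>z. exp (- \<i> * z)) has_field_derivative - \<i> * exp (- \<i> * complex_of_real s)) (at (complex_of_real s))"
      by (auto intro!: derivative_eq_intros)
    from has_vector_derivative_real_field[OF this] show ?thesis by (simp add: phase_def)
  qed
  have "(?h has_vector_derivative phase (- s) *\<^sub>C \<i> *\<^sub>C U (s *\<^sub>R centre) \<xi> + (- \<i> * phase (- s)) *\<^sub>C U (s *\<^sub>R centre) \<xi>) (at s)" for s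
    by (rule bounded_bilinear.has_vector_derivative[OF bounded_bilinear_scaleC p' U'])
  then have "(?h has_vector_derivative 0) (at s)" for s
    by (simp add: scaleC_scaleC scaleC_add_left[symmetric] mult.commute)
  then obtain k where k: "\<And>s. ?h s = k"
    using has_vector_derivative_zero_constant[of UNIV ?h] by auto
  have "k = \<xi>" using k[of 0] by (simp add: phase_simps)
  then have "phase (- t) *\<^sub>C U (t *\<^sub>R centre) \<xi> = \<xi>" using k[of t] by simp
  then have "phase t *\<^sub>C phase (- t) *\<^sub>C U (t *\<^sub>R centre) \<xi> = phase t *\<^sub>C \<xi>" by simp
  then show ?thesis by (simp add: scaleC_scaleC phase_simps(1)[symmetric] phase_simps(3))
qed

lemma closed_eq_dense:
  assumes "closed S" "D \<subseteq> S"
  shows "x \<in> S"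
proof -
  have "closure D \<subseteq> S" using assms(2,1) by (rule closure_minimal)
  then show ?thesis unfolding rho(2) by blast
qed

end

sublocale integrable \<subseteq> central_rep U
proof
  fix t \<xi>
  have "closed {\<xi>. U (t *\<^sub>R centre) \<xi> = phase t *\<^sub>C \<xi>}"
    by (intro closed_Collect_eq linear_continuous_on U_simps(8) bounded_linear_scaleC)
  then have "\<xi> \<in> {\<xi>. U (t *\<^sub>R centre) \<xi> = phase t *\<^sub>C \<xi>}"
    by (rule closed_eq_dense) (simp add: centre_on_domain subset_iff)
  then show "U (t *\<^sub>R centre) \<xi> = phase t *\<^sub>C \<xi>" by simp
qed

text \<open>The domains consist of the smooth vectors, so a bounded intertwiner of the groups
  respects domains and differentials. It is applied to a projection in \<open>cyclic\<close> and to
  unitaries in \<open>stone_von_neumann\<close>.\<close>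

lemma integrable_intertwine:
  assumes "integrable U D \<rho>" "integrable U' D' \<rho>'"
    and L: "bounded_linear L" "\<And>c x. L (c *\<^sub>C x) = c *\<^sub>C L x" and comm: "\<And>g x. L (U g x) = U' g (L x)"
    and \<xi>: "\<xi> \<in> D"
  shows "L \<xi> \<in> D'" "L (\<rho> (cls ccr_relations p) \<xi>) = \<rho>' (cls ccr_relations p) (L \<xi>)"
proof -
  interpret U: integrable U D \<rho> by fact
  interpret U': integrable U' D' \<rho>' by fact
  note inter = smooth_intertwine[OF U.heis_rep_axioms U'.heis_rep_axioms L(1) comm]
  have D': "L \<xi> \<in> D'" if "\<xi> \<in> D" for \<xi>
    using inter(1)[of \<xi>] that by (simp only: U.smooth U'.smooth)
  then show "L \<xi> \<in> D'" using \<xi> .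
  have embed: "L (\<rho> (cls ccr_relations (heis_embed X)) \<xi>) = \<rho>' (cls ccr_relations (heis_embed X)) (L \<xi>)"
    if "\<xi> \<in> D" for X \<xi>
    unfolding U.diff[OF that] U'.diff[OF D'[OF that]] by (rule inter(2)) (use that U.smooth in simp)
  note L_simps = linear_simps(1)[OF L(1)] L(2)
  show "L (\<rho> (cls ccr_relations p) \<xi>) = \<rho>' (cls ccr_relations p) (L \<xi>)"
    using \<xi>
  proof (induction p arbitrary: \<xi> rule: free_star_induct)
    case (scalar c)
    then show ?case by (simp only: U.rho(8) U'.rho(8) D' L_simps)
  next
    case (gen l)
    then show ?case unfolding gen_heis_embed
      by (simp only: U.rho(5,6) U'.rho(5,6) D' L_simps embed)
  next
    case (adj_gen l)
    then show ?case unfolding gen_heis_embed(2)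
      by (simp only: U.rho(5,6) U'.rho(5,6) D' L_simps embed)
  next
    case (add p q)
    then show ?case by (simp only: U.rho(5) U'.rho(5) D' L_simps)
  next
    case (mult p q)
    then show ?case by (simp only: U.rho(3,7) U'.rho(7) D')
  qed
qed

lemma unitary_inv:
  assumes W: "unitary W"
  shows "unitary (inv_into UNIV W)"
proof -
  note W = unitaryD[OF W]
  define V where "V = inv_into UNIV W"
  have r: "W (V y) = y" for y unfolding V_def by (rule surj_f_inv_f[OF W(4)])
  have l: "V (W x) = x" for x unfolding V_def by (rule inv_f_f[OF bij_is_inj[OF W(9)]])
  have "V (x + y) = V x + V y" for x y using l[of "V x + V y"] by (simp add: W(1) r)
  moreover have "V (c *\<^sub>C x) = c *\<^sub>C V x" for c x using l[of "c *\<^sub>C V x"] by (simp add: W(2) r)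
  moreover have "cinner (V x) (V y) = cinner x y" for x y using W(3)[of "V x" "V y"] by (simp add: r)
  moreover have "surj V" by (rule surjI[of V W]) (rule l)
  ultimately show ?thesis by (simp add: unitary_def V_def)
qed

text \<open>The projection \<open>Q\<close> onto the closed span \<open>K\<close> of the orbit
  commutes with the group and hence restricts to the domain. This turns a splitting of the Hilbert
  space into a splitting of \<open>D\<close>, to which irreducibility applies.\<close>

lemma (in integrable) cyclic:
  assumes irr: "irreducible_rep ccr_algebra D \<rho>"
    and \<Omega>: "\<Omega> \<noteq> 0"
  shows "total (\<lambda>X. U X \<Omega>)"
proof -
  define K where "K = \<Inter>{M. csubspace M \<and> closed M \<and> range (\<lambda>X. U X \<Omega>) \<subseteq> M}"
  have K: "csubspace K" "closed K"
    unfolding K_def by (auto simp: csubspace_def)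
  have orbit: "U X \<Omega> \<in> K" for X unfolding K_def by blast
  have K_least: "x \<in> M" if "x \<in> K" "csubspace M" "closed M" "\<And>X. U X \<Omega> \<in> M" for x M
    using that unfolding K_def by blast
  have inv: "U g x \<in> K" if x: "x \<in> K" for g x
  proof -
    have "csubspace {x. U g x \<in> K}"
      using csubspaceD[OF K(1)] by (simp add: csubspace_def U_simps(1,2,6))
    moreover have "closed {x. U g x \<in> K}"
      using continuous_closed_vimage[OF K(2), of "U g"] linear_continuous_at[OF U_simps(8)] by (simp add: vimage_def)
    moreover have "U X \<Omega> \<in> {x. U g x \<in> K}" for X by (simp only: mem_Collect_eq U_mult orbit)
    ultimately show ?thesis using K_least[OF x] by blast
  qed
  have "\<forall>x. \<exists>m. m \<in> K \<and> (\<forall>y\<in>K. cinner (x - m) y = 0)"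
    using orthogonal_projection[OF K] by blast
  then obtain Q where Q: "\<And>x. Q x \<in> K" "\<And>x y. y \<in> K \<Longrightarrow> cinner (x - Q x) y = 0"
    using choice[of "\<lambda>x m. m \<in> K \<and> (\<forall>y\<in>K. cinner (x - m) y = 0)"] by blast
  have Q_eq: "Q x = m" if m: "m \<in> K" "\<And>y. y \<in> K \<Longrightarrow> cinner (x - m) y = 0" for x m
  proof -
    have "m - Q x \<in> K" by (rule csubspaceD(5)[OF K(1) m(1) Q(1)])
    then have "cinner ((x - Q x) - (x - m)) (m - Q x) = 0"
      using m(2) Q(2) by (simp only: cinner_diff_left diff_zero)
    then show ?thesis by simp
  qed
  have Q_fix: "Q x = x" if "x \<in> K" for x by (rule Q_eq[OF that]) simp
  have Q_add: "Q (x + y) = Q x + Q y" for x y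
  proof (rule Q_eq)
    show "cinner (x + y - (Q x + Q y)) z = 0" if "z \<in> K" for z
      using Q(2)[OF that, of x] Q(2)[OF that, of y] by (simp add: cinner_simps)
  qed (intro csubspaceD(2)[OF K(1)] Q(1))
  have Q_scale: "Q (c *\<^sub>C x) = c *\<^sub>C Q x" for c x
  proof (rule Q_eq)
    show "cinner (c *\<^sub>C x - c *\<^sub>C Q x) z = 0" if "z \<in> K" for z
      using Q(2)[OF that, of x] by (simp add: cinner_simps)
  qed (intro csubspaceD(3)[OF K(1)] Q(1))
  have Q_comm: "Q (U g x) = U g (Q x)" for g x
  proof (rule Q_eq)
    show "cinner (U g x - U g (Q x)) z = 0" if "z \<in> K" for z
      unfolding U_simps(7)[symmetric] U_adjoint by (rule Q(2)[OF inv[OF that]])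
  qed (rule inv[OF Q(1)])
  have Q_norm: "norm (Q x) \<le> norm x" for x
  proof -
    have "(norm (x - Q x + Q x))\<^sup>2 = (norm (x - Q x))\<^sup>2 + (norm (Q x))\<^sup>2"
      unfolding norm_add_square using Q(2)[OF Q(1), of x x] by simp
    then have "(norm (Q x))\<^sup>2 \<le> (norm x)\<^sup>2" by simp
    then show ?thesis by (rule power2_le_imp_le) simp
  qed
  have Q_lin: "bounded_linear Q"
  proof
    show "Q (r *\<^sub>R x) = r *\<^sub>R Q x" for r x using Q_scale[of "complex_of_real r" x] by (simp add: scaleC_of_real)
    show "\<exists>B. \<forall>x. norm (Q x) \<le> norm x * B" by (rule exI[of _ 1]) (simp add: Q_norm)
  qed (rule Q_add)
  note Q_inter = integrable_intertwine[where L = Q and U = U and U' = U, OF integrable_axioms integrable_axioms Q_lin Q_scale Q_comm]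
  have Q_diff: "Q (x - Q x) = 0" for x
    using Q_fix[OF Q(1)[of x]] by (simp add: linear_simps(2)[OF Q_lin])
  let ?D1 = "{\<xi> \<in> D. Q \<xi> = \<xi>}" and ?D2 = "{\<xi> \<in> D. Q \<xi> = 0}"
  note D = csubspaceD[OF rho(1)]
  have "?D1 = {0} \<or> ?D2 = {0}"
  proof (rule irreducible_repD(2)[OF irr])
    show "csubspace ?D1" "csubspace ?D2"
      using D(1,2,3) by (simp_all add: csubspace_def Q_add Q_scale linear_simps(3)[OF Q_lin])
    show "cinner \<xi> \<eta> = 0" if "\<xi> \<in> ?D1" "\<eta> \<in> ?D2" for \<xi> \<eta>
    proof -
      have "\<xi> \<in> K" using that(1) Q(1)[of \<xi>] by simp
      then have "cinner \<eta> \<xi> = 0" using Q(2)[of \<xi> \<eta>] that(2) by simp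
      then show ?thesis using cinner_commute[of \<xi> \<eta>] by simp
    qed
    show "D = {\<xi> + \<eta> |\<xi> \<eta>. \<xi> \<in> ?D1 \<and> \<eta> \<in> ?D2}"
    proof (intro equalityI subsetI)
      fix \<xi> assume \<xi>: "\<xi> \<in> D"
      have "\<xi> = Q \<xi> + (\<xi> - Q \<xi>)" by simp
      moreover have "Q \<xi> \<in> ?D1" using Q_inter(1)[OF \<xi>] Q_fix[OF Q(1)] by simp
      moreover have "\<xi> - Q \<xi> \<in> ?D2" using D(5)[OF \<xi> Q_inter(1)[OF \<xi>]] Q_diff by simp
      ultimately show "\<xi> \<in> {\<xi> + \<eta> |\<xi> \<eta>. \<xi> \<in> ?D1 \<and> \<eta> \<in> ?D2}" by blast
    qed (use D(2) in blast)
    show "\<rho> X \<xi> \<in> ?D1" if X: "X \<in> carrier ccr_algebra" and \<xi>: "\<xi> \<in> ?D1" for X \<xi>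
      using \<xi> carrier_presented[OF X[unfolded ccr_algebra_def]] by (auto simp: rho(3) Q_inter(2))
    show "\<rho> X \<xi> \<in> ?D2" if X: "X \<in> carrier ccr_algebra" and \<xi>: "\<xi> \<in> ?D2" for X \<xi>
      using \<xi> carrier_presented[OF X[unfolded ccr_algebra_def]] by (auto simp: rho(3) Q_inter(2) rho(9))
  qed
  then have K_all: "K = UNIV"
  proof
    \<comment> \<open>\<open>Q\<close> would vanish on the dense domain, hence everywhere, although
      it fixes the nonzero vector \<open>\<Omega>\<close>.\<close>
    assume D1: "?D1 = {0}"
    have "Q \<xi> = 0" if "\<xi> \<in> D" for \<xi>
    proof -
      have "Q \<xi> \<in> ?D1" using Q_inter(1)[OF that] Q_fix[OF Q(1)] by simp
      then show ?thesis unfolding D1 by simp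
    qed
    then have "\<Omega> \<in> {x. Q x = 0}"
      by (intro closed_eq_dense closed_Collect_eq linear_continuous_on Q_lin continuous_on_const) blast
    then show ?thesis using Q_fix[OF orbit[of 0]] \<Omega> by simp
  next
    assume D2: "?D2 = {0}"
    have "D \<subseteq> K"
    proof
      fix \<xi> assume \<xi>: "\<xi> \<in> D"
      have "\<xi> - Q \<xi> \<in> ?D2" using D(5)[OF \<xi> Q_inter(1)[OF \<xi>]] Q_diff by simp
      then have "\<xi> = Q \<xi>" unfolding D2 by simp
      then show "\<xi> \<in> K" using Q(1)[of \<xi>] by simp
    qed
    then show ?thesis using closed_eq_dense[OF K(2)] by blast
  qed
  show ?thesis
    unfolding total_def
  proof (intro allI impI)
    fix M assume M: "csubspace M \<and> closed M \<and> range (\<lambda>X. U X \<Omega>) \<subseteq> M"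
    then have "K \<subseteq> M" unfolding K_def by (rule_tac Inter_lower) simp
    then show "M = UNIV" using K_all by blast
  qed
qed

interpretation fock_weyl: integrable weyl rapidly_decreasing fock_rep
  by standard (simp_all only: star_rep_fock smooth_vectors_weyl fock_rep_cls differential_weyl generator_op_def)

theorem (in integrable) stone_von_neumann:
  assumes irr: "irreducible_rep ccr_algebra D \<rho>"
  shows "\<exists>W. unitary W \<and> W ` D = rapidly_decreasing \<and>
    (\<forall>p. \<forall>\<xi>\<in>D. W (\<rho> (cls ccr_relations p) \<xi>) = fock_rep (cls ccr_relations p) (W \<xi>))"
proof -
  obtain \<zeta> where "\<zeta> \<in> D" "\<zeta> \<noteq> 0" using irreducible_repD(1)[OF irr] csubspaceD(1)[OF rho(1)] by blast
  from vacuum_exists[OF this(2)] obtain \<Omega> where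
    \<Omega>: "\<And>z. cinner (U (embed z) \<Omega>) \<Omega> = complex_of_real (gauss z)" by blast
  have "\<Omega> \<noteq> 0" using \<Omega>[of 0] by (auto simp: embed_simps(4) gauss_simps(1))
  note total = cyclic[OF irr this]
  have "cinner (U X \<Omega>) (U Y \<Omega>) = cinner (weyl X (coherent 0)) (weyl Y (coherent 0))" for X Y
    unfolding gram_vacuum[OF \<Omega>] weyl.gram_vacuum[OF weyl_vacuum] ..
  from unitary_extension[OF this total total_weyl_vacuum]
  obtain W where W: "unitary W" "\<And>X. W (U X \<Omega>) = weyl X (coherent 0)" by blast
  note W_simps = unitaryD[OF W(1)]
  have W_comm: "W (U g x) = weyl g (W x)" for g x
  proof (rule total_eqI[OF total])
    show "bounded_linear (\<lambda>x. W (U g x))" "bounded_linear (\<lambda>x. weyl g (W x))"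
      by (rule bounded_linear_compose; rule W_simps U_simps weyl.U_simps)+
    show "W (U g (c *\<^sub>C x)) = c *\<^sub>C W (U g x)" "weyl g (W (c *\<^sub>C x)) = c *\<^sub>C weyl g (W x)" for c x
      by (simp_all only: W_simps(2) U_simps(2) weyl.U_simps(2))
    show "W (U g (U X \<Omega>)) = weyl g (W (U X \<Omega>))" for X
      by (simp only: U_mult weyl.U_mult W(2))
  qed
  \<comment> \<open>The inverse of \<open>W\<close> is an intertwiner as well, which shows that the
    image of \<open>D\<close> exhausts the Fock domain.\<close>
  define V where "V = inv_into UNIV W"
  have V: "unitary V" unfolding V_def by (rule unitary_inv[OF W(1)])
  have WV: "W (V y) = y" for y unfolding V_def by (rule surj_f_inv_f[OF W_simps(4)])
  have VW: "V (W x) = x" for x unfolding V_def by (rule inv_f_f[OF bij_is_inj[OF W_simps(9)]])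
  have V_comm: "V (weyl g y) = U g (V y)" for g y
    using VW[of "U g (V y)"] by (simp only: W_comm WV)
  note W_inter = integrable_intertwine[where L = W and U = U and U' = weyl, OF integrable_axioms fock_weyl.integrable_axioms W_simps(8) W_simps(2) W_comm]
  note V_inter = integrable_intertwine[where L = V and U = weyl and U' = U, OF fock_weyl.integrable_axioms integrable_axioms
      unitaryD(8)[OF V] unitaryD(2)[OF V] V_comm]
  have "W ` D = rapidly_decreasing"
  proof (intro equalityI subsetI)
    fix y assume "y \<in> rapidly_decreasing"
    from V_inter(1)[OF this] show "y \<in> W ` D" by (rule image_eqI[of y W "V y", OF WV[symmetric]])
  qed (use W_inter(1) in blast)
  then show ?thesis using W(1) W_inter(2) by blast
qed

theorem theorem2:
  fixes x1 x2 :: complex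
  assumes "x1 \<noteq> 0"
  shows "\<exists>\<pi> :: generator free_star set \<Rightarrow> (nat \<times> nat \<times> nat) ell2 \<Rightarrow> (nat \<times> nat \<times> nat) ell2.
    star_rep (A_algebra x1 x2) rapidly_decreasing \<pi> \<and>
    (\<forall>f\<in>rapidly_decreasing. \<forall>n.
       coord (\<pi> (A_elem x1 x2 Ga1) f) n = tensor3 creation id id (coord f) n \<and>
       coord (\<pi> (A_elem x1 x2 Ga2) f) n =
         complex_of_real (sqrt (1 + (cmod x2)\<^sup>2 / (cmod x1)\<^sup>2)) * tensor3 id id creation (coord f) n
         - x2 / complex_of_real (cmod x1) * tensor3 id annihilation id (coord f) n
         + cnj x1 / 2 * tensor3 id (creation \<circ> creation) id (coord f) n
         + complex_of_real (cmod x1) * tensor3 annihilation creation id (coord f) n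
         + x1 / 2 * tensor3 (annihilation \<circ> annihilation) id id (coord f) n \<and>
       coord (\<pi> (A_elem x1 x2 GA) f) n =
         complex_of_real (cmod x1) * tensor3 id creation id (coord f) n
         + x1 * tensor3 annihilation id id (coord f) n) \<and>
    well_behaved x1 x2 rapidly_decreasing \<pi> \<and>
    irreducible_rep (A_algebra x1 x2) rapidly_decreasing \<pi> \<and>
    (\<forall>(D :: 'h::complex_hilbert set) \<rho>.
       well_behaved x1 x2 D \<rho> \<and> irreducible_rep (A_algebra x1 x2) D \<rho> \<longrightarrow>
       unitarily_equivalent (A_algebra x1 x2) D \<rho> rapidly_decreasing \<pi>)"
proof -
  interpret iso_parameters x1 x2 by standard fact
  have "unitarily_equivalent (A_algebra x1 x2) D \<sigma> rapidly_decreasing pi_rep"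
    if wb: "well_behaved x1 x2 D \<sigma>" and irr: "irreducible_rep (A_algebra x1 x2) D \<sigma>"
    for D :: "'h set" and \<sigma>
  proof -
    obtain \<phi> \<rho> where \<phi>: "canonical_iso x1 x2 \<phi>" and int: "integrable_rep D \<rho>"
      and \<sigma>: "\<And>X \<xi>. X \<in> carrier (A_algebra x1 x2) \<Longrightarrow> \<xi> \<in> D \<Longrightarrow> \<sigma> X \<xi> = \<rho> (\<phi> X) \<xi>"
      using wb unfolding well_behaved_def by blast
    obtain U where U: "strongly_continuous_unitary_rep U" "D = smooth_vectors U"
      "\<forall>X. \<forall>\<xi>\<in>D. \<rho> (cls ccr_relations (heis_embed X)) \<xi> = differential U X \<xi>"
      using int[unfolded integrable_rep_def, THEN conjunct2] by (elim exE conjE)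
    interpret integrable U D \<rho>
    proof
      show "strongly_continuous_unitary_rep U" by (rule U(1))
      show "star_rep ccr_algebra D \<rho>" by (rule int[unfolded integrable_rep_def, THEN conjunct1])
      show "D = smooth_vectors U" by (rule U(2))
      show "\<rho> (cls ccr_relations (heis_embed X)) \<xi> = differential U X \<xi>" if "\<xi> \<in> D" for \<xi> X
        using U(3)[THEN spec, of X] that by (rule bspec)
    qed
    have \<sigma>_cls: "\<sigma> (cls (A_relations x1 x2) p) \<xi> = \<rho> (cls ccr_relations (free_hom forward p)) \<xi>" if "\<xi> \<in> D" for p \<xi>
    proof -
      have "cls (A_relations x1 x2) p \<in> carrier (A_algebra x1 x2)"
        unfolding A_algebra_def presented_simps(1) by (rule rangeI)
      from \<sigma>[OF this that] show ?thesis unfolding canonical_iso_cls[OF assms \<phi>] .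
    qed
    \<comment> \<open>Each operator of \<open>\<sigma>\<close> is an operator of
      \<open>\<rho>\<close>, so a decomposition that reduces \<open>\<rho>\<close> reduces
      \<open>\<sigma>\<close>, and irreducibility carries over to the CCR algebra.\<close>
    have "irreducible_rep ccr_algebra D \<rho>"
      unfolding irreducible_rep_def
    proof (intro conjI allI impI; (elim conjE)?)
      show "D \<noteq> {0}" by (rule irreducible_repD(1)[OF irr])
    next
      fix D1 D2
      assume D12: "csubspace D1" "csubspace D2" "\<forall>\<xi>\<in>D1. \<forall>\<eta>\<in>D2. cinner \<xi> \<eta> = 0"
        "D = {\<xi> + \<eta> |\<xi> \<eta>. \<xi> \<in> D1 \<and> \<eta> \<in> D2}"
        and inv: "\<forall>X\<in>carrier ccr_algebra. \<rho> X ` D1 \<subseteq> D1 \<and> \<rho> X ` D2 \<subseteq> D2"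
      have D: "\<xi> + \<eta> \<in> D" if "\<xi> \<in> D1" "\<eta> \<in> D2" for \<xi> \<eta> unfolding D12(4) using that by blast
      have sub: "D1 \<subseteq> D" "D2 \<subseteq> D"
        using D[OF _ csubspaceD(1)[OF D12(2)]] D[OF csubspaceD(1)[OF D12(1)]] by auto
      have \<sigma>_inv: "\<sigma> X \<xi> \<in> E" if X: "X \<in> carrier (A_algebra x1 x2)" and \<xi>: "\<xi> \<in> E" and E: "E = D1 \<or> E = D2" for X \<xi> E
      proof -
        obtain p where X: "X = cls (A_relations x1 x2) p"
          using carrier_presented[OF X[unfolded A_algebra_def]] by blast
        have "cls ccr_relations (free_hom forward p) \<in> carrier ccr_algebra"
          unfolding ccr_algebra_def presented_simps(1) by (rule rangeI)
        then have "\<rho> (cls ccr_relations (free_hom forward p)) \<xi> \<in> E" using inv E \<xi> by blast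
        moreover have "\<xi> \<in> D" using \<xi> E sub by blast
        ultimately show ?thesis by (simp only: X \<sigma>_cls)
      qed
      show "D1 = {0} \<or> D2 = {0}"
      proof (rule irreducible_repD(2)[OF irr D12(1,2) _ D12(4)])
        show "cinner \<xi> \<eta> = 0" if "\<xi> \<in> D1" "\<eta> \<in> D2" for \<xi> \<eta> using D12(3) that by blast
        show "\<sigma> X \<xi> \<in> D1" if "X \<in> carrier (A_algebra x1 x2)" "\<xi> \<in> D1" for X \<xi> by (rule \<sigma>_inv[OF that]) simp
        show "\<sigma> X \<xi> \<in> D2" if "X \<in> carrier (A_algebra x1 x2)" "\<xi> \<in> D2" for X \<xi> by (rule \<sigma>_inv[OF that]) simp
      qed
    qed
    from stone_von_neumann[OF this]
    obtain W where W: "unitary W" "W ` D = rapidly_decreasing"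
      "\<And>p \<xi>. \<xi> \<in> D \<Longrightarrow> W (\<rho> (cls ccr_relations p) \<xi>) = fock_rep (cls ccr_relations p) (W \<xi>)"
      by blast
    have "W (\<sigma> X \<xi>) = pi_rep X (W \<xi>)" if X: "X \<in> carrier (A_algebra x1 x2)" and \<xi>: "\<xi> \<in> D" for X \<xi>
    proof -
      obtain p where X: "X = cls (A_relations x1 x2) p"
        using carrier_presented[OF X[unfolded A_algebra_def]] by blast
      show ?thesis unfolding X \<sigma>_cls[OF \<xi>] W(3)[OF \<xi>] pi_rep_def phi_cls ..
    qed
    then show ?thesis unfolding unitarily_equivalent_def using W(1,2) by blast
  qed
  then show ?thesis
    by (intro exI[of _ pi_rep] conjI allI impI ballI star_rep_pi well_behaved_pi irreducible_pi) (simp_all only: pi_formulas)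
qed

end
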